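(* Let $p \in (1,\infty)$ and let $A_p = -\frac{d}{dx}$ with domain $D(A_p) = W^{1,p}(\mathbb{R})$ be the generator of the shift group $(S(t)f)(s) = f(s-t)$ on $L^p(\mathbb{R})$. Then the inverse operator $A_p^{-1}$, with domain $D(A_p^{-1}) = \operatorname{Rg}(A_p)$, generates a $C_0$-semigroup on $L^p(\mathbb{R})$ if and only if $p = 2$.
   Context: $L^p(\mathbb{R})$ is the space of complex-valued $p$-integrable functions with respect to Lebesgue measure, and $W^{1,p}(\mathbb{R})$ is the usual first-order Sobolev space. The operator $A_p$ is closed, densely defined, injective and has dense range in $L^p(\mathbb{R})$; hence its inverse $A_p^{-1}\colon \operatorname{Rg}(A_p) \to L^p(\mathbb{R})$, which maps $A_p f$ to $f$ for $f \in D(A_p)$, is a well-defined closed, densely defined operator, where $\operatorname{Rg}(A_p)$ denotes the range of $A_p$. An operator "generates a $C_0$-semigroup" if it is the infinitesimal generator of some strongly continuous one-parameter semigroup $(T(t))_{t\ge 0}$ of bounded linear operators (not required to be uniformly bounded in $t$). *)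

theory Defs
  imports "HOL-Analysis.Analysis"
begin

section \<open>Measurable functions modulo equality almost everywhere\<close>

text \<open>
  Representatives are Borel measurable. Every Lebesgue measurable function agrees almost everywhere
  with a Borel measurable one, so the classes are those of the Lebesgue measurable functions.
\<close>

definition ae_eq :: "(real \<Rightarrow> complex) \<Rightarrow> (real \<Rightarrow> complex) \<Rightarrow> bool" where
  "ae_eq f g \<longleftrightarrow> f \<in> borel_measurable lborel \<and> g \<in> borel_measurable lborel \<and>
     (AE x in lborel. f x = g x)"

quotient_type L0 = "real \<Rightarrow> complex" / partial: ae_eq
proof (rule part_equivpI)
  show "\<exists>f. ae_eq f f"
    by (rule exI[of _ "\<lambda>_. 0"]) (simp add: ae_eq_def)
  show "symp ae_eq"
    by (auto simp: symp_def ae_eq_def elim: eventually_mono)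
  show "transp ae_eq"
    unfolding transp_def ae_eq_def
  proof (intro allI impI conjI)
    fix f g h :: "real \<Rightarrow> complex"
    assume 1: "f \<in> borel_measurable lborel \<and> g \<in> borel_measurable lborel \<and> (AE x in lborel. f x = g x)"
      and 2: "g \<in> borel_measurable lborel \<and> h \<in> borel_measurable lborel \<and> (AE x in lborel. g x = h x)"
    show "f \<in> borel_measurable lborel" "h \<in> borel_measurable lborel" using 1 2 by auto
    from 1 2 have "AE x in lborel. f x = g x" "AE x in lborel. g x = h x" by auto
    then show "AE x in lborel. f x = h x" by eventually_elim simp
  qed
qed

instantiation L0 :: ab_group_add
begin

lift_definition zero_L0 :: L0 is "\<lambda>_. 0"
  by (simp add: ae_eq_def)

lift_definition plus_L0 :: "L0 \<Rightarrow> L0 \<Rightarrow> L0" is "\<lambda>f g x. f x + g x"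
  unfolding ae_eq_def by (auto intro: borel_measurable_add elim: eventually_elim2)

lift_definition uminus_L0 :: "L0 \<Rightarrow> L0" is "\<lambda>f x. - f x"
  unfolding ae_eq_def by (auto elim: eventually_mono)

lift_definition minus_L0 :: "L0 \<Rightarrow> L0 \<Rightarrow> L0" is "\<lambda>f g x. f x - g x"
  unfolding ae_eq_def by (auto intro: borel_measurable_diff elim: eventually_elim2)

instance
  by standard (transfer; auto simp: ae_eq_def algebra_simps)+

end

lift_definition scaleC :: "complex \<Rightarrow> L0 \<Rightarrow> L0" is "\<lambda>c f x. c * f x"
  unfolding ae_eq_def by (auto elim: eventually_mono)

interpretation L0: vector_space scaleC
  by standard (transfer; auto simp: ae_eq_def algebra_simps)+


section \<open>The spaces $L^p(\<real>)$ and $W^{1,p}(\<real>)$\<close>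

lift_definition p_integrable :: "real \<Rightarrow> L0 \<Rightarrow> bool" is
  "\<lambda>p f. integrable lborel (\<lambda>x. norm (f x) powr p)"
  unfolding ae_eq_def by (intro integrable_cong_AE) (auto elim: eventually_mono)

definition Lp :: "real \<Rightarrow> L0 set" where
  "Lp p = {f. p_integrable p f}"

lift_definition Lp_norm :: "real \<Rightarrow> L0 \<Rightarrow> real" is
  "\<lambda>p f. (LINT x|lborel. norm (f x) powr p) powr (1 / p)"
  unfolding ae_eq_def
  by (intro arg_cong2[where f = "(powr)"] integral_cong_AE refl) (auto elim: eventually_mono)

definition test_function :: "(real \<Rightarrow> real) \<Rightarrow> bool" where
  "test_function \<phi> \<longleftrightarrow>
     (\<forall>n. (deriv ^^ n) \<phi> differentiable_on UNIV) \<and> compact (closure {x. \<phi> x \<noteq> 0})"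

text \<open>
  The Bochner integral of a non-integrable function is 0, so this is only meaningful for locally
  integrable classes, in particular for members of \<open>Lp p\<close> with \<open>p \<ge> 1\<close>.
\<close>

lift_definition weak_derivative :: "L0 \<Rightarrow> L0 \<Rightarrow> bool" is
  "\<lambda>f g. \<forall>\<phi>. test_function \<phi> \<longrightarrow>
     (LINT x|lborel. f x * of_real (deriv \<phi> x)) = - (LINT x|lborel. g x * of_real (\<phi> x))"
proof -
  have *: "(LINT x|lborel. f x * of_real (h x)) = (LINT x|lborel. g x * of_real (h x))"
    if "ae_eq f g" and h: "h \<in> borel_measurable borel" for f g :: "real \<Rightarrow> complex" and h
    using that unfolding ae_eq_def
    by (intro integral_cong_AE) (auto elim: eventually_mono)
  have meas: "\<phi> \<in> borel_measurable borel" "deriv \<phi> \<in> borel_measurable borel"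
    if "test_function \<phi>" for \<phi>
  proof -
    have "(deriv ^^ n) \<phi> \<in> borel_measurable borel" for n
      using that unfolding test_function_def
      by (intro borel_measurable_continuous_onI differentiable_imp_continuous_on) blast
    from this[of 0] this[of 1] show "\<phi> \<in> borel_measurable borel" "deriv \<phi> \<in> borel_measurable borel"
      by simp_all
  qed
  show "?thesis f1 f2 g1 g2" if "ae_eq f1 f2" "ae_eq g1 g2" for f1 f2 g1 g2
    using *[OF that(1) meas(2)] *[OF that(2) meas(1)] by (simp cong: imp_cong)
qed

definition W1p :: "real \<Rightarrow> L0 set" where
  "W1p p = {f \<in> Lp p. \<exists>g \<in> Lp p. weak_derivative f g}"


section \<open>Operators, $C_0$-semigroups and generators on $L^p(\<real>)$\<close>

text \<open>
  An unbounded operator is represented by its graph: its domain is \<^const>\<open>Domain\<close>, its range is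
  \<^const>\<open>Range\<close>, the inverse of an injective operator is \<^const>\<open>converse\<close>, and equality of operators
  includes equality of their domains.
\<close>

definition neg_ddx :: "real \<Rightarrow> (L0 \<times> L0) set" where
  "neg_ddx p = {(f, - g) | f g. f \<in> W1p p \<and> g \<in> Lp p \<and> weak_derivative f g}"

lemma Domain_neg_ddx: "Domain (neg_ddx p) = W1p p"
  unfolding neg_ddx_def W1p_def by auto

definition bounded_operator :: "real \<Rightarrow> (L0 \<Rightarrow> L0) \<Rightarrow> bool" where
  "bounded_operator p T \<longleftrightarrow>
     (\<forall>f \<in> Lp p. T f \<in> Lp p) \<and>
     (\<forall>f \<in> Lp p. \<forall>g \<in> Lp p. T (f + g) = T f + T g) \<and>
     (\<forall>c. \<forall>f \<in> Lp p. T (scaleC c f) = scaleC c (T f)) \<and>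
     (\<exists>K. \<forall>f \<in> Lp p. Lp_norm p (T f) \<le> K * Lp_norm p f)"

definition C0_semigroup :: "real \<Rightarrow> (real \<Rightarrow> L0 \<Rightarrow> L0) \<Rightarrow> bool" where
  "C0_semigroup p T \<longleftrightarrow>
     (\<forall>t \<ge> 0. bounded_operator p (T t)) \<and>
     (\<forall>f \<in> Lp p. T 0 f = f) \<and>
     (\<forall>s \<ge> 0. \<forall>t \<ge> 0. \<forall>f \<in> Lp p. T (s + t) f = T s (T t f)) \<and>
     (\<forall>f \<in> Lp p. \<forall>s \<ge> 0. ((\<lambda>t. Lp_norm p (T t f - T s f)) \<longlongrightarrow> 0) (at s within {0..}))"

definition generator :: "real \<Rightarrow> (real \<Rightarrow> L0 \<Rightarrow> L0) \<Rightarrow> (L0 \<times> L0) set" where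
  "generator p T = {(f, g). f \<in> Lp p \<and> g \<in> Lp p \<and>
     ((\<lambda>t. Lp_norm p (scaleC (of_real (1 / t)) (T t f - f) - g)) \<longlongrightarrow> 0) (at_right 0)}"

definition generates_C0_semigroup :: "real \<Rightarrow> (L0 \<times> L0) set \<Rightarrow> bool" where
  "generates_C0_semigroup p A \<longleftrightarrow> (\<exists>T. C0_semigroup p T \<and> generator p T = A)"

end

theory Submission imports Defs "HOL-Probability.Probability" begin

text \<open>
  For \<open>p \<noteq> 2\<close> there are explicit solutions \<open>u\<close> of \<open>u' = A\<^sub>p\<^sup>-\<^sup>1 u\<close>, depending on a parameter \<open>d > 0\<close>,
  with \<open>\<parallel>u (d sinh s)\<parallel>\<^sup>p = C (cosh s)\<^sup>1\<^sup>-\<^sup>p\<^sup>/\<^sup>2\<close> where \<open>C\<close> depends on \<open>d\<close> only. A semigroup would have to map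
  \<open>u 0\<close> to \<open>u 1\<close> and \<open>u (-1)\<close> to \<open>u 0\<close>. Letting \<open>d \<rightarrow> 0\<close>, the quotient of the norms is unbounded in the
  first case if \<open>p < 2\<close> and in the second one if \<open>p > 2\<close>.

  For \<open>p = 2\<close> the operator \<open>A\<^sub>2\<close> is skew-adjoint, so that \<open>1 - m (m - A\<^sub>2)\<^sup>-\<^sup>1 = (1 - m A\<^sub>2\<^sup>-\<^sup>1)\<^sup>-\<^sup>1\<close> is a
  contraction, and \<open>A\<^sub>2\<^sup>-\<^sup>1\<close> generates a contraction semigroup by the theorem of Hille and Yosida.
\<close>

section \<open>The norm of $L^p$\<close>

text \<open>The equation \<open>u' = A\<^sub>p\<^sup>-\<^sup>1 u\<close> says
  \<open>- \<partial>\<^sub>x \<partial>\<^sub>t u = u\<close>. With \<open>a = 1 - \<i> x\<close>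
  and \<open>b = d - \<i> t\<close> it becomes
  \<open>\<partial>\<^sub>a \<partial>\<^sub>b u = u\<close>, which has elementary solutions that
  decay as long as both roots stay in the right half plane. In the coordinates
  \<open>x = sinh y\<close>, \<open>t = d sinh s\<close> the evolution is a translation in
  \<open>y\<close>, up to a factor depending on \<open>s\<close>. The weight \<open>cosh y\<close>
  of the substitution contributes \<open>cosh s\<close>, the factor \<open>1 / \<surd>b\<close>
  contributes its power \<open>-p/2\<close>, and the two balance only for \<open>p = 2\<close>. As
  only \<open>T 1\<close> has to be bounded, growth of the semigroup in \<open>t\<close> is no
  obstacle to the argument. It does matter for showing that a semigroup must follow the explicit
  solution: this takes local boundedness, hence the uniform boundedness principle. For
  \<open>p = 2\<close> the contraction estimate is an energy identity for an explicit kernel.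
  Dissipativity on the whole graph takes uniqueness of weak solutions of \<open>w' = - m w\<close>
  in \<open>L\<^sup>2\<close>, for which enough test functions are constructed.\<close>

lemma rep_L0_measurable [measurable]: "rep_L0 F \<in> borel_measurable borel"
  using Quotient3_rep_reflp[OF Quotient3_L0, of F] by (simp add: ae_eq_def)

lemma abs_rep_L0: "abs_L0 (rep_L0 F) = F"
  by (rule Quotient3_abs_rep[OF Quotient3_L0])

lemma L0_cases:
  obtains f where "f \<in> borel_measurable borel" "F = abs_L0 f"
  using rep_L0_measurable abs_rep_L0 by metis

lemma ae_eq_refl: "f \<in> borel_measurable borel \<Longrightarrow> ae_eq f f"
  by (simp add: ae_eq_def)

lemma abs_L0_eq_iff:
  assumes "f \<in> borel_measurable borel" "g \<in> borel_measurable borel"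
  shows "abs_L0 f = abs_L0 g \<longleftrightarrow> (AE x in lborel. f x = g x)"
  using Quotient3_rel[OF Quotient3_L0, of f g] assms by (auto simp: ae_eq_def)

lemma abs_L0_add:
  assumes "f \<in> borel_measurable borel" "g \<in> borel_measurable borel"
  shows "abs_L0 f + abs_L0 g = abs_L0 (\<lambda>x. f x + g x)"
  using assms by (simp add: plus_L0.abs_eq ae_eq_refl)

lemma abs_L0_diff:
  assumes "f \<in> borel_measurable borel" "g \<in> borel_measurable borel"
  shows "abs_L0 f - abs_L0 g = abs_L0 (\<lambda>x. f x - g x)"
  using assms by (simp add: minus_L0.abs_eq ae_eq_refl)

lemma abs_L0_uminus: "f \<in> borel_measurable borel \<Longrightarrow> - abs_L0 f = abs_L0 (\<lambda>x. - f x)"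
  by (simp add: uminus_L0.abs_eq ae_eq_refl)

lemma abs_L0_scaleC: "f \<in> borel_measurable borel \<Longrightarrow> scaleC c (abs_L0 f) = abs_L0 (\<lambda>x. c * f x)"
  by (simp add: scaleC.abs_eq ae_eq_refl)

lemmas abs_L0_arith = abs_L0_add abs_L0_diff abs_L0_uminus abs_L0_scaleC

lemma zero_L0_abs: "0 = abs_L0 (\<lambda>x. 0)"
  by (simp add: zero_L0_def)

lemma abs_in_Lp:
  assumes "f \<in> borel_measurable borel"
  shows "abs_L0 f \<in> Lp p \<longleftrightarrow> integrable lborel (\<lambda>x. norm (f x) powr p)"
  using assms by (simp add: Lp_def p_integrable.abs_eq ae_eq_refl)

lemma Lp_norm_abs:
  assumes "f \<in> borel_measurable borel"
  shows "Lp_norm p (abs_L0 f) = (LINT x|lborel. norm (f x) powr p) powr (1 / p)"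
  using assms by (simp add: Lp_norm.abs_eq ae_eq_refl)

lemma weak_derivative_abs:
  assumes "f \<in> borel_measurable borel" "g \<in> borel_measurable borel"
  shows "weak_derivative (abs_L0 f) (abs_L0 g) \<longleftrightarrow> (\<forall>\<phi>. test_function \<phi> \<longrightarrow>
     (LINT x|lborel. f x * of_real (deriv \<phi> x)) = - (LINT x|lborel. g x * of_real (\<phi> x)))"
  using assms by (simp add: weak_derivative.abs_eq ae_eq_refl)

text \<open>Pointwise core of Minkowski's inequality: \<open>(u + v) / (A + B)\<close> is the convex
  combination of \<open>u / A\<close> and \<open>v / B\<close> with weights
  \<open>A / (A + B)\<close> and \<open>B / (A + B)\<close>. If \<open>A\<close> and
  \<open>B\<close> bound the two norms, the bracket integrates to at most 1.\<close>

lemma powr_add_convex: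
  fixes u v A B p :: real
  assumes "1 \<le> p" "0 \<le> u" "0 \<le> v" "0 < A" "0 < B"
  shows "(u + v) powr p \<le> (A + B) powr p * (A / (A + B) * (u powr p / A powr p) + B / (A + B) * (v powr p / B powr p))"
proof -
  \<comment> \<open>Settles the cases of \<open>key\<close> in which one argument is 0.\<close>
  have scal: "(t * w) powr p \<le> t * w powr p" if "0 \<le> t" "t \<le> 1" "0 \<le> w" for t w :: real
  proof -
    have "t powr p \<le> t"
      using that assms(1) powr_mono'[of 1 p t] by (cases "t = 0") auto
    then show ?thesis using that by (simp add: powr_mult mult_right_mono)
  qed
  have key: "(t * x + s * y) powr p \<le> t * x powr p + s * y powr p"
    if "0 \<le> x" "0 \<le> y" "0 < t" "0 < s" "t + s = 1" for t s x y :: real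
  proof -
    have "x = 0 \<or> y = 0 \<or> (0 < x \<and> 0 < y)" using that by linarith
    then consider "x = 0" | "y = 0" | "0 < x" "0 < y" by blast
    then show ?thesis
    proof cases
      case 1 then show ?thesis using scal[of s y] that assms by simp
    next
      case 2 then show ?thesis using scal[of t x] that assms by simp
    next
      case 3
      have s: "s = 1 - t" using that by simp
      show ?thesis
        using convex_onD[OF powr_convex[OF assms(1)], of s x y] 3 that by (simp add: s)
    qed
  qed
  have "(u + v) powr p = (A + B) powr p * (A / (A + B) * (u / A) + B / (A + B) * (v / B)) powr p"
  proof -
    have "A / (A + B) * (u / A) + B / (A + B) * (v / B) = (u + v) / (A + B)"
      using assms by (simp add: add_divide_distrib)
    then show ?thesis using assms by (simp add: powr_divide)
  qed
  also have "\<dots> \<le> (A + B) powr p * (A / (A + B) * (u / A) powr p + B / (A + B) * (v / B) powr p)"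
    using assms by (intro mult_left_mono key) (auto simp: add_divide_distrib[symmetric])
  also have "(u / A) powr p = u powr p / A powr p" using assms by (simp add: powr_divide)
  also have "(v / B) powr p = v powr p / B powr p" using assms by (simp add: powr_divide)
  finally show ?thesis .
qed

lemma Lp_norm_nonneg [simp]: "0 \<le> Lp_norm p F"
  by transfer simp

lemma integral_powr_norm:
  assumes [measurable]: "f \<in> borel_measurable borel" and "p \<noteq> 0"
  shows "(LINT x|lborel. norm (f x) powr p) = Lp_norm p (abs_L0 f) powr p"
  using assms by (simp add: Lp_norm_abs powr_powr powr_one integral_nonneg_AE)

lemma Lp_norm_le_iff:
  assumes [measurable]: "f \<in> borel_measurable borel" and "p > 0" "A \<ge> 0"
  shows "Lp_norm p (abs_L0 f) \<le> A \<longleftrightarrow> (LINT x|lborel. norm (f x) powr p) \<le> A powr p"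
  using assms by (simp add: integral_powr_norm powr_le_cancel_iff powr_mono_both)
    (metis Lp_norm_nonneg linorder_not_le powr_less_mono2 powr_mono2 less_eq_real_def)

text \<open>Positive upper bounds \<open>A\<close> and \<open>B\<close> take the place of the norms,
  since a norm may be 0 and could not be divided by. The triangle inequality follows by adding an
  arbitrarily small excess to both norms.\<close>

lemma Lp_add_le:
  fixes p :: real
  assumes p: "1 \<le> p" and "F \<in> Lp p" "G \<in> Lp p"
    and "Lp_norm p F \<le> A" "Lp_norm p G \<le> B" "0 < A" "0 < B"
  shows "F + G \<in> Lp p \<and> Lp_norm p (F + G) \<le> A + B"
proof -
  obtain f where f [measurable]: "f \<in> borel_measurable borel" and F: "F = abs_L0 f" by (rule L0_cases)
  obtain g where g [measurable]: "g \<in> borel_measurable borel" and G: "G = abs_L0 g" by (rule L0_cases)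
  let ?b = "\<lambda>x. (A + B) powr p * (A / (A + B) * (norm (f x) powr p / A powr p) + B / (A + B) * (norm (g x) powr p / B powr p))"
  have i: "integrable lborel (\<lambda>x. norm (f x) powr p)" "integrable lborel (\<lambda>x. norm (g x) powr p)"
    using assms by (auto simp: F G abs_in_Lp)
  have ib: "integrable lborel ?b" using i by simp
  have le: "norm (f x + g x) powr p \<le> ?b x" for x
  proof -
    have "norm (f x + g x) powr p \<le> (norm (f x) + norm (g x)) powr p"
      using p by (intro powr_mono2) (auto intro: norm_triangle_ineq)
    also have "\<dots> \<le> ?b x" using assms by (intro powr_add_convex) auto
    finally show ?thesis .
  qed
  have isum: "integrable lborel (\<lambda>x. norm (f x + g x) powr p)"
  proof (rule Bochner_Integration.integrable_bound[OF ib])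
    show "AE x in lborel. norm (norm (f x + g x) powr p) \<le> norm (?b x)"
      using le by (intro AE_I2) (smt (verit) powr_ge_zero real_norm_def)
  qed measurable
  have l1: "(LINT x|lborel. norm (f x) powr p) \<le> A powr p"
    using Lp_norm_le_iff[of f p A] assms by (simp add: F)
  have l2: "(LINT x|lborel. norm (g x) powr p) \<le> B powr p"
    using Lp_norm_le_iff[of g p B] assms by (simp add: G)
  have "(LINT x|lborel. norm (f x + g x) powr p) \<le> (LINT x|lborel. ?b x)"
    using isum ib le by (intro integral_mono)
  also have "\<dots> = (A + B) powr p * (A / (A + B) * ((LINT x|lborel. norm (f x) powr p) / A powr p) + B / (A + B) * ((LINT x|lborel. norm (g x) powr p) / B powr p))"
    using i by simp
  also have "\<dots> \<le> (A + B) powr p * (A / (A + B) * 1 + B / (A + B) * 1)"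
    using l1 l2 assms by (intro mult_left_mono add_mono) (auto simp: divide_le_eq)
  also have "\<dots> = (A + B) powr p"
    using assms by (simp add: add_divide_distrib[symmetric])
  finally have "Lp_norm p (F + G) \<le> A + B"
    using assms p by (simp add: F G abs_L0_arith Lp_norm_le_iff)
  then show ?thesis using isum by (simp add: F G abs_L0_arith abs_in_Lp)
qed

lemma Lp_add: "1 \<le> p \<Longrightarrow> F \<in> Lp p \<Longrightarrow> G \<in> Lp p \<Longrightarrow> F + G \<in> Lp p"
  using Lp_add_le[of p F G "Lp_norm p F + 1" "Lp_norm p G + 1"] by (simp add: add_nonneg_pos)

lemma Lp_norm_triangle:
  assumes "1 \<le> p" "F \<in> Lp p" "G \<in> Lp p"
  shows "Lp_norm p (F + G) \<le> Lp_norm p F + Lp_norm p G"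
proof (rule field_le_epsilon)
  fix e :: real assume "e > 0"
  then show "Lp_norm p (F + G) \<le> Lp_norm p F + Lp_norm p G + e"
    using Lp_add_le[of p F G "Lp_norm p F + e / 2" "Lp_norm p G + e / 2"] assms by (simp add: add_nonneg_pos)
qed

lemma Lp_zero [simp]: "0 \<in> Lp p" and Lp_norm_zero [simp]: "Lp_norm p 0 = 0"
  by (simp_all add: zero_L0_abs abs_in_Lp Lp_norm_abs)

lemma Lp_scaleC: "F \<in> Lp p \<Longrightarrow> scaleC c F \<in> Lp p"
  by (cases F rule: L0_cases) (auto simp: abs_L0_arith abs_in_Lp norm_mult powr_mult)

lemma Lp_norm_scaleC:
  assumes "p > 0" shows "Lp_norm p (scaleC c F) = norm c * Lp_norm p F"
  using assms by (cases F rule: L0_cases)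
    (auto simp: abs_L0_arith Lp_norm_abs norm_mult powr_mult powr_powr integral_nonneg_AE)

lemma scaleC_minus_one: "scaleC (-1) F = - F"
  by (simp add: L0.scale_minus_left)

lemma Lp_uminus: "F \<in> Lp p \<Longrightarrow> - F \<in> Lp p"
  using Lp_scaleC[of F p "-1"] by (simp add: scaleC_minus_one)

lemma Lp_norm_uminus: "p > 0 \<Longrightarrow> Lp_norm p (- F) = Lp_norm p F"
  using Lp_norm_scaleC[of p "-1" F] by (simp add: scaleC_minus_one)

lemma Lp_diff: "1 \<le> p \<Longrightarrow> F \<in> Lp p \<Longrightarrow> G \<in> Lp p \<Longrightarrow> F - G \<in> Lp p"
  using Lp_add[of p F "-G"] by (simp add: Lp_uminus)

lemma Lp_norm_minus_commute: "p > 0 \<Longrightarrow> Lp_norm p (F - G) = Lp_norm p (G - F)"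
  using Lp_norm_uminus[of p "F - G"] by simp

lemma Lp_norm_triangle_diff:
  assumes "1 \<le> p" "F \<in> Lp p" "G \<in> Lp p"
  shows "Lp_norm p (F - G) \<le> Lp_norm p F + Lp_norm p G"
  using Lp_norm_triangle[of p F "-G"] assms by (simp add: Lp_uminus Lp_norm_uminus)

lemma Lp_norm_triangle_sub:
  assumes "1 \<le> p" "F \<in> Lp p" "G \<in> Lp p"
  shows "Lp_norm p F \<le> Lp_norm p G + Lp_norm p (F - G)"
  using Lp_norm_triangle[of p G "F - G"] assms by (simp add: Lp_diff)

lemma Lp_norm_eq_0_iff:
  assumes "p > 0" "F \<in> Lp p"
  shows "Lp_norm p F = 0 \<longleftrightarrow> F = 0"
proof -
  obtain f where [measurable]: "f \<in> borel_measurable borel" and F: "F = abs_L0 f" by (rule L0_cases)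
  have "integrable lborel (\<lambda>x. norm (f x) powr p)" using assms by (simp add: F abs_in_Lp)
  then have "(LINT x|lborel. norm (f x) powr p) = 0 \<longleftrightarrow> (AE x in lborel. norm (f x) powr p = 0)"
    by (intro integral_nonneg_eq_0_iff_AE) auto
  then show ?thesis by (simp add: F Lp_norm_abs zero_L0_abs abs_L0_eq_iff)
qed

text \<open>Packs membership and norm bound into one inequality between nonnegative integrals, to
  which Fatou's lemma applies before the limit is known to be integrable.\<close>

lemma Lp_iff_nn_integral:
  assumes [measurable]: "f \<in> borel_measurable borel" and "p > 0" "A \<ge> 0"
  shows "abs_L0 f \<in> Lp p \<and> Lp_norm p (abs_L0 f) \<le> A \<longleftrightarrow>
    (\<integral>\<^sup>+x. ennreal (norm (f x) powr p) \<partial>lborel) \<le> ennreal (A powr p)"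
proof
  assume l: "abs_L0 f \<in> Lp p \<and> Lp_norm p (abs_L0 f) \<le> A"
  then have "(\<integral>\<^sup>+x. ennreal (norm (f x) powr p) \<partial>lborel) = ennreal (LINT x|lborel. norm (f x) powr p)"
    by (intro nn_integral_eq_integral) (auto simp: abs_in_Lp)
  with l assms show "(\<integral>\<^sup>+x. ennreal (norm (f x) powr p) \<partial>lborel) \<le> ennreal (A powr p)"
    by (simp add: Lp_norm_le_iff ennreal_leI)
next
  assume r: "(\<integral>\<^sup>+x. ennreal (norm (f x) powr p) \<partial>lborel) \<le> ennreal (A powr p)"
  then have i: "integrable lborel (\<lambda>x. norm (f x) powr p)"
    by (intro integrableI_bounded) (auto simp: le_less_trans[OF r])
  then have "(\<integral>\<^sup>+x. ennreal (norm (f x) powr p) \<partial>lborel) = ennreal (LINT x|lborel. norm (f x) powr p)"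
    by (intro nn_integral_eq_integral) auto
  with r have "(LINT x|lborel. norm (f x) powr p) \<le> A powr p"
    by simp
  with i show "abs_L0 f \<in> Lp p \<and> Lp_norm p (abs_L0 f) \<le> A"
    using assms by (simp add: abs_in_Lp Lp_norm_le_iff)
qed

lemma nn_integral_powr_fatou:
  fixes f :: "nat \<Rightarrow> real \<Rightarrow> complex"
  assumes [measurable]: "\<And>k. f k \<in> borel_measurable borel" "g \<in> borel_measurable borel" "h \<in> borel_measurable borel"
    and lim: "AE x in lborel. (\<lambda>k. f k x) \<longlonglongrightarrow> g x" and "p > 0"
    and le: "eventually (\<lambda>k. (\<integral>\<^sup>+x. ennreal (norm (f k x - h x) powr p) \<partial>lborel) \<le> c) sequentially"
  shows "(\<integral>\<^sup>+x. ennreal (norm (g x - h x) powr p) \<partial>lborel) \<le> c"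
proof -
  have "AE x in lborel. ennreal (norm (g x - h x) powr p) = liminf (\<lambda>k. ennreal (norm (f k x - h x) powr p))"
    using lim
  proof eventually_elim
    case (elim x)
    have "(\<lambda>k. ennreal (norm (f k x - h x) powr p)) \<longlonglongrightarrow> ennreal (norm (g x - h x) powr p)"
      using elim \<open>p > 0\<close> by (intro tendsto_intros tendsto_powr') auto
    then show ?case by (rule lim_imp_Liminf[OF trivial_limit_sequentially, symmetric])
  qed
  then have "(\<integral>\<^sup>+x. ennreal (norm (g x - h x) powr p) \<partial>lborel)
      = (\<integral>\<^sup>+x. liminf (\<lambda>k. ennreal (norm (f k x - h x) powr p)) \<partial>lborel)"
    by (rule nn_integral_cong_AE)
  also have "\<dots> \<le> liminf (\<lambda>k. \<integral>\<^sup>+x. ennreal (norm (f k x - h x) powr p) \<partial>lborel)"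
    by (intro nn_integral_liminf) measurable
  also have "\<dots> \<le> limsup (\<lambda>k. \<integral>\<^sup>+x. ennreal (norm (f k x - h x) powr p) \<partial>lborel)"
    by (rule Liminf_le_Limsup) simp
  also have "\<dots> \<le> c" by (rule Limsup_bounded[OF le])
  finally show ?thesis .
qed

text \<open>Half of the decay \<open>(1/4) ^ k\<close> is spent on the factor \<open>2 ^ k\<close>:
  the scaled increments still have summable integrals, so almost everywhere they are eventually
  below 1, and the increments themselves are eventually below \<open>(1/2) ^ k\<close>.\<close>

lemma AE_convergent_of_fast_Cauchy:
  fixes f :: "nat \<Rightarrow> real \<Rightarrow> complex"
  assumes [measurable]: "\<And>k. f k \<in> borel_measurable borel" and "p \<ge> 1"
    and le: "\<And>k. (\<integral>\<^sup>+x. ennreal (norm (f (Suc k) x - f k x) powr p) \<partial>lborel) \<le> ennreal (((1/4) ^ k) powr p)"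
  shows "AE x in lborel. convergent (\<lambda>k. f k x)"
proof -
  let ?d = "\<lambda>k x. (2 ^ k * norm (f (Suc k) x - f k x)) powr p"
  have bd: "(\<integral>\<^sup>+x. ennreal (?d k x) \<partial>lborel) \<le> ennreal ((1/2) ^ k)" for k
  proof -
    have "(\<integral>\<^sup>+x. ennreal (?d k x) \<partial>lborel) =
      (\<integral>\<^sup>+x. ennreal ((2 ^ k) powr p) * ennreal (norm (f (Suc k) x - f k x) powr p) \<partial>lborel)"
      by (intro nn_integral_cong) (simp add: powr_mult ennreal_mult')
    also have "\<dots> = ennreal ((2 ^ k) powr p) * (\<integral>\<^sup>+x. ennreal (norm (f (Suc k) x - f k x) powr p) \<partial>lborel)"
      by (intro nn_integral_cmult) measurable
    also have "\<dots> \<le> ennreal ((2 ^ k) powr p) * ennreal (((1/4) ^ k) powr p)"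
      by (intro mult_left_mono le) auto
    also have "\<dots> = ennreal ((2 ^ k * (1/4) ^ k) powr p)"
      by (simp add: powr_mult ennreal_mult')
    also have "2 ^ k * (1/4) ^ k = (1/2 :: real) ^ k"
      by (simp flip: power_mult_distrib)
    also have "((1/2 :: real) ^ k) powr p \<le> ((1/2) ^ k) powr 1"
      using assms by (intro powr_mono') (auto simp: power_le_one)
    finally show ?thesis by (simp add: ennreal_leI)
  qed
  have "(\<integral>\<^sup>+x. (\<Sum>k. ennreal (?d k x)) \<partial>lborel) = (\<Sum>k. \<integral>\<^sup>+x. ennreal (?d k x) \<partial>lborel)"
    by (intro nn_integral_suminf) measurable
  also have "\<dots> \<le> (\<Sum>k. ennreal ((1/2) ^ k))"
    by (intro suminf_le bd) auto
  also have "\<dots> = ennreal 2"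
    by (subst suminf_ennreal2) (auto simp: suminf_geometric)
  finally have "(\<integral>\<^sup>+x. (\<Sum>k. ennreal (?d k x)) \<partial>lborel) \<noteq> \<infinity>"
    by (auto simp: top_unique)
  then have "AE x in lborel. (\<Sum>k. ennreal (?d k x)) \<noteq> \<infinity>"
    by (intro nn_integral_PInf_AE) measurable
  then show ?thesis
  proof eventually_elim
    case (elim x)
    then have "summable (\<lambda>k. ?d k x)"
      by (intro summable_suminf_not_top) auto
    then have "(\<lambda>k. ?d k x) \<longlonglongrightarrow> 0" by (rule summable_LIMSEQ_zero)
    then have "eventually (\<lambda>k. ?d k x < 1) sequentially"
      by (rule order_tendstoD) simp
    then have "eventually (\<lambda>k. norm (f (Suc k) x - f k x) \<le> (1/2) ^ k) sequentially"
    proof eventually_elim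
      case (elim k)
      have "2 ^ k * norm (f (Suc k) x - f k x) < 1"
        using elim ge_one_powr_ge_zero[of "2 ^ k * norm (f (Suc k) x - f k x)" p] assms(2) by linarith
      then show ?case by (simp add: field_simps)
    qed
    then have "summable (\<lambda>k. f (Suc k) x - f k x)"
      by (rule summable_comparison_test_ev) (simp add: summable_geometric)
    then have "convergent (\<lambda>n. f n x - f 0 x)"
      unfolding summable_iff_convergent sum_lessThan_telescope[of "\<lambda>k. f k x"] .
    then have "convergent (\<lambda>n. (f n x - f 0 x) + f 0 x)"
      by (intro convergent_add convergent_const)
    then show ?case by simp
  qed
qed

text \<open>Riesz-Fischer. A fast subsequence converges almost everywhere, and Fatou's lemma carries
  its distance to any sufficiently late \<open>X m\<close> over to the limit, so that the whole
  sequence converges.\<close>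

lemma Lp_complete:
  assumes p: "1 \<le> p" and X: "\<And>n. X n \<in> Lp p"
    and Cauchy: "\<And>e. e > 0 \<Longrightarrow> \<exists>N. \<forall>m\<ge>N. \<forall>n\<ge>N. Lp_norm p (X m - X n) < e"
  shows "\<exists>F\<in>Lp p. (\<lambda>n. Lp_norm p (X n - F)) \<longlonglongrightarrow> 0"
proof -
  have p0: "p > 0" using p by simp
  have "\<exists>N. \<forall>k. \<forall>m\<ge>N k. \<forall>n\<ge>N k. Lp_norm p (X m - X n) < (1/4) ^ k"
    by (intro choice allI Cauchy) simp
  then obtain N where N: "\<And>k m n. m \<ge> N k \<Longrightarrow> n \<ge> N k \<Longrightarrow> Lp_norm p (X m - X n) < (1/4) ^ k"
    by blast
  \<comment> \<open>Partial sums turn the thresholds \<open>N\<close> into a monotone sequence that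
    still dominates them.\<close>
  define R where "R k = (\<Sum>i\<le>k. N i)" for k
  have NR: "N k \<le> R k" for k unfolding R_def by (simp add: member_le_sum)
  have mono: "R j \<le> R k" if "j \<le> k" for j k
    unfolding R_def using that by (intro sum_mono2) auto
  have R: "Lp_norm p (X m - X n) < (1/4) ^ k" if "m \<ge> R k" "n \<ge> R k" for k m n
    using N[of k m n] NR[of k] that by linarith
  define x where "x n = rep_L0 (X n)" for n
  have xm [measurable]: "x n \<in> borel_measurable borel" for n by (simp add: x_def)
  have Xx: "X n = abs_L0 (x n)" for n by (simp add: x_def abs_rep_L0)
  have nn: "(\<integral>\<^sup>+t. ennreal (norm (x m t - x n t) powr p) \<partial>lborel) \<le> ennreal (((1/4) ^ k) powr p)"
    if "m \<ge> R k" "n \<ge> R k" for k m n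
    using Lp_iff_nn_integral[of "\<lambda>t. x m t - x n t" p "(1/4) ^ k"] R[OF that] Lp_diff[OF p X X, of m n] p
    by (simp add: Xx abs_L0_arith)
  define g where "g t = lim (\<lambda>k. x (R k) t)" for t
  have [measurable]: "g \<in> borel_measurable borel"
    unfolding g_def by (intro borel_measurable_lim_metric) measurable
  have "AE t in lborel. convergent (\<lambda>k. x (R k) t)"
    using p by (rule AE_convergent_of_fast_Cauchy[rotated]) (auto intro!: nn mono)
  then have lim: "AE t in lborel. (\<lambda>k. x (R k) t) \<longlonglongrightarrow> g t"
    unfolding g_def by (simp add: convergent_LIMSEQ_iff)
  have est: "abs_L0 g - X m \<in> Lp p \<and> Lp_norm p (abs_L0 g - X m) \<le> (1/4) ^ j" if "m \<ge> R j" for j m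
  proof -
    have "(\<integral>\<^sup>+t. ennreal (norm (g t - x m t) powr p) \<partial>lborel) \<le> ennreal (((1/4) ^ j) powr p)"
    proof (rule nn_integral_powr_fatou[OF _ _ _ lim p0])
      show "\<forall>\<^sub>F k in sequentially. (\<integral>\<^sup>+t. ennreal (norm (x (R k) t - x m t) powr p) \<partial>lborel) \<le> ennreal (((1/4) ^ j) powr p)"
        using eventually_ge_at_top[of j] by eventually_elim (intro nn mono that)
    qed measurable
    then show ?thesis using Lp_iff_nn_integral[of "\<lambda>t. g t - x m t" p "(1/4) ^ j"] p0
      by (simp add: Xx abs_L0_arith)
  qed
  have "abs_L0 g \<in> Lp p"
    using Lp_add[OF p, of "abs_L0 g - X (R 0)" "X (R 0)"] est[of 0 "R 0"] X by simp
  moreover have "(\<lambda>n. Lp_norm p (X n - abs_L0 g)) \<longlonglongrightarrow> 0"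
  proof (rule LIMSEQ_I)
    fix r :: real assume "r > 0"
    then obtain j where j: "(1/4 :: real) ^ j < r"
      using real_arch_pow_inv[of r "1/4"] by auto
    have "norm (Lp_norm p (X n - abs_L0 g) - 0) < r" if "n \<ge> R j" for n
      using est[OF that] j Lp_norm_minus_commute[OF p0, of "X n" "abs_L0 g"] by simp
    then show "\<exists>no. \<forall>n\<ge>no. norm (Lp_norm p (X n - abs_L0 g) - 0) < r" by blast
  qed
  ultimately show ?thesis by blast
qed

section \<open>Contraction semigroups generated by m-dissipative operators\<close>

definition linear_contraction :: "('a::real_normed_vector \<Rightarrow> 'a) \<Rightarrow> bool" where
  "linear_contraction P \<longleftrightarrow> linear P \<and> (\<forall>x. norm (P x) \<le> norm x)"

lemma linear_contractionD:
  assumes "linear_contraction P"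
  shows "P (x + y) = P x + P y" "P (x - y) = P x - P y" "P (c *\<^sub>R x) = c *\<^sub>R P x" "norm (P x) \<le> norm x"
  using assms by (auto simp: linear_contraction_def linear_add linear_diff linear_scale)

lemma linear_contraction_dist:
  assumes "linear_contraction P" shows "dist (P x) (P y) \<le> dist x y"
  using linear_contractionD(2,4)[OF assms] by (metis dist_norm)

lemma dense_approachable:
  assumes "closure S = UNIV" "e > 0" obtains y where "y \<in> S" "dist y x < e"
  using assms closure_approachable[of x S] by auto

lemma linear_contraction_funpow:
  assumes "linear_contraction P" shows "linear_contraction (P ^^ n)"
proof -
  have "linear (P ^^ n) \<and> (\<forall>x. norm ((P ^^ n) x) \<le> norm x)"
  proof (induction n)
    case 0 then show ?case by (simp add: linear_id[unfolded id_def] id_def)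
  next
    case (Suc n)
    then show ?case using assms unfolding linear_contraction_def
      using linear_compose[of "P ^^ n" P] by (auto simp: o_def intro: order_trans)
  qed
  then show ?thesis by (simp add: linear_contraction_def)
qed

lemma funpow_commute_fun:
  assumes "\<And>x. P (Q x) = Q (P x)" shows "(P ^^ n) (Q x) = Q ((P ^^ n) x)"
  by (induction n) (auto simp: assms)

lemma funpow_comp_commute:
  assumes "\<And>x. P (Q x) = Q (P x)" shows "((\<lambda>x. P (Q x)) ^^ n) x = (P ^^ n) ((Q ^^ n) x)"
proof (induction n)
  case (Suc n)
  have "Q ((P ^^ n) y) = (P ^^ n) (Q y)" for y
    using funpow_commute_fun[of P Q n y] assms by simp
  then show ?case by (simp add: Suc)
qed simp

text \<open>Telescoping: commutation turns \<open>(P ^^ n) (Q x)\<close> into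
  \<open>Q ((P ^^ n) x)\<close>, so that each step adds only an image of the same vector
  \<open>P x - Q x\<close> under a contraction.\<close>

lemma norm_funpow_diff_le:
  assumes P: "linear_contraction P" and Q: "linear_contraction Q" and comm: "\<And>x. P (Q x) = Q (P x)"
  shows "norm ((P ^^ n) x - (Q ^^ n) x) \<le> real n * norm (P x - Q x)"
proof (induction n)
  case (Suc n)
  have "(P ^^ Suc n) x - (Q ^^ Suc n) x = (P ^^ n) (P x - Q x) + Q ((P ^^ n) x - (Q ^^ n) x)"
    using linear_contractionD(2)[OF linear_contraction_funpow[OF P]] linear_contractionD(2)[OF Q]
      funpow_commute_fun[of P Q n x] comm by (simp add: funpow_swap1)
  also have "norm \<dots> \<le> norm (P x - Q x) + norm ((P ^^ n) x - (Q ^^ n) x)"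
    by (rule order_trans[OF norm_triangle_ineq add_mono[OF linear_contractionD(4)[OF linear_contraction_funpow[OF P]] linear_contractionD(4)[OF Q]]])
  also have "\<dots> \<le> real (Suc n) * norm (P x - Q x)"
    using Suc by (simp add: algebra_simps)
  finally show ?case .
qed simp

lemma convergent_of_dense:
  fixes F :: "nat \<Rightarrow> 'a \<Rightarrow> 'a::banach"
  assumes F: "\<And>m. linear_contraction (F m)" and S: "closure S = UNIV"
    and conv: "\<And>x. x \<in> S \<Longrightarrow> convergent (\<lambda>m. F m x)"
  shows "convergent (\<lambda>m. F m x)"
proof -
  have "Cauchy (\<lambda>m. F m x)"
  proof (rule metric_CauchyI)
    fix e :: real assume e: "e > 0"
    obtain y where y: "y \<in> S" "dist y x < e / 3"
      by (rule dense_approachable[OF S, of "e / 3" x]) (use e in auto)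
    have "Cauchy (\<lambda>m. F m y)" using conv[OF y(1)] by (rule convergent_Cauchy)
    then obtain M where M: "\<And>m n. m \<ge> M \<Longrightarrow> n \<ge> M \<Longrightarrow> dist (F m y) (F n y) < e / 3"
      using metric_CauchyD[of _ "e / 3"] e by (metis divide_pos_pos zero_less_numeral)
    have d: "dist (F m x) (F m y) < e / 3" for m
      using y(2) linear_contraction_dist[OF F, of m x y] by (simp add: dist_commute)
    have "dist (F m x) (F n x) < e" if "m \<ge> M" "n \<ge> M" for m n
      using dist_triangle_third[OF d[of m] M[OF that], of "F n x"] d[of n] by (simp add: dist_commute)
    then show "\<exists>M. \<forall>m\<ge>M. \<forall>n\<ge>M. dist (F m x) (F n x) < e" by blast
  qed
  then show ?thesis by (rule Cauchy_convergent)
qed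

text \<open>\<open>dissipative\<close> and \<open>range\<close> together say that
  \<open>1 - l B\<close> has a contractive inverse for every \<open>l > 0\<close>. The structure is
  real; complex homogeneity of the semigroup is recovered through
  \<open>T_commute_gen\<close>.\<close>

locale m_dissipative =
  fixes B :: "('a::banach \<times> 'a) set"
  assumes subspace: "subspace B"
    and dissipative: "(x, y) \<in> B \<Longrightarrow> 0 < l \<Longrightarrow> norm x \<le> norm (x - l *\<^sub>R y)"
    and range: "0 < l \<Longrightarrow> \<exists>x y. (x, y) \<in> B \<and> x - l *\<^sub>R y = z"
    and dense: "closure (Domain B) = UNIV"
begin

section \<open>The resolvent of an m-dissipative operator\<close>

lemma B_add: "(x, y) \<in> B \<Longrightarrow> (x', y') \<in> B \<Longrightarrow> (x + x', y + y') \<in> B"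
  using subspace_add[OF subspace, of "(x, y)" "(x', y')"] by simp

lemma B_scale: "(x, y) \<in> B \<Longrightarrow> (c *\<^sub>R x, c *\<^sub>R y) \<in> B"
  using subspace_mul[OF subspace, of "(x, y)" c] by simp

lemma B_diff: "(x, y) \<in> B \<Longrightarrow> (x', y') \<in> B \<Longrightarrow> (x - x', y - y') \<in> B"
  using subspace_diff[OF subspace, of "(x, y)" "(x', y')"] by simp

text \<open>The resolvent \<open>(1 - l B)\<^sup>-\<^sup>1\<close>; the case \<open>l = 0\<close> is set apart since it must be total.\<close>

definition J :: "real \<Rightarrow> 'a \<Rightarrow> 'a" where
  "J l z = (if l = 0 then z else THE x. \<exists>y. (x, y) \<in> B \<and> x - l *\<^sub>R y = z)"

lemma J_eqI:
  assumes "(x, y) \<in> B" "0 \<le> l" "x - l *\<^sub>R y = z"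
  shows "J l z = x"
proof (cases "l = 0")
  case False
  then have "l > 0" using assms by simp
  have "x' = x" if "(x', y') \<in> B" "x' - l *\<^sub>R y' = z" for x' y'
  proof -
    have "norm (x' - x) \<le> norm ((x' - x) - l *\<^sub>R (y' - y))"
      using \<open>l > 0\<close> by (intro dissipative B_diff that assms)
    also have "(x' - x) - l *\<^sub>R (y' - y) = (x' - l *\<^sub>R y') - (x - l *\<^sub>R y)"
      by (simp add: algebra_simps)
    also have "\<dots> = 0" using that assms by simp
    finally show ?thesis by simp
  qed
  then have "(THE x. \<exists>y. (x, y) \<in> B \<and> x - l *\<^sub>R y = z) = x"
    using assms(1,3) by (intro the_equality) blast+
  then show ?thesis using False by (simp add: J_def)
qed (use assms in \<open>simp add: J_def\<close>)

lemma J_obtain: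
  assumes "0 < l" obtains y where "(J l z, y) \<in> B" "J l z - l *\<^sub>R y = z"
proof -
  obtain x y where "(x, y) \<in> B" "x - l *\<^sub>R y = z" using range[OF assms] by blast
  with J_eqI[of x y l z] assms that show ?thesis by auto
qed

lemma J_zero [simp]: "J 0 z = z" by (simp add: J_def)

lemma J_contraction:
  assumes "0 \<le> l" shows "linear_contraction (J l)"
proof (cases "l = 0")
  case True
  then show ?thesis by (simp add: J_def[abs_def] linear_contraction_def linear_id[unfolded id_def])
next
  case False
  then have l: "0 < l" using assms by simp
  have "linear (J l)"
  proof (rule linearI)
    fix u v
    obtain y where y: "(J l u, y) \<in> B" "J l u - l *\<^sub>R y = u" by (rule J_obtain[OF l])
    obtain z where z: "(J l v, z) \<in> B" "J l v - l *\<^sub>R z = v" by (rule J_obtain[OF l])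
    have "(J l u + J l v) - l *\<^sub>R (y + z) = (J l u - l *\<^sub>R y) + (J l v - l *\<^sub>R z)"
      by (simp add: algebra_simps)
    then show "J l (u + v) = J l u + J l v"
      using y z assms by (intro J_eqI[OF B_add[OF y(1) z(1)]]) auto
  next
    fix r u
    obtain y where y: "(J l u, y) \<in> B" "J l u - l *\<^sub>R y = u" by (rule J_obtain[OF l])
    have "r *\<^sub>R J l u - l *\<^sub>R (r *\<^sub>R y) = r *\<^sub>R (J l u - l *\<^sub>R y)"
      by (simp add: algebra_simps)
    then show "J l (r *\<^sub>R u) = r *\<^sub>R J l u"
      using y assms by (intro J_eqI[OF B_scale[OF y(1)]]) auto
  qed
  moreover have "norm (J l u) \<le> norm u" for u
    using J_obtain[OF l, of u] dissipative[OF _ l] by metis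
  ultimately show ?thesis by (simp add: linear_contraction_def)
qed

lemmas J_simps = linear_contractionD[OF J_contraction]

text \<open>The resolvent commutes with \<open>B\<close>. One application shows that
  \<open>J l x - x\<close> is of order \<open>l\<close> on the domain, two give the expansion
  \<open>x + l B x + l\<^sup>2 J l (B\<^sup>2 x)\<close> behind all later error estimates.\<close>

lemma J_step:
  assumes "(x, y) \<in> B" "0 \<le> l"
  shows "J l x = x + l *\<^sub>R J l y" "(J l x, J l y) \<in> B"
proof -
  have "J l x = x + l *\<^sub>R J l y \<and> (J l x, J l y) \<in> B"
  proof (cases "l = 0")
    case False
    then have l: "0 < l" using assms by simp
    obtain r where r: "(J l y, r) \<in> B" "J l y - l *\<^sub>R r = y" by (rule J_obtain[OF l])
    have B: "(x + l *\<^sub>R J l y, J l y) \<in> B"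
    proof -
      have "y + l *\<^sub>R r = J l y" using r(2) by (metis diff_add_cancel)
      then show ?thesis using B_add[OF assms(1) B_scale[OF r(1), of l]] by simp
    qed
    then have "J l x = x + l *\<^sub>R J l y" by (rule J_eqI) (use l in auto)
    with B show ?thesis by simp
  qed (use assms in auto)
  then show "J l x = x + l *\<^sub>R J l y" "(J l x, J l y) \<in> B" by auto
qed

text \<open>Applying \<open>C\<close> to the equation for \<open>J l z\<close> gives the equation
  for \<open>J l (C z)\<close>, which has one solution. \<open>C\<close> will be another resolvent,
  or multiplication by a complex number.\<close>

lemma J_commute_gen:
  assumes C: "linear C" "\<And>x y. (x, y) \<in> B \<Longrightarrow> (C x, C y) \<in> B" and "0 \<le> l"
  shows "J l (C z) = C (J l z)"
proof (cases "l = 0")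
  case False
  then have l: "0 < l" using assms by simp
  obtain s where s: "(J l z, s) \<in> B" "J l z - l *\<^sub>R s = z" by (rule J_obtain[OF l])
  have "C (J l z) - l *\<^sub>R C s = C (J l z - l *\<^sub>R s)"
    using C(1) by (simp add: linear_diff linear_scale)
  then show ?thesis using s C(2)[OF s(1)] l by (intro J_eqI) auto
qed simp

lemma J_commute:
  assumes "0 \<le> k" "0 \<le> l" shows "J l (J k z) = J k (J l z)"
  using assms J_contraction[OF assms(1)] J_step(2)
  by (intro J_commute_gen) (auto simp: linear_contraction_def)

text \<open>Stated for a family \<open>P\<close> because it serves both the resolvents
  \<open>J\<close> and the semigroup \<open>T\<close>.\<close>

lemma tendsto_id_of_lipschitz:
  assumes P: "\<And>t. 0 \<le> t \<Longrightarrow> linear_contraction (P t)"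
    and lip: "\<And>x y t. (x, y) \<in> B \<Longrightarrow> 0 \<le> t \<Longrightarrow> norm (P t x - x) \<le> t * norm y"
  shows "((\<lambda>t. P t x) \<longlongrightarrow> x) (at_right 0)"
proof (rule tendstoI)
  fix e :: real assume e: "e > 0"
  obtain u v where u: "(u, v) \<in> B" "dist u x < e / 3"
    using dense_approachable[OF dense, of "e / 3" x] e by (metis Domain.cases divide_pos_pos zero_less_numeral)
  have "((\<lambda>t. t * norm v) \<longlongrightarrow> 0 * norm v) (at_right 0)"
    by (intro tendsto_intros)
  then have "\<forall>\<^sub>F t in at_right 0. t * norm v < e / 3"
    by (rule order_tendstoD) (use e in auto)
  then show "\<forall>\<^sub>F t in at_right 0. dist (P t x) x < e"
    using eventually_at_right_less[of 0]
  proof eventually_elim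
    case (elim t)
    then have t: "0 \<le> t" by simp
    have "dist (P t x) (P t u) < e / 3"
      using u(2) linear_contraction_dist[OF P[OF t], of x u] by (simp add: dist_commute)
    moreover have "dist (P t u) u < e / 3"
      using lip[OF u(1) t] elim by (simp add: dist_norm)
    ultimately show ?case
      using u(2) dist_triangle[of "P t x" x "P t u"] dist_triangle[of "P t u" x u] by linarith
  qed
qed

lemma J_tendsto: "((\<lambda>l. J l x) \<longlongrightarrow> x) (at_right 0)"
  using J_step(1) J_simps(4) by (intro tendsto_id_of_lipschitz J_contraction) (auto intro: mult_left_mono)

definition D2 :: "('a \<times> 'a \<times> 'a) set" where
  "D2 = {(x, y, z). (x, y) \<in> B \<and> (y, z) \<in> B}"

text \<open>The resolvent gains one power of \<open>B\<close> and commutes with it, so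
  \<open>J l x\<close> with small \<open>l\<close> approximates in the graph norm: the domain of the
  square is a core. \<open>T_has_generator\<close> relies on the closeness of the images.\<close>

lemma approx_D2:
  assumes "(x, y) \<in> B" "e > 0"
  obtains x' y' z' where "(x', y', z') \<in> D2" "norm (x' - x) < e" "norm (y' - y) < e"
proof -
  have "\<forall>\<^sub>F l in at_right 0. dist (J l x) x < e" "\<forall>\<^sub>F l in at_right 0. dist (J l y) y < e"
    using tendstoD[OF J_tendsto] assms by auto
  then have "\<forall>\<^sub>F l in at_right (0::real). dist (J l x) x < e \<and> dist (J l y) y < e \<and> 0 < l"
    using eventually_at_right_less[of 0] by eventually_elim auto
  then obtain l where l: "dist (J l x) x < e" "dist (J l y) y < e" "0 < l"
    by (metis (no_types, lifting) eventually_happens trivial_limit_at_right_real)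
  obtain w where "(J l y, w) \<in> B" by (rule J_obtain[OF l(3)])
  then have "(J l x, J l y, w) \<in> D2" using J_step(2)[OF assms(1)] l by (auto simp: D2_def)
  then show ?thesis using that l by (auto simp: dist_norm)
qed

lemma dense_D2: "closure (Domain D2) = UNIV"
proof -
  have "\<exists>x'\<in>Domain D2. dist x' x < e" if e: "e > 0" for x and e :: real
  proof -
    obtain u v where u: "(u, v) \<in> B" "dist u x < e / 2"
      using dense_approachable[OF dense, of "e / 2" x] e by (metis Domain.cases divide_pos_pos zero_less_numeral)
    obtain x' y' z' where "(x', y', z') \<in> D2" "norm (x' - u) < e / 2"
      by (rule approx_D2[OF u(1), of "e / 2"]) (use e in auto)
    then show ?thesis using u(2) 
      using dist_triangle_half_l[of x' u e x] by (intro bexI[of _ x']) (auto simp: dist_norm norm_minus_commute)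
  qed
  then show ?thesis by (auto simp: closure_approachable)
qed

text \<open>In the expansion of \<open>J l x\<close> the terms of order 0 and 1 cancel, and the
  three remaining terms each have a coefficient of at most \<open>(h + k)^2\<close>. Unequal steps
  are allowed because the estimate serves the addition law as well as the halving of steps.\<close>

lemma J_J_approx:
  assumes "(x, y, z) \<in> D2" and h: "0 \<le> h" "0 \<le> k"
  shows "norm (J h (J k x) - J (h + k) x) \<le> 3 * (h + k)^2 * norm z"
proof -
  have B: "(x, y) \<in> B" "(y, z) \<in> B" using assms by (auto simp: D2_def)
  have e: "J l x = x + l *\<^sub>R y + (l * l) *\<^sub>R J l z" if "0 \<le> l" for l
    using J_step(1)[OF B(1) that] J_step(1)[OF B(2) that] by (simp add: algebra_simps)
  have "J h (J k x) = J h x + k *\<^sub>R J h y + (k * k) *\<^sub>R J h (J k z)"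
    using h by (simp add: e[of k] J_simps)
  also have "J h y = y + h *\<^sub>R J h z" using J_step(1)[OF B(2)] h by simp
  finally have "J h (J k x) - J (h + k) x = ((h + k) * h) *\<^sub>R J h z + (k * k) *\<^sub>R J h (J k z)
      - ((h + k) * (h + k)) *\<^sub>R J (h + k) z"
    using h by (simp add: e algebra_simps)
  also have "norm \<dots> \<le> (h + k) * h * norm (J h z) + k * k * norm (J h (J k z)) + (h + k) * (h + k) * norm (J (h + k) z)"
    using h by (intro order_trans[OF norm_triangle_ineq4] order_trans[OF add_right_mono[OF norm_triangle_ineq]]) simp
  also have "\<dots> \<le> (h + k) * h * norm z + k * k * norm z + (h + k) * (h + k) * norm z"
    using h J_simps(4) order_trans[OF J_simps(4) J_simps(4)]
    by (intro add_mono mult_left_mono) auto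
  also have "\<dots> = ((h + k) * h + k * k + (h + k) * (h + k)) * norm z" by (simp add: algebra_simps)
  also have "\<dots> \<le> 3 * (h + k)^2 * norm z"
    using h by (intro mult_right_mono) (auto simp: power2_eq_square algebra_simps)
  finally show ?thesis .
qed

text \<open>Euler steps of dyadic length: consecutive approximations differ by halving the step, and these
  differences are summable on the domain of \<open>B\<^sup>2\<close>.\<close>

definition F :: "real \<Rightarrow> nat \<Rightarrow> 'a \<Rightarrow> 'a" where
  "F t m = J (t / 2 ^ m) ^^ (2 ^ m)"

lemma F_contraction: "0 \<le> t \<Longrightarrow> linear_contraction (F t m)"
  unfolding F_def by (intro linear_contraction_funpow J_contraction) simp

lemma JJ_contraction: "0 \<le> h \<Longrightarrow> 0 \<le> k \<Longrightarrow> linear_contraction (\<lambda>x. J h (J k x))"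
  using J_contraction[of h] J_contraction[of k] linear_compose[of "J k" "J h"]
  by (auto simp: linear_contraction_def o_def intro: order_trans)

text \<open>There are \<open>2 ^ m\<close> comparisons of two steps with one, each with an error
  quadratic in a step of order \<open>2 ^ (- m)\<close>; one factor \<open>2 ^ (- m)\<close>
  survives.\<close>

lemma F_F_approx:
  assumes "(x, y, z) \<in> D2" and st: "0 \<le> s" "0 \<le> t"
  shows "norm (F s m (F t m x) - F (s + t) m x) \<le> 3 * (s + t)^2 * norm z * (1/2) ^ m"
proof -
  define h k where "h = s / 2 ^ m" and "k = t / 2 ^ m"
  have hk: "0 \<le> h" "0 \<le> k" and sum: "(s + t) / 2 ^ m = h + k"
    using st by (auto simp: h_def k_def add_divide_distrib)
  have "F s m (F t m x) = ((\<lambda>x. J h (J k x)) ^^ (2 ^ m)) x"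
    unfolding F_def by (subst funpow_comp_commute) (auto simp: h_def[symmetric] k_def[symmetric] J_commute hk)
  moreover have "F (s + t) m x = (J (h + k) ^^ (2 ^ m)) x" by (simp add: F_def sum)
  ultimately have "norm (F s m (F t m x) - F (s + t) m x) \<le> real (2 ^ m) * norm (J h (J k x) - J (h + k) x)"
    using norm_funpow_diff_le[OF JJ_contraction[OF hk] J_contraction, of "h + k" "2 ^ m" x] hk
    by (simp add: J_commute[of "h + k"])
  also have "\<dots> \<le> 2 ^ m * (3 * (h + k)^2 * norm z)"
    using J_J_approx[OF assms(1) hk] by simp
  also have "\<dots> = 3 * (s + t)^2 * norm z * (1/2) ^ m"
    by (simp add: sum[symmetric] power2_eq_square field_simps)
  finally show ?thesis .
qed

text \<open>Halving the step is an instance of the addition estimate, as \<open>F t (Suc m)\<close>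
  is \<open>F (t / 2) m\<close> applied twice.\<close>

lemma F_Suc_approx:
  assumes "(x, y, z) \<in> D2" and t: "0 \<le> t"
  shows "norm (F t (Suc m) x - F t m x) \<le> 3 * t^2 * norm z * (1/2) ^ m"
proof -
  have "F t (Suc m) x = F (t / 2) m (F (t / 2) m x)"
  proof -
    have "t / 2 ^ Suc m = t / 2 / 2 ^ m" "(2::nat) ^ Suc m = 2 ^ m + 2 ^ m" by simp_all
    then show ?thesis by (simp only: F_def funpow_add o_apply)
  qed
  then show ?thesis using F_F_approx[OF assms(1), of "t/2" "t/2" m] t by simp
qed

lemma F_convergent: "0 \<le> t \<Longrightarrow> convergent (\<lambda>m. F t m x)"
proof (rule convergent_of_dense[OF F_contraction dense_D2])
  fix x assume t: "0 \<le> t" and "x \<in> Domain D2"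
  then obtain y z where D: "(x, y, z) \<in> D2" by auto
  have "summable (\<lambda>m. F t (Suc m) x - F t m x)"
  proof (rule summable_comparison_test')
    show "summable (\<lambda>m. 3 * t^2 * norm z * (1/2) ^ m)"
      by (rule summable_mult) (simp add: summable_geometric)
    show "norm (F t (Suc m) x - F t m x) \<le> 3 * t^2 * norm z * (1/2) ^ m" if "m \<ge> 0" for m
      by (rule F_Suc_approx[OF D t])
  qed
  then have "convergent (\<lambda>n. F t n x - F t 0 x)"
    unfolding summable_iff_convergent sum_lessThan_telescope[of "\<lambda>m. F t m x"] .
  then have "convergent (\<lambda>n. (F t n x - F t 0 x) + F t 0 x)"
    by (intro convergent_add convergent_const)
  then show "convergent (\<lambda>m. F t m x)" by simp
qed

section \<open>The limit of the Euler approximations\<close>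

definition T :: "real \<Rightarrow> 'a \<Rightarrow> 'a" where
  "T t x = lim (\<lambda>m. F t m x)"

lemma F_tendsto: "0 \<le> t \<Longrightarrow> (\<lambda>m. F t m x) \<longlonglongrightarrow> T t x"
  using F_convergent by (simp add: T_def convergent_LIMSEQ_iff)

lemma T_contraction:
  assumes t: "0 \<le> t" shows "linear_contraction (T t)"
proof -
  note F = linear_contractionD[OF F_contraction[OF t]]
  have "T t (x + y) = T t x + T t y" for x y
    using LIMSEQ_unique[OF F_tendsto[OF t, of "x + y"]] tendsto_add[OF F_tendsto[OF t, of x] F_tendsto[OF t, of y]]
    by (simp add: F(1))
  moreover have "T t (c *\<^sub>R x) = c *\<^sub>R T t x" for c x
    using LIMSEQ_unique[OF F_tendsto[OF t, of "c *\<^sub>R x"]] tendsto_scaleR[OF tendsto_const F_tendsto[OF t, of x]]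
    by (simp add: F(3))
  moreover have "norm (T t x) \<le> norm x" for x
    by (rule LIMSEQ_le_const2[OF tendsto_norm[OF F_tendsto[OF t]]]) (auto simp: F)
  ultimately show ?thesis by (auto simp: linear_contraction_def intro!: linearI)
qed

lemmas T_simps = linear_contractionD[OF T_contraction]

lemma T_zero: "T 0 x = x"
proof -
  have "(J 0 ^^ n) x = x" for n by (induction n) auto
  then have "(\<lambda>m. F 0 m x) \<longlonglongrightarrow> x" by (simp add: F_def)
  then show ?thesis using F_tendsto[of 0 x] by (simp add: LIMSEQ_unique)
qed

lemma T_commute_gen:
  assumes C: "bounded_linear C" "\<And>x y. (x, y) \<in> B \<Longrightarrow> (C x, C y) \<in> B" and t: "0 \<le> t"
  shows "T t (C x) = C (T t x)"
proof (rule LIMSEQ_unique[OF F_tendsto[OF t]])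
  have "F t m (C x) = C (F t m x)" for m
    unfolding F_def using t C
    by (intro funpow_commute_fun J_commute_gen) (auto simp: bounded_linear.linear)
  then show "(\<lambda>m. F t m (C x)) \<longlonglongrightarrow> C (T t x)"
    using bounded_linear.tendsto[OF C(1) F_tendsto[OF t]] by simp
qed

lemma T_add:
  assumes st: "0 \<le> s" "0 \<le> t" shows "T (s + t) x = T s (T t x)"
proof -
  have lim: "(\<lambda>m. F s m (F t m x)) \<longlonglongrightarrow> T s (T t x)" for x
  proof -
    have "(\<lambda>m. F s m (F t m x - T t x)) \<longlonglongrightarrow> 0"
    proof (rule Lim_null_comparison)
      show "\<forall>\<^sub>F m in sequentially. norm (F s m (F t m x - T t x)) \<le> norm (F t m x - T t x)"
        by (simp add: linear_contractionD(4)[OF F_contraction[OF st(1)]])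
      show "(\<lambda>m. norm (F t m x - T t x)) \<longlonglongrightarrow> 0"
        using F_tendsto[OF st(2), of x] by (simp add: tendsto_norm_zero_iff LIM_zero_iff)
    qed
    from tendsto_add[OF this F_tendsto[OF st(1), of "T t x"]] show ?thesis
      by (simp add: linear_contractionD(2)[OF F_contraction[OF st(1)]])
  qed
  have D: "T (s + t) x = T s (T t x)" if "x \<in> Domain D2" for x
  proof -
    obtain y z where D: "(x, y, z) \<in> D2" using \<open>x \<in> Domain D2\<close> by auto
    have "(\<lambda>m. F s m (F t m x) - F (s + t) m x) \<longlonglongrightarrow> 0"
    proof (rule Lim_null_comparison)
      show "\<forall>\<^sub>F m in sequentially. norm (F s m (F t m x) - F (s + t) m x) \<le> 3 * (s + t)^2 * norm z * (1/2) ^ m"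
        using F_F_approx[OF D st] by simp
      show "(\<lambda>m. 3 * (s + t)^2 * norm z * (1/2) ^ m) \<longlonglongrightarrow> 0"
        by (intro tendsto_mult_right_zero LIMSEQ_power_zero) simp
    qed
    moreover have "(\<lambda>m. F s m (F t m x) - F (s + t) m x) \<longlonglongrightarrow> T s (T t x) - T (s + t) x"
      using st by (intro tendsto_diff lim F_tendsto) auto
    ultimately show ?thesis using LIMSEQ_unique by fastforce
  qed
  show ?thesis
  proof (rule ccontr)
    assume ne: "T (s + t) x \<noteq> T s (T t x)"
    define e where "e = norm (T (s + t) x - T s (T t x))"
    have "e > 0" using ne by (simp add: e_def)
    then obtain u where u: "u \<in> Domain D2" "dist u x < e / 2"
      using dense_approachable[OF dense_D2, of "e / 2" x] by (metis divide_pos_pos zero_less_numeral)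
    have "T (s + t) x - T s (T t x) = T (s + t) (x - u) - T s (T t (x - u))"
      using D[OF u(1)] st by (simp add: T_simps)
    also have "norm \<dots> \<le> norm (x - u) + norm (x - u)"
      using st by (intro order_trans[OF norm_triangle_ineq4] add_mono T_simps(4) order_trans[OF T_simps(4) T_simps(4)]) auto
    also have "\<dots> < e" using u(2) by (simp add: dist_norm norm_minus_commute)
    finally show False by (simp add: e_def)
  qed
qed

text \<open>The 7 is 6 + 1: the successive differences of \<open>F_Suc_approx\<close> sum to at most
  6, and the start \<open>F t 0 = J t\<close> has error \<open>t\<^sup>2 J t z\<close>.\<close>

lemma T_quadratic:
  assumes D: "(x, y, z) \<in> D2" and t: "0 \<le> t"
  shows "norm (T t x - x - t *\<^sub>R y) \<le> 7 * t^2 * norm z"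
proof -
  have B: "(x, y) \<in> B" "(y, z) \<in> B" using D by (auto simp: D2_def)
  have F0: "F t 0 x - x - t *\<^sub>R y = (t * t) *\<^sub>R J t z"
    using J_step(1)[OF B(1) t] J_step(1)[OF B(2) t] by (simp add: F_def algebra_simps)
  have Fn: "norm (F t n x - F t 0 x) \<le> 6 * t^2 * norm z" for n
  proof -
    have "norm (F t n x - F t 0 x) \<le> (\<Sum>m<n. norm (F t (Suc m) x - F t m x))"
      unfolding sum_lessThan_telescope[of "\<lambda>m. F t m x", symmetric] by (rule norm_sum)
    also have "\<dots> \<le> (\<Sum>m<n. 3 * t^2 * norm z * (1/2) ^ m)"
      by (intro sum_mono F_Suc_approx[OF D t])
    also have "\<dots> = 3 * t^2 * norm z * (\<Sum>m<n. (1/2) ^ m)" by (simp add: sum_distrib_left)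
    also have "(\<Sum>m<n. (1/2::real) ^ m) \<le> 2"
      using sum_gp_strict[of "1/2::real" n] by simp
    finally show ?thesis by (simp add: mult_left_mono)
  qed
  have "norm (F t n x - x - t *\<^sub>R y) \<le> 7 * t^2 * norm z" for n
  proof -
    have "F t n x - x - t *\<^sub>R y = (F t n x - F t 0 x) + (t * t) *\<^sub>R J t z"
      using F0 by (simp add: algebra_simps)
    also have "norm \<dots> \<le> 6 * t^2 * norm z + t * t * norm z"
      using Fn[of n] J_simps(4)[OF t, of z]
      by (intro order_trans[OF norm_triangle_ineq] add_mono) (auto simp: mult_left_mono)
    finally show ?thesis by (simp add: power2_eq_square algebra_simps)
  qed
  then show ?thesis
    by (intro LIMSEQ_le_const2[OF tendsto_norm[OF tendsto_diff[OF tendsto_diff[OF F_tendsto[OF t] tendsto_const] tendsto_const]]]) auto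
qed

text \<open>Powers of \<open>J (t / 2 ^ m)\<close> are compared with powers of the identity, so that
  the one-step deviation is multiplied by the number of steps.\<close>

lemma T_lipschitz:
  assumes B: "(x, y) \<in> B" and t: "0 \<le> t"
  shows "norm (T t x - x) \<le> t * norm y"
proof -
  have "norm (F t m x - x) \<le> t * norm y" for m
  proof -
    have h: "0 \<le> t / 2 ^ m" using t by simp
    have "norm ((J (t / 2 ^ m) ^^ n) x - (id ^^ n) x) \<le> real n * norm (J (t / 2 ^ m) x - id x)" for n
      using J_contraction[OF h] by (intro norm_funpow_diff_le) (auto simp: linear_contraction_def linear_id)
    from this[of "2 ^ m"] have "norm (F t m x - x) \<le> 2 ^ m * norm (J (t / 2 ^ m) x - x)"
      by (simp add: F_def)
    also have "J (t / 2 ^ m) x - x = (t / 2 ^ m) *\<^sub>R J (t / 2 ^ m) y"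
      using J_step(1)[OF B h] by simp
    also have "2 ^ m * norm \<dots> \<le> t * norm y"
      using t J_simps(4)[OF h, of y] by (simp add: mult_left_mono)
    finally show ?thesis .
  qed
  then show ?thesis
    by (intro LIMSEQ_le_const2[OF tendsto_norm[OF tendsto_diff[OF F_tendsto[OF t] tendsto_const]]]) auto
qed

lemma T_continuous_0: "((\<lambda>t. T t x) \<longlongrightarrow> x) (at_right 0)"
  by (rule tendsto_id_of_lipschitz[OF T_contraction T_lipschitz])

lemma T_continuous:
  assumes s: "0 \<le> s" shows "((\<lambda>t. T t x) \<longlongrightarrow> T s x) (at s within {0..})"
proof (rule tendstoI)
  fix e :: real assume e: "e > 0"
  obtain d where d: "d > 0" "\<And>t. 0 < t \<Longrightarrow> t < d \<Longrightarrow> dist (T t x) x < e"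
    using tendstoD[OF T_continuous_0 e] unfolding eventually_at_right_field by force
  have shift: "dist (T (r + t) x) (T r x) < e" if "0 \<le> r" "0 < t" "t < d" for r t
    using d(2)[OF that(2,3)] linear_contraction_dist[OF T_contraction[OF that(1)], of "T t x" x] T_add[of r t x] that
    by simp
  have "\<forall>\<^sub>F t in at s within {0..}. dist t s < d \<and> t \<noteq> s \<and> t \<in> {0..}"
    using d(1) by (auto simp: eventually_at)
  then show "\<forall>\<^sub>F t in at s within {0..}. dist (T t x) (T s x) < e"
  proof eventually_elim
    case (elim t)
    show ?case
    proof (cases "t < s")
      case True
      then show ?thesis using shift[of t "s - t"] elim by (simp add: dist_commute dist_real_def)
    next
      case False
      then show ?thesis using shift[of s "t - s"] elim s by (simp add: dist_real_def)
    qed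
  qed
qed

text \<open>\<open>x\<close> is split into \<open>x'\<close> from the core, where the quadratic
  estimate applies, and \<open>x - x'\<close>, whose difference quotient is at most
  \<open>norm (y - y')\<close> uniformly in \<open>t\<close> by \<open>T_lipschitz\<close>.\<close>

lemma T_has_generator:
  assumes B: "(x, y) \<in> B"
  shows "((\<lambda>t. (1 / t) *\<^sub>R (T t x - x)) \<longlongrightarrow> y) (at_right 0)"
proof (rule tendstoI)
  fix e :: real assume e: "e > 0"
  obtain x' y' z' where D: "(x', y', z') \<in> D2" "norm (x' - x) < e / 3" "norm (y' - y) < e / 3"
    by (rule approx_D2[OF B, of "e / 3"]) (use e in auto)
  have B': "(x', y') \<in> B" using D(1) by (simp add: D2_def)
  have "((\<lambda>t. 7 * t * norm z') \<longlongrightarrow> 7 * 0 * norm z') (at_right 0)"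
    by (intro tendsto_intros)
  then have "\<forall>\<^sub>F t in at_right 0. 7 * t * norm z' < e / 3"
    by (rule order_tendstoD) (use e in auto)
  then show "\<forall>\<^sub>F t in at_right 0. dist ((1 / t) *\<^sub>R (T t x - x)) y < e"
    using eventually_at_right_less[of 0]
  proof eventually_elim
    case (elim t)
    then have t: "0 \<le> t" "0 < t" by auto
    have "(1 / t) *\<^sub>R (T t x - x) - y = (1 / t) *\<^sub>R (T t (x - x') - (x - x'))
        + (1 / t) *\<^sub>R (T t x' - x' - t *\<^sub>R y') + (y' - y)"
      using t by (simp add: T_simps algebra_simps)
    also have "norm \<dots> \<le> norm ((1 / t) *\<^sub>R (T t (x - x') - (x - x'))) + norm ((1 / t) *\<^sub>R (T t x' - x' - t *\<^sub>R y')) + norm (y' - y)"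
      by (intro order_trans[OF norm_triangle_ineq] add_right_mono norm_triangle_ineq)
    also have "norm ((1 / t) *\<^sub>R (T t (x - x') - (x - x'))) \<le> norm (y - y')"
      unfolding norm_scaleR using T_lipschitz[OF B_diff[OF B B'] t(1)] t
      by (simp add: pos_divide_le_eq mult.commute)
    also have "norm ((1 / t) *\<^sub>R (T t x' - x' - t *\<^sub>R y')) \<le> 7 * t * norm z'"
      unfolding norm_scaleR using T_quadratic[OF D(1) t(1)] t
      by (simp add: pos_divide_le_eq power2_eq_square mult_ac)
    finally have "norm ((1 / t) *\<^sub>R (T t x - x) - y) < e"
      using elim D(3) by (simp add: norm_minus_commute)
    then show ?case by (simp add: dist_norm)
  qed
qed

text \<open>The generator cannot properly extend \<open>B\<close>, since \<open>1 - B\<close> is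
  already onto: the difference \<open>w\<close> from an element of \<open>B\<close> with the same
  image under it would be an eigenvector of the generator for the eigenvalue 1. Its norm would have
  to grow along the semigroup, which contracts.\<close>

lemma generator_imp_B:
  assumes G: "((\<lambda>t. (1 / t) *\<^sub>R (T t x - x)) \<longlongrightarrow> y) (at_right 0)"
  shows "(x, y) \<in> B"
proof -
  obtain x' y' where B: "(x', y') \<in> B" "x' - 1 *\<^sub>R y' = x - y" using range[of 1 "x - y"] by auto
  define w where "w = x' - x"
  have w: "w = y' - y" using B(2) by (simp add: w_def algebra_simps)
  have "((\<lambda>t. (1 / t) *\<^sub>R (T t x' - x') - (1 / t) *\<^sub>R (T t x - x)) \<longlongrightarrow> y' - y) (at_right 0)"
    by (intro tendsto_diff T_has_generator B G)
  then have lim: "((\<lambda>t. norm ((1 / t) *\<^sub>R (T t x' - x') - (1 / t) *\<^sub>R (T t x - x) - w)) \<longlongrightarrow> 0) (at_right 0)"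
    unfolding w[symmetric] by (simp add: tendsto_norm_zero_iff LIM_zero_iff)
  have "norm w \<le> 0"
  proof (rule tendsto_lowerbound[OF lim])
    show "\<forall>\<^sub>F t in at_right 0. norm w \<le> norm ((1 / t) *\<^sub>R (T t x' - x') - (1 / t) *\<^sub>R (T t x - x) - w)"
      using eventually_at_right_less[of 0]
    proof eventually_elim
      case (elim t)
      have e: "(1 / t) *\<^sub>R (T t x' - x') - (1 / t) *\<^sub>R (T t x - x) - w = (1 / t) *\<^sub>R (T t w - (1 + t) *\<^sub>R w)"
        using elim by (simp add: w_def T_simps algebra_simps)
      have "(1 + t) * norm w - norm w \<le> norm ((1 + t) *\<^sub>R w) - norm (T t w)"
        using T_simps(4)[of t w] elim by simp
      also have "\<dots> \<le> norm ((1 + t) *\<^sub>R w - T t w)" by (rule norm_triangle_ineq2)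
      finally have "t * norm w \<le> norm (T t w - (1 + t) *\<^sub>R w)"
        by (simp add: norm_minus_commute algebra_simps)
      then show ?case unfolding e using elim
        by (simp add: pos_le_divide_eq mult.commute del: scaleR_left_distrib)
    qed
  qed simp
  then show ?thesis using B(1) w by (simp add: w_def)
qed

end

section \<open>Uniform boundedness and uniqueness of orbits\<close>

lemma bounded_operatorD:
  assumes "bounded_operator p T"
  shows "f \<in> Lp p \<Longrightarrow> T f \<in> Lp p"
    "f \<in> Lp p \<Longrightarrow> g \<in> Lp p \<Longrightarrow> T (f + g) = T f + T g"
    "f \<in> Lp p \<Longrightarrow> T (scaleC c f) = scaleC c (T f)"
  using assms by (auto simp: bounded_operator_def)

lemma bounded_operator_uminus: "bounded_operator p T \<Longrightarrow> f \<in> Lp p \<Longrightarrow> T (- f) = - T f"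
  using bounded_operatorD(3)[of p T f "-1"] by (simp add: scaleC_minus_one)

lemma bounded_operator_diff:
  "bounded_operator p T \<Longrightarrow> f \<in> Lp p \<Longrightarrow> g \<in> Lp p \<Longrightarrow> T (f - g) = T f - T g"
  using bounded_operatorD(2)[of p T f "- g"] bounded_operator_uminus[of p T g] by (simp add: Lp_uminus)

definition op_norm :: "real \<Rightarrow> (L0 \<Rightarrow> L0) \<Rightarrow> real" where
  "op_norm p T = (SUP f\<in>{f \<in> Lp p. Lp_norm p f \<le> 1}. Lp_norm p (T f))"

lemma op_norm_bdd:
  assumes "bounded_operator p T"
  shows "bdd_above ((\<lambda>f. Lp_norm p (T f)) ` {f \<in> Lp p. Lp_norm p f \<le> 1})"
proof -
  obtain K where K: "\<And>f. f \<in> Lp p \<Longrightarrow> Lp_norm p (T f) \<le> K * Lp_norm p f"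
    using assms unfolding bounded_operator_def by blast
  have "Lp_norm p (T f) \<le> \<bar>K\<bar>" if "f \<in> Lp p" "Lp_norm p f \<le> 1" for f
  proof -
    have "K * Lp_norm p f \<le> \<bar>K\<bar> * 1" using that by (intro mult_mono) auto
    then show ?thesis using K[OF that(1)] by simp
  qed
  then show ?thesis by (intro bdd_aboveI2[of _ _ "\<bar>K\<bar>"]) auto
qed

lemma op_norm_bound:
  assumes p: "p > 0" and T: "bounded_operator p T" and f: "f \<in> Lp p"
  shows "Lp_norm p (T f) \<le> op_norm p T * Lp_norm p f"
proof (cases "f = 0")
  case True
  have "T 0 = 0" using bounded_operatorD(3)[OF T, of 0 0] by simp
  then show ?thesis using True by simp
next
  case False
  then have n: "Lp_norm p f > 0" using Lp_norm_eq_0_iff[OF p f] Lp_norm_nonneg[of p f] by linarith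
  let ?c = "of_real (1 / Lp_norm p f) :: complex"
  have "Lp_norm p (T (scaleC ?c f)) \<le> op_norm p T"
    unfolding op_norm_def using f n p
    by (intro cSUP_upper op_norm_bdd[OF T]) (simp add: Lp_scaleC Lp_norm_scaleC norm_divide)
  then show ?thesis using n p bounded_operatorD(3)[OF T f, of ?c]
    by (simp add: Lp_norm_scaleC norm_divide field_simps)
qed

text \<open>\<open>gliding_hump\<close> loses up to half of the operator norm (times
  \<open>(1/3) ^ n\<close>), so the fraction has to exceed 1/2; with 3/4 a quarter is left.\<close>

lemma op_norm_nearly:
  assumes T: "bounded_operator p T" and pos: "0 < op_norm p T"
  obtains f where "f \<in> Lp p" "Lp_norm p f \<le> 1" "3/4 * op_norm p T \<le> Lp_norm p (T f)"
proof -
  have "3/4 * op_norm p T < (SUP f\<in>{f \<in> Lp p. Lp_norm p f \<le> 1}. Lp_norm p (T f))"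
    using pos by (simp add: op_norm_def[symmetric])
  then obtain y where "y \<in> (\<lambda>f. Lp_norm p (T f)) ` {f \<in> Lp p. Lp_norm p f \<le> 1}" "3/4 * op_norm p T < y"
    by (rule less_cSupE) (auto intro: exI[of _ 0])
  then show ?thesis using that by auto
qed

text \<open>Gliding hump: the signs of successive perturbations of size \<open>3\<^sup>-\<^sup>n\<close> are chosen so that
  the \<open>n\<close>-th operator sees the \<open>n\<close>-th perturbation; the later ones are too small to undo this.\<close>

lemma gliding_hump:
  assumes p: "1 \<le> p" and T: "\<And>n. bounded_operator p (T n)"
    and h: "\<And>n. h n \<in> Lp p" "\<And>n. Lp_norm p (h n) \<le> (1/3) ^ n"
  obtains F where "F \<in> Lp p" "\<And>n. Lp_norm p (T n (h n)) \<le> Lp_norm p (T n F) + op_norm p (T n) * ((1/2) * (1/3) ^ n)"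
proof -
  have p0: "p > 0" using p by simp
  define x where "x = rec_nat 0 (\<lambda>n y. if Lp_norm p (T n (h n)) \<le> Lp_norm p (T n (y + h n)) then y + h n else y - h n)"
  have x_Suc: "x (Suc n) = (if Lp_norm p (T n (h n)) \<le> Lp_norm p (T n (x n + h n)) then x n + h n else x n - h n)" for n
    by (simp add: x_def)
  have x: "x n \<in> Lp p" for n
  proof (induction n)
    case (Suc n)
    then show ?case by (simp add: x_Suc Lp_add[OF p] Lp_diff[OF p] h)
  qed (simp add: x_def)
  have step: "Lp_norm p (x (Suc n) - x n) \<le> (1/3) ^ n" for n
    using h(2)[of n] by (simp add: x_Suc Lp_norm_uminus[OF p0])
  have big: "Lp_norm p (T n (h n)) \<le> Lp_norm p (T n (x (Suc n)))" for n
  proof (cases "Lp_norm p (T n (h n)) \<le> Lp_norm p (T n (x n + h n))")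
    case False
    let ?a = "T n (x n)" and ?b = "T n (h n)"
    have ab: "?a \<in> Lp p" "?b \<in> Lp p" by (auto intro: bounded_operatorD(1)[OF T] x h)
    \<comment> \<open>Twice \<open>?b\<close> is the difference of the two candidates, hence one of
      them has at least the norm of \<open>?b\<close>.\<close>
    have "scaleC 2 ?b = (?a + ?b) - (?a - ?b)"
      by (simp add: L0.scale_left_distrib[of 1 1, simplified])
    then have "2 * Lp_norm p ?b \<le> Lp_norm p (?a + ?b) + Lp_norm p (?a - ?b)"
      using Lp_norm_triangle_diff[OF p Lp_add[OF p ab] Lp_diff[OF p ab]] Lp_norm_scaleC[OF p0, of 2 ?b] by simp
    then show ?thesis using False x h
      by (simp add: x_Suc bounded_operatorD(2)[OF T] bounded_operator_diff[OF T])
  qed (simp add: x_Suc)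
  \<comment> \<open>\<open>3/2 * (1/3) ^ n\<close> is the geometric sum of all later perturbations.
    From index \<open>Suc n\<close> on it is half of \<open>(1/3) ^ n\<close>, which is the loss in
    the conclusion.\<close>
  have tail: "Lp_norm p (x (n + k) - x n) \<le> 3/2 * ((1/3) ^ n - (1/3) ^ (n + k))" for n k
  proof (induction k)
    case (Suc k)
    have "x (n + Suc k) - x n = (x (Suc (n + k)) - x (n + k)) + (x (n + k) - x n)" by simp
    then have "Lp_norm p (x (n + Suc k) - x n) \<le> Lp_norm p (x (Suc (n + k)) - x (n + k)) + Lp_norm p (x (n + k) - x n)"
      using Lp_norm_triangle[OF p Lp_diff[OF p x x] Lp_diff[OF p x x]] by metis
    also have "\<dots> \<le> (1/3) ^ (n + k) + 3/2 * ((1/3) ^ n - (1/3) ^ (n + k))"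
      by (intro add_mono step Suc)
    also have "\<dots> = 3/2 * ((1/3) ^ n - (1/3) ^ (n + Suc k))" by (simp add: field_simps)
    finally show ?case .
  qed simp
  have tail': "Lp_norm p (x m - x n) \<le> 3/2 * (1/3) ^ n" if "m \<ge> n" for m n
  proof -
    have "Lp_norm p (x m - x n) \<le> 3/2 * ((1/3) ^ n - (1/3) ^ m)"
      using tail[of n "m - n"] that by simp
    also have "\<dots> \<le> 3/2 * (1/3) ^ n" by simp
    finally show ?thesis .
  qed
  have "\<exists>F\<in>Lp p. (\<lambda>n. Lp_norm p (x n - F)) \<longlonglongrightarrow> 0"
  proof (rule Lp_complete[OF p x])
    fix e :: real assume "e > 0"
    then obtain N where N: "(1/3 :: real) ^ N < e / 3" using real_arch_pow_inv[of "e / 3" "1/3"] by auto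
    have "Lp_norm p (x m - x n) < e" if "m \<ge> N" "n \<ge> N" for m n
    proof -
      have "Lp_norm p ((x m - x N) - (x n - x N)) \<le> 3/2 * (1/3) ^ N + 3/2 * (1/3) ^ N"
        by (intro order_trans[OF Lp_norm_triangle_diff[OF p Lp_diff[OF p x x] Lp_diff[OF p x x]]] add_mono tail' that)
      then show ?thesis using N by simp
    qed
    then show "\<exists>N. \<forall>m\<ge>N. \<forall>n\<ge>N. Lp_norm p (x m - x n) < e" by blast
  qed
  then obtain F where F: "F \<in> Lp p" "(\<lambda>n. Lp_norm p (x n - F)) \<longlonglongrightarrow> 0" by blast
  have lim: "Lp_norm p (F - x n) \<le> 3/2 * (1/3) ^ n" for n
  proof -
    have "Lp_norm p (F - x n) \<le> Lp_norm p (x m - F) + 3/2 * (1/3) ^ n" if "m \<ge> n" for m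
    proof -
      have "F - x n = (x m - x n) - (x m - F)" by simp
      then have "Lp_norm p (F - x n) \<le> Lp_norm p (x m - x n) + Lp_norm p (x m - F)"
        using Lp_norm_triangle_diff[OF p Lp_diff[OF p x x] Lp_diff[OF p x F(1)]] by metis
      then show ?thesis using tail'[OF that] by simp
    qed
    then show ?thesis
      using LIMSEQ_le_const[OF tendsto_add[OF F(2) tendsto_const[of "3/2 * (1/3) ^ n"]], of "Lp_norm p (F - x n)"]
      by auto
  qed
  show ?thesis
  proof (rule that[OF F(1)])
    fix n
    have "Lp_norm p (T n (x (Suc n))) \<le> Lp_norm p (T n F) + Lp_norm p (T n (x (Suc n)) - T n F)"
      by (intro Lp_norm_triangle_sub p bounded_operatorD(1)[OF T] x F)
    also have "T n (x (Suc n)) - T n F = - T n (F - x (Suc n))"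
      by (simp add: bounded_operator_diff[OF T F(1) x])
    also have "Lp_norm p (- T n (F - x (Suc n))) \<le> op_norm p (T n) * Lp_norm p (F - x (Suc n))"
      using op_norm_bound[OF p0 T Lp_diff[OF p F(1) x]] by (simp add: Lp_norm_uminus[OF p0])
    also have "op_norm p (T n) * Lp_norm p (F - x (Suc n)) \<le> op_norm p (T n) * ((1/2) * (1/3) ^ n)"
    proof (rule mult_left_mono)
      show "Lp_norm p (F - x (Suc n)) \<le> (1/2) * (1/3) ^ n" using lim[of "Suc n"] by simp
      have "Lp_norm p (T n 0) \<le> op_norm p (T n)"
        unfolding op_norm_def by (intro cSUP_upper op_norm_bdd[OF T]) simp
      then show "0 \<le> op_norm p (T n)" using Lp_norm_nonneg[of p "T n 0"] by linarith
    qed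
    finally show "Lp_norm p (T n (h n)) \<le> Lp_norm p (T n F) + op_norm p (T n) * ((1/2) * (1/3) ^ n)"
      using big[of n] by linarith
  qed
qed

theorem uniform_boundedness:
  assumes p: "1 \<le> p" and T: "\<And>i. i \<in> I \<Longrightarrow> bounded_operator p (T i)"
    and pw: "\<And>f. f \<in> Lp p \<Longrightarrow> \<exists>K. \<forall>i\<in>I. Lp_norm p (T i f) \<le> K"
  shows "\<exists>K\<ge>0. \<forall>i\<in>I. \<forall>f\<in>Lp p. Lp_norm p (T i f) \<le> K * Lp_norm p f"
proof (cases "\<exists>K. \<forall>i\<in>I. op_norm p (T i) \<le> K")
  case True
  then obtain K where K: "\<And>i. i \<in> I \<Longrightarrow> op_norm p (T i) \<le> K" by blast
  have "Lp_norm p (T i f) \<le> \<bar>K\<bar> * Lp_norm p f" if "i \<in> I" "f \<in> Lp p" for i f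
  proof -
    have "op_norm p (T i) \<le> \<bar>K\<bar>" using K[OF that(1)] by linarith
    then show ?thesis
      using op_norm_bound[OF _ T[OF that(1)] that(2)] p mult_right_mono[of "op_norm p (T i)" "\<bar>K\<bar>" "Lp_norm p f"]
      by (meson Lp_norm_nonneg less_le_trans order_trans zero_less_one)
  qed
  then show ?thesis by (intro exI[of _ "\<bar>K\<bar>"]) auto
next
  case False
  have p0: "p > 0" using p by simp
  \<comment> \<open>The factor 4 undoes the remaining quarter and \<open>3 ^ n\<close> the size of
    the perturbation, so that the \<open>n\<close>-th operator exceeds \<open>n + 1\<close> at
    \<open>F\<close>.\<close>
  have "\<forall>n. \<exists>i\<in>I. op_norm p (T i) > 4 * real (Suc n) * 3 ^ n" using False by (meson not_le)
  then obtain i where i: "\<And>n. i n \<in> I" "\<And>n. op_norm p (T (i n)) > 4 * real (Suc n) * 3 ^ n" by metis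
  have pos: "0 < op_norm p (T (i n))" for n
    using i(2)[of n] by (rule le_less_trans[rotated]) simp
  have "\<forall>n. \<exists>g. g \<in> Lp p \<and> Lp_norm p g \<le> 1 \<and> 3/4 * op_norm p (T (i n)) \<le> Lp_norm p (T (i n) g)"
    using op_norm_nearly[OF T[OF i(1)] pos] by metis
  then obtain g where g: "\<And>n. g n \<in> Lp p" "\<And>n. Lp_norm p (g n) \<le> 1"
    "\<And>n. 3/4 * op_norm p (T (i n)) \<le> Lp_norm p (T (i n) (g n))" by metis
  define h where "h n = scaleC (of_real ((1/3) ^ n)) (g n)" for n
  have h: "h n \<in> Lp p" "Lp_norm p (h n) \<le> (1/3) ^ n" for n
    using g by (auto simp: h_def Lp_scaleC Lp_norm_scaleC[OF p0] mult_left_le norm_power norm_divide)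
  have Th: "Lp_norm p (T (i n) (h n)) = (1/3) ^ n * Lp_norm p (T (i n) (g n))" for n
    unfolding h_def by (subst bounded_operatorD(3)[OF T[OF i(1)] g(1)]) (simp add: Lp_norm_scaleC[OF p0] norm_power norm_divide)
  obtain F where F: "F \<in> Lp p"
    "\<And>n. Lp_norm p (T (i n) (h n)) \<le> Lp_norm p (T (i n) F) + op_norm p (T (i n)) * ((1/2) * (1/3) ^ n)"
    by (rule gliding_hump[of p "\<lambda>n. T (i n)" h]) (use p T i(1) h in auto)
  obtain K where K: "\<And>j. j \<in> I \<Longrightarrow> Lp_norm p (T j F) \<le> K" using pw[OF F(1)] by blast
  obtain n where n: "K < real n" using reals_Archimedean2 by blast
  have "(1/3) ^ n * (3/4 * op_norm p (T (i n))) \<le> (1/3) ^ n * Lp_norm p (T (i n) (g n))"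
    by (intro mult_left_mono g(3)) simp
  also have "\<dots> \<le> K + op_norm p (T (i n)) * ((1/2) * (1/3) ^ n)"
    using F(2)[of n] K[OF i(1), of n] by (simp add: Th)
  finally have "(1/3) ^ n * op_norm p (T (i n)) \<le> 4 * K" by (simp add: algebra_simps)
  moreover have "4 * real (Suc n) < (1/3) ^ n * op_norm p (T (i n))"
    using i(2)[of n] by (simp add: field_simps power_divide)
  ultimately show ?thesis using n by simp
qed

text \<open>\<open>C0_semigroup\<close> bounds each operator separately. Orbits are continuous,
  hence bounded on a compact interval, and uniform boundedness yields a common constant.\<close>

lemma C0_semigroup_locally_bounded:
  assumes p: "1 \<le> p" and T: "C0_semigroup p T"
  shows "\<exists>K\<ge>0. \<forall>s\<in>{0..t}. \<forall>f\<in>Lp p. Lp_norm p (T s f) \<le> K * Lp_norm p f"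
proof (rule uniform_boundedness[OF p])
  show bo: "bounded_operator p (T s)" if "s \<in> {0..t}" for s
    using T that by (auto simp: C0_semigroup_def)
  fix f assume f: "f \<in> Lp p"
  have "continuous_on {0..t} (\<lambda>s. Lp_norm p (T s f))"
    unfolding continuous_on_def
  proof
    fix s assume s: "s \<in> {0..t}"
    have "((\<lambda>r. Lp_norm p (T r f - T s f)) \<longlongrightarrow> 0) (at s within {0..})"
      using T f s by (auto simp: C0_semigroup_def)
    then have lim: "((\<lambda>r. Lp_norm p (T r f - T s f)) \<longlongrightarrow> 0) (at s within {0..t})"
      by (rule tendsto_within_subset) auto
    show "((\<lambda>r. Lp_norm p (T r f)) \<longlongrightarrow> Lp_norm p (T s f)) (at s within {0..t})"
    proof (rule Lim_transform[OF tendsto_const], rule Lim_null_comparison[OF _ lim])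
      show "\<forall>\<^sub>F r in at s within {0..t}. norm (Lp_norm p (T r f) - Lp_norm p (T s f)) \<le> Lp_norm p (T r f - T s f)"
        unfolding eventually_at_filter
      proof (intro always_eventually allI impI)
        fix r assume "r \<in> {0..t}"
        then have "T r f \<in> Lp p" "T s f \<in> Lp p" using bounded_operatorD(1)[OF bo _] f s by auto
        then show "norm (Lp_norm p (T r f) - Lp_norm p (T s f)) \<le> Lp_norm p (T r f - T s f)"
          using Lp_norm_triangle_sub[OF p, of "T r f" "T s f"] Lp_norm_triangle_sub[OF p, of "T s f" "T r f"]
            Lp_norm_minus_commute[of p "T r f" "T s f"] p by (auto simp: abs_le_iff)
      qed
    qed
  qed
  then have "compact ((\<lambda>s. Lp_norm p (T s f)) ` {0..t})"
    by (rule compact_continuous_image) simp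
  then have "bounded ((\<lambda>s. Lp_norm p (T s f)) ` {0..t})" by (rule compact_imp_bounded)
  then show "\<exists>K. \<forall>s\<in>{0..t}. Lp_norm p (T s f) \<le> K"
    unfolding bounded_iff by (metis abs_le_D1 imageI real_norm_def)
qed

text \<open>The curve \<open>T (t - r) (u r)\<close> has derivative 0 in \<open>r\<close>. Calculus
  is done on the real function \<open>\<phi>\<close>, its distance to the end point, whose
  increments are controlled by those of the curve.\<close>

theorem orbit_unique:
  assumes p: "1 \<le> p" and T: "C0_semigroup p T"
    and u: "\<And>s. u s \<in> Lp p" and gen: "\<And>s. (u s, v s) \<in> generator p T"
    and deriv: "\<And>s. ((\<lambda>h. Lp_norm p (scaleC (of_real (1 / h)) (u (s + h) - u s) - v s)) \<longlongrightarrow> 0) (at 0)"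
    and t: "0 < t"
  shows "T t (u 0) = u t"
proof -
  have p0: "p > 0" using p by simp
  note arith = Lp_add[OF p] Lp_diff[OF p] Lp_scaleC
  obtain K where K: "K \<ge> 0" "\<And>s f. s \<in> {0..t} \<Longrightarrow> f \<in> Lp p \<Longrightarrow> Lp_norm p (T s f) \<le> K * Lp_norm p f"
    using C0_semigroup_locally_bounded[OF p T, of t] by blast
  have bo: "bounded_operator p (T s)" if "s \<in> {0..t}" for s using T that by (auto simp: C0_semigroup_def)
  have v: "v s \<in> Lp p" for s using gen[of s] by (auto simp: generator_def)
  have TLp: "T s f \<in> Lp p" if "s \<in> {0..t}" "f \<in> Lp p" for s f using bounded_operatorD(1)[OF bo] that by blast
  define y where "y r = T (t - r) (u r)" for r
  have yLp: "y r \<in> Lp p" if "r \<in> {0..t}" for r using that u by (auto simp: y_def intro!: TLp)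
  define \<phi> where "\<phi> r = Lp_norm p (y r - y t)" for r
  \<comment> \<open>By the semigroup law \<open>y b - y a\<close> is \<open>T (t - b)\<close>
    applied to the defect of \<open>u\<close> over one step, so \<open>T\<close> itself is never
    differentiated at a positive time.\<close>
  have step: "Lp_norm p (y b - y a) \<le> K * Lp_norm p (u b - T (b - a) (u a))" if "0 \<le> a" "a \<le> b" "b \<le> t" for a b
  proof -
    have "T (t - a) (u a) = T (t - b) (T (b - a) (u a))"
    proof -
      have "T ((t - b) + (b - a)) (u a) = T (t - b) (T (b - a) (u a))"
        using T that u[of a] unfolding C0_semigroup_def by (metis diff_ge_0_iff_ge)
      then show ?thesis by simp
    qed
    then have "y b - y a = T (t - b) (u b - T (b - a) (u a))"
      using that by (simp add: y_def bounded_operator_diff[OF bo] u TLp)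
    then show ?thesis using K(2)[of "t - b"] that u TLp by (simp add: arith)
  qed
  have scale: "Lp_norm p (f - scaleC (of_real h) g) = \<bar>h\<bar> * Lp_norm p (scaleC (of_real (1 / h)) f - g)" if "h \<noteq> 0" for h f g
  proof -
    have "f - scaleC (of_real h) g = scaleC (of_real h) (scaleC (of_real (1 / h)) f - g)"
      using that by (simp add: L0.scale_right_diff_distrib)
    then show ?thesis using Lp_norm_scaleC[OF p0] by simp
  qed
  have "(\<phi> has_real_derivative 0) (at r within {0..t})" if r: "r \<in> {0..t}" for r
    unfolding has_field_derivative_iff
  proof (rule tendstoI)
    fix e0 :: real assume e0: "e0 > 0"
    \<comment> \<open>A step to the right has two errors \<open>h * e\<close>, a step to the left an
      additional one multiplied by \<open>K\<close>, and the outer operator contributes another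
      \<open>K\<close>. The \<open>+ 1\<close> keeps the denominator positive.\<close>
    define e where "e = e0 / (K * (K + 2) + 1)"
    have "K * (K + 2) + 1 > 0" using K(1) by (simp add: add_nonneg_pos)
    then have e: "e > 0" "K * (K + 2) * e < e0" using e0 by (auto simp: e_def field_simps)
    have "\<forall>\<^sub>F h in at 0. Lp_norm p (scaleC (of_real (1 / h)) (u (r + h) - u r) - v r) < e"
      by (rule order_tendstoD(2)[OF deriv]) (rule e)
    then obtain d1 where d1: "d1 > 0"
      "\<And>h. h \<noteq> 0 \<Longrightarrow> \<bar>h\<bar> < d1 \<Longrightarrow> Lp_norm p (scaleC (of_real (1 / h)) (u (r + h) - u r) - v r) < e"
      by (auto simp: eventually_at)
    have "\<forall>\<^sub>F h in at_right 0. Lp_norm p (scaleC (of_real (1 / h)) (T h (u r) - u r) - v r) < e"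
      using gen[of r] e by (intro order_tendstoD(2)[of _ 0]) (auto simp: generator_def)
    then obtain d2 where d2: "d2 > 0"
      "\<And>h. 0 < h \<Longrightarrow> h < d2 \<Longrightarrow> Lp_norm p (scaleC (of_real (1 / h)) (T h (u r) - u r) - v r) < e"
      unfolding eventually_at_right_field by force
    have "((\<lambda>h. Lp_norm p (T h (v r) - T 0 (v r))) \<longlongrightarrow> 0) (at 0 within {0..})"
      using T v[of r] unfolding C0_semigroup_def by blast
    then have "\<forall>\<^sub>F h in at 0 within {0..}. Lp_norm p (T h (v r) - T 0 (v r)) < e"
      by (rule order_tendstoD(2)) (rule e)
    then obtain d3 where d3: "d3 > 0" "\<And>h. 0 < h \<Longrightarrow> h < d3 \<Longrightarrow> Lp_norm p (T h (v r) - T 0 (v r)) < e"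
      by (auto simp: eventually_at)
    have T0: "T 0 (v r) = v r" using T v[of r] unfolding C0_semigroup_def by blast
    have bound: "\<bar>\<phi> r' - \<phi> r\<bar> \<le> K * (K + 2) * e * \<bar>r' - r\<bar>"
      if r': "r' \<in> {0..t}" "r' \<noteq> r" "\<bar>r' - r\<bar> < Min {d1, d2, d3}" for r'
    proof -
      define h where "h = \<bar>r' - r\<bar>"
      have h: "0 < h" "h < d1" "h < d2" "h < d3" "h \<in> {0..t}" using r r' by (auto simp: h_def abs_if)
      have a: "Lp_norm p ((T h (u r) - u r) - scaleC (of_real h) (v r)) \<le> h * e"
        using d2(2)[of h] h by (simp add: scale)
      have b: "Lp_norm p ((u r' - u r) - scaleC (of_real (r' - r)) (v r)) \<le> h * e"
        using d1(2)[of "r' - r"] r' h(1) by (subst scale) (auto simp: h_def mult_left_mono)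
      have main: "Lp_norm p (y r' - y r) \<le> K * ((K + 2) * (h * e))"
      proof (cases "r < r'")
        case True
        then have hr: "h = r' - r" by (simp add: h_def)
        have "u r' - T h (u r) = ((u r' - u r) - scaleC (of_real h) (v r)) - ((T h (u r) - u r) - scaleC (of_real h) (v r))"
          by simp
        also have "Lp_norm p \<dots> \<le> Lp_norm p ((u r' - u r) - scaleC (of_real h) (v r)) + Lp_norm p ((T h (u r) - u r) - scaleC (of_real h) (v r))"
          using h by (intro Lp_norm_triangle_diff[OF p] arith u v TLp)
        also have "\<dots> \<le> h * e + h * e" using a b hr by (intro add_mono) auto
        also have "\<dots> \<le> (K + 2) * (h * e)" using K(1) h e by (simp add: algebra_simps)
        finally show ?thesis using step[of r r'] True r r' K(1) hr
          by (auto intro: order_trans mult_left_mono)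
      next
        case False
        then have hr: "r' - r = - h" "r - r' = h" "r' < r" using r' by (auto simp: h_def)
        \<comment> \<open>The step starts at \<open>r'\<close>, but the derivatives are controlled
          at \<open>r\<close>. Therefore \<open>u r'\<close> is expanded around \<open>r\<close>
          before \<open>T h\<close> is applied, which leaves \<open>T h (v r) - v r\<close>, small
          by strong continuity.\<close>
        define w where "w = (u r' - u r) - scaleC (of_real (- h)) (v r)"
        have w: "w \<in> Lp p" "Lp_norm p w \<le> h * e" using b by (auto simp: w_def hr intro!: arith u v)
        have "T h w = (T h (u r') - T h (u r)) - scaleC (of_real (- h)) (T h (v r))"
          using h unfolding w_def
          by (simp only: bounded_operator_diff[OF bo[OF h(5)]] bounded_operatorD(3)[OF bo[OF h(5)]] arith u v)
        then have "u r - T h (u r') = scaleC (of_real h) (T h (v r) - v r)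
            - (((T h (u r) - u r) - scaleC (of_real h) (v r)) + T h w)"
          by (simp add: L0.scale_right_diff_distrib algebra_simps)
        also have "Lp_norm p \<dots> \<le> Lp_norm p (scaleC (of_real h) (T h (v r) - v r)) +
            (Lp_norm p ((T h (u r) - u r) - scaleC (of_real h) (v r)) + Lp_norm p (T h w))"
          using h by (intro order_trans[OF Lp_norm_triangle_diff[OF p]] add_left_mono Lp_norm_triangle[OF p] arith u v TLp w)
        also have "\<dots> \<le> h * e + (h * e + K * (h * e))"
        proof (intro add_mono a)
          show "Lp_norm p (scaleC (of_real h) (T h (v r) - v r)) \<le> h * e"
            using d3(2)[of h] h by (simp add: Lp_norm_scaleC[OF p0] T0)
          show "Lp_norm p (T h w) \<le> K * (h * e)"
            using K(2)[OF h(5) w(1)] w(2) K(1) by (meson mult_left_mono order_trans)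
        qed
        also have "\<dots> = (K + 2) * (h * e)" by (simp add: algebra_simps)
        finally have "Lp_norm p (y r - y r') \<le> K * ((K + 2) * (h * e))"
          using step[of r' r] hr r r' K(1) by (auto intro: order_trans mult_left_mono)
        then show ?thesis by (simp add: Lp_norm_minus_commute[OF p0, of "y r'"])
      qed
      have tt: "t \<in> {0..t}" using t by simp
      have "\<bar>\<phi> r' - \<phi> r\<bar> \<le> Lp_norm p (y r' - y r)"
        using Lp_norm_triangle_sub[OF p, of "y r' - y t" "y r - y t"] Lp_norm_triangle_sub[OF p, of "y r - y t" "y r' - y t"]
          Lp_norm_minus_commute[OF p0, of "y r" "y r'"] yLp r r' tt
        by (auto simp: \<phi>_def arith abs_le_iff)
      then show ?thesis using main by (simp add: h_def mult_ac)
    qed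
    have "\<forall>\<^sub>F r' in at r within {0..t}. r' \<in> {0..t} \<and> r' \<noteq> r \<and> \<bar>r' - r\<bar> < Min {d1, d2, d3}"
      unfolding eventually_at using d1(1) d2(1) d3(1)
      by (intro exI[of _ "Min {d1, d2, d3}"]) (auto simp: dist_real_def)
    then show "\<forall>\<^sub>F r' in at r within {0..t}. dist ((\<phi> r' - \<phi> r) / (r' - r)) 0 < e0"
    proof eventually_elim
      case (elim r')
      then have "\<bar>\<phi> r' - \<phi> r\<bar> / \<bar>r' - r\<bar> \<le> K * (K + 2) * e"
        using bound[of r'] by (simp add: pos_divide_le_eq)
      then show ?case using e(2) by (simp add: abs_divide)
    qed
  qed
  then obtain c where c: "\<And>r. r \<in> {0..t} \<Longrightarrow> \<phi> r = c"
    using has_field_derivative_zero_constant[of "{0..t}" \<phi>] by auto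
  have "\<phi> 0 = \<phi> t" using c t by simp
  then have "Lp_norm p (y 0 - y t) = 0" by (simp add: \<phi>_def)
  then have "y 0 = y t" using Lp_norm_eq_0_iff[OF p0, of "y 0 - y t"] yLp t by (simp add: arith)
  moreover have "T 0 (u t) = u t" using T u[of t] unfolding C0_semigroup_def by blast
  ultimately show ?thesis by (simp add: y_def)
qed

section \<open>The explicit solution\<close>

lemma test_functionE:
  assumes "test_function \<phi>"
  obtains M where "M > 0" "\<And>x. (\<phi> has_real_derivative deriv \<phi> x) (at x)"
    "continuous_on UNIV \<phi>" "continuous_on UNIV (deriv \<phi>)"
    "\<And>x. M \<le> \<bar>x\<bar> \<Longrightarrow> \<phi> x = 0" "\<And>x. M \<le> \<bar>x\<bar> \<Longrightarrow> deriv \<phi> x = 0"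
proof -
  have d: "(deriv ^^ n) \<phi> differentiable_on UNIV" for n using assms by (simp add: test_function_def)
  have "\<phi> field_differentiable at x" for x
    using d[of 0] by (simp add: differentiable_on_def real_differentiable_def field_differentiable_def)
  then have der: "(\<phi> has_real_derivative deriv \<phi> x) (at x)" for x
    by (simp add: DERIV_deriv_iff_field_differentiable)
  have c: "continuous_on UNIV \<phi>" "continuous_on UNIV (deriv \<phi>)"
    using differentiable_imp_continuous_on[OF d[of 0]] differentiable_imp_continuous_on[OF d[of 1]] by auto
  have "bounded (closure {x. \<phi> x \<noteq> 0})"
    using assms by (simp add: test_function_def compact_imp_bounded)
  then have "bounded {x. \<phi> x \<noteq> 0}" using bounded_closure bounded_subset closure_subset by blast
  then obtain B where B: "\<And>x. \<phi> x \<noteq> 0 \<Longrightarrow> \<bar>x\<bar> \<le> B" by (auto simp: bounded_iff)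
  \<comment> \<open>One more than the support bound: each \<open>x\<close> with
    \<open>M \<le> \<bar>x\<bar>\<close> has a neighbourhood where \<open>\<phi>\<close> vanishes,
    so the derivative vanishes there too.\<close>
  define M where "M = \<bar>B\<bar> + 1"
  have z: "\<phi> x = 0" if "\<bar>B\<bar> < \<bar>x\<bar>" for x using B[of x] that by linarith
  have "deriv \<phi> x = 0" if "M \<le> \<bar>x\<bar>" for x
  proof -
    have "((\<lambda>_. 0) has_real_derivative deriv \<phi> x) (at x)"
    proof (rule has_field_derivative_transform_within_open[OF der])
      show "open {y. \<bar>B\<bar> < \<bar>y\<bar>}" by (intro open_Collect_less continuous_intros)
      show "x \<in> {y. \<bar>B\<bar> < \<bar>y\<bar>}" using that by (simp add: M_def)
    qed (auto simp: z)
    then show ?thesis using DERIV_const DERIV_unique by blast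
  qed
  then show ?thesis using der c by (intro that[of M]) (auto simp: M_def intro!: z)
qed

lemma has_integral_compact_support:
  fixes F :: "real \<Rightarrow> 'a::euclidean_space"
  assumes der: "\<And>x. (F has_vector_derivative f x) (at x)" and cont: "continuous_on UNIV f"
    and M: "M \<ge> 0" "\<And>x. M < \<bar>x\<bar> \<Longrightarrow> f x = 0"
  shows "has_bochner_integral lborel f (F M - F (- M))"
proof -
  have "has_bochner_integral lborel (\<lambda>x. indicator {- M..M} x *\<^sub>R f x) (F M - F (- M))"
    using M der by (intro has_bochner_integral_FTC_Icc) (auto intro: has_vector_derivative_at_within continuous_on_subset[OF cont])
  moreover have "indicator {- M..M} x *\<^sub>R f x = f x" for x
    using M(2)[of x] by (auto simp: indicator_def)
  ultimately show ?thesis by simp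
qed

lemma integrable_compact_support:
  fixes f :: "real \<Rightarrow> 'a::euclidean_space"
  assumes "continuous_on UNIV f" "\<And>x. M < \<bar>x\<bar> \<Longrightarrow> f x = 0"
  shows "integrable lborel f"
proof -
  have "integrable lborel (\<lambda>x. indicator {- M..M} x *\<^sub>R f x)"
    using borel_integrable_compact[of "{- M..M}" f] continuous_on_subset[OF assms(1)] by (simp add: set_integrable_def)
  moreover have "indicator {- M..M} x *\<^sub>R f x = f x" for x
    using assms(2)[of x] by (auto simp: indicator_def)
  ultimately show ?thesis by simp
qed

lemma weak_derivative_of_C1:
  fixes f :: "real \<Rightarrow> complex"
  assumes der: "\<And>x. (f has_vector_derivative f' x) (at x)" and cont: "continuous_on UNIV f'"
  shows "weak_derivative (abs_L0 f) (abs_L0 f')"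
proof -
  have cf: "continuous_on UNIV f"
    using der by (intro continuous_at_imp_continuous_on ballI) (rule has_vector_derivative_continuous)
  have "(LINT x|lborel. f x * of_real (deriv \<phi> x)) = - (LINT x|lborel. f' x * of_real (\<phi> x))"
    if \<phi>: "test_function \<phi>" for \<phi>
  proof -
    obtain M where M: "M > 0" "\<And>x. (\<phi> has_real_derivative deriv \<phi> x) (at x)"
      "continuous_on UNIV \<phi>" "continuous_on UNIV (deriv \<phi>)"
      "\<And>x. M \<le> \<bar>x\<bar> \<Longrightarrow> \<phi> x = 0" "\<And>x. M \<le> \<bar>x\<bar> \<Longrightarrow> deriv \<phi> x = 0"
      using test_functionE[OF \<phi>] by metis
    let ?g = "\<lambda>x. f x * of_real (deriv \<phi> x) + f' x * of_real (\<phi> x)"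
    have "has_bochner_integral lborel ?g (f M * of_real (\<phi> M) - f (- M) * of_real (\<phi> (- M)))"
    proof (rule has_integral_compact_support[where F = "\<lambda>x. f x * of_real (\<phi> x)"])
      fix x
      show "((\<lambda>x. f x * complex_of_real (\<phi> x)) has_vector_derivative ?g x) (at x)"
        using M(2)[of x] by (intro has_vector_derivative_mult der has_vector_derivative_of_real)
          (simp add: has_real_derivative_iff_has_vector_derivative)
    next
      show "continuous_on UNIV ?g" using M cf cont by (intro continuous_intros)
    qed (use M in auto)
    then have "(LINT x|lborel. ?g x) = 0"
      using M by (simp add: has_bochner_integral_integral_eq)
    moreover have "integrable lborel (\<lambda>x. f x * of_real (deriv \<phi> x))" "integrable lborel (\<lambda>x. f' x * of_real (\<phi> x))"
      using M cf cont by (auto intro!: integrable_compact_support[of _ M] continuous_intros)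
    ultimately show ?thesis by (simp add: add_eq_0_iff2)
  qed
  then show ?thesis
    using cf cont by (simp add: weak_derivative_abs borel_measurable_continuous_onI)
qed

text \<open>With \<open>a = 1 - \<i> x\<close> and \<open>b = d - \<i> t\<close>, the function \<open>U = exp (-2 \<surd>a \<surd>b) / \<surd>b\<close> and its derivative
  \<open>V\<close> in \<open>t\<close> satisfy \<open>\<partial>\<^sub>x V = - U\<close>, so that \<open>t \<mapsto> U\<close> solves the Cauchy problem for the inverse
  operator. Its norm in \<open>Lp p\<close> can be computed exactly from the substitution \<open>x = sinh y\<close>,
  \<open>t = d sinh s\<close>.\<close>

declare csqrt.sel [simp del]

definition sol :: "real \<Rightarrow> complex \<Rightarrow> complex \<Rightarrow> complex" where
  "sol d t x = exp (- 2 * csqrt (1 - \<i> * x) * csqrt (of_real d - \<i> * t)) / csqrt (of_real d - \<i> * t)"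

definition sol' :: "real \<Rightarrow> complex \<Rightarrow> complex \<Rightarrow> complex" where
  "sol' d t x = (\<i> / (2 * csqrt (of_real d - \<i> * t) ^ 3) + \<i> * csqrt (1 - \<i> * x) / csqrt (of_real d - \<i> * t) ^ 2)
     * exp (- 2 * csqrt (1 - \<i> * x) * csqrt (of_real d - \<i> * t))"

section \<open>Derivatives and decay of the explicit solution\<close>

lemma not_nonpos_Reals: "d > 0 \<Longrightarrow> of_real d - \<i> * of_real t \<notin> \<real>\<^sub>\<le>\<^sub>0"
  by (auto simp: complex_nonpos_Reals_iff)

lemma one_not_nonpos_Reals: "1 - \<i> * of_real x \<notin> \<real>\<^sub>\<le>\<^sub>0"
  using not_nonpos_Reals[of 1 x] by simp

lemma csqrt_nz: "d > 0 \<Longrightarrow> csqrt (of_real d - \<i> * of_real t) \<noteq> 0"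
  using not_nonpos_Reals[of d t] by (metis csqrt_eq_0 nonpos_Reals_zero_I)

lemma sol_field_deriv_t:
  assumes d: "d > 0"
  shows "((\<lambda>t. sol d t x) has_field_derivative sol' d (of_real t) x) (at (of_real t))"
proof -
  note nz = csqrt_nz[OF d, of t]
  show ?thesis
    unfolding sol_def sol'_def
    apply (rule derivative_eq_intros refl not_nonpos_Reals[OF d] nz)+
    using nz by (simp add: field_simps power2_eq_square power3_eq_cube)
qed

lemmas sol_deriv_t = has_vector_derivative_real_field[OF sol_field_deriv_t]

lemma sol'_deriv_x:
  assumes d: "d > 0"
  shows "((\<lambda>x. sol' d (of_real t) (of_real x)) has_vector_derivative - sol d (of_real t) (of_real x)) (at x)"
proof (rule has_vector_derivative_real_field)
  note nz = csqrt_nz[OF d, of t] csqrt_nz[of 1 x, simplified]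
  show "((\<lambda>x. sol' d (of_real t) x) has_field_derivative - sol d (of_real t) (of_real x)) (at (of_real x))"
    unfolding sol_def sol'_def
    apply (rule derivative_eq_intros refl one_not_nonpos_Reals nz power_not_zero)+
    using nz by (simp add: field_simps power2_eq_square power3_eq_cube)
qed

lemma sol_continuous:
  assumes "d > 0"
  shows "continuous_on UNIV (\<lambda>x. sol d (of_real t) (of_real x))"
    "continuous_on UNIV (\<lambda>x. sol' d (of_real t) (of_real x))"
proof -
  have c: "continuous_on UNIV (\<lambda>x. csqrt (1 - \<i> * of_real x))"
    by (intro continuous_at_imp_continuous_on ballI continuous_intros isCont_csqrt' one_not_nonpos_Reals)
  show "continuous_on UNIV (\<lambda>x. sol d (of_real t) (of_real x))"
    "continuous_on UNIV (\<lambda>x. sol' d (of_real t) (of_real x))"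
    unfolding sol_def sol'_def using csqrt_nz[OF assms] by (intro continuous_intros c; simp)+
qed

lemma sol_measurable [measurable]:
  assumes "d > 0"
  shows "(\<lambda>x. sol d (of_real t) (of_real x)) \<in> borel_measurable borel"
    "(\<lambda>x. sol' d (of_real t) (of_real x)) \<in> borel_measurable borel"
  using sol_continuous[OF assms] by (auto intro: borel_measurable_continuous_onI)

text \<open>Square roots of numbers in the right half plane have an argument below
  \<open>pi / 4\<close> in modulus. The product of two of them thus has positive real part, whence
  the decay of the exponential in \<open>sol\<close>.\<close>

lemma Re_csqrt_gt:
  assumes "Re b > 0" shows "\<bar>Im (csqrt b)\<bar> < Re (csqrt b)"
proof -
  have "Re b = (Re (csqrt b))^2 - (Im (csqrt b))^2"
    by (metis Re_power2 power2_csqrt)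
  then have "\<bar>Im (csqrt b)\<bar>^2 < (Re (csqrt b))^2" using assms by simp
  then show ?thesis using Re_csqrt[of b] by (rule power2_less_imp_less)
qed

lemma norm_one_minus_ix: "norm (csqrt (1 - \<i> * of_real x)) ^ 4 = 1 + x^2"
proof -
  have "norm (csqrt (1 - \<i> * of_real x)) ^ 4 = norm ((csqrt (1 - \<i> * of_real x))^2) ^ 2"
    unfolding norm_power power_mult[symmetric] by simp
  also have "\<dots> = 1 + x^2" by (simp add: cmod_power2)
  finally show ?thesis .
qed

text \<open>3125 is \<open>5 ^ 5\<close>. Of the five powers, \<open>sol_bound\<close> uses four to
  produce \<open>1 + x^2\<close> and one for the factor \<open>csqrt (1 - \<i> * x)\<close> of
  \<open>sol'\<close>.\<close>

lemma power5_exp_bound: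
  fixes y :: real assumes "y \<ge> 0" shows "y ^ 5 * exp (- y) \<le> 3125"
proof -
  have "(y / 5) ^ 5 \<le> exp (y / 5) ^ 5"
    using assms exp_ge_add_one_self[of "y / 5"] by (intro power_mono) linarith+
  also have "\<dots> = exp y" by (simp flip: exp_of_nat_mult)
  finally show ?thesis by (simp add: exp_minus field_simps power_divide)
qed

text \<open>Uniformity over \<open>\<bar>t\<bar> \<le> M\<close> is what differentiation in
  \<open>t\<close> under the norm requires. It comes from compactness: the gap
  \<open>Re - \<bar>Im\<bar>\<close> of the root depending on \<open>t\<close> attains a positive
  minimum \<open>\<delta>\<close>.\<close>

lemma sol_bound:
  assumes d: "d > 0"
  obtains C where "C \<ge> 0"
    "\<And>t x. \<bar>t\<bar> \<le> M \<Longrightarrow> norm (sol d (of_real t) (of_real x)) \<le> C / (1 + x^2)"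
    "\<And>t x. \<bar>t\<bar> \<le> M \<Longrightarrow> norm (sol' d (of_real t) (of_real x)) \<le> C / (1 + x^2)"
proof (cases "M \<ge> 0")
  case False
  then show ?thesis by (intro that[of 0]) auto
next
  case True
  let ?B = "\<lambda>t. csqrt (of_real d - \<i> * of_real t)"
  let ?A = "\<lambda>x. csqrt (1 - \<i> * of_real x)"
  have "continuous_on {-M..M} (\<lambda>t. Re (?B t) - \<bar>Im (?B t)\<bar>)"
    by (intro continuous_intros continuous_at_imp_continuous_on ballI isCont_csqrt' not_nonpos_Reals d)
  from continuous_attains_inf[OF _ _ this] True obtain t0 where t0: "t0 \<in> {-M..M}"
    "\<And>t. t \<in> {-M..M} \<Longrightarrow> Re (?B t0) - \<bar>Im (?B t0)\<bar> \<le> Re (?B t) - \<bar>Im (?B t)\<bar>" by auto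
  define \<delta> where "\<delta> = Re (?B t0) - \<bar>Im (?B t0)\<bar>"
  have \<delta>: "\<delta> > 0" using Re_csqrt_gt[of "of_real d - \<i> * of_real t0"] d by (simp add: \<delta>_def)
  have \<delta>le: "\<delta> \<le> Re (?B t) - \<bar>Im (?B t)\<bar>" if "\<bar>t\<bar> \<le> M" for t
    unfolding \<delta>_def by (rule t0(2)) (use that in auto)
  have Bge: "\<delta> \<le> norm (?B t)" if "\<bar>t\<bar> \<le> M" for t
    using \<delta>le[OF that] complex_Re_le_cmod[of "?B t"] by linarith
  define K where "K = 3125 / \<delta> ^ 5"
  have A1: "1 \<le> norm (?A x)" for x
  proof (rule ccontr)
    assume "\<not> 1 \<le> norm (?A x)"
    then have "norm (?A x) ^ 4 < 1" by (intro power_less_one_iff[THEN iffD2]) auto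
    then show False using norm_one_minus_ix[of x] by simp
  qed
  \<comment> \<open>Since \<open>\<bar>Im A\<bar> < Re A\<close>, the real part of
    \<open>A * B\<close> is at least \<open>\<delta> * Re A\<close>. The factor 2 in the exponent
    pays for \<open>norm A \<le> 2 * Re A\<close>.\<close>
  have ex: "norm (exp (- 2 * ?A x * ?B t)) \<le> exp (- (\<delta> * norm (?A x)))" if t: "\<bar>t\<bar> \<le> M" for t x
  proof -
    have a: "\<bar>Im (?A x)\<bar> < Re (?A x)" using Re_csqrt_gt[of "1 - \<i> * of_real x"] by simp
    have na: "norm (?A x) \<le> 2 * Re (?A x)" using cmod_le[of "?A x"] a by linarith
    have "Im (?A x) * Im (?B t) \<le> \<bar>Im (?A x)\<bar> * \<bar>Im (?B t)\<bar>" by (metis abs_ge_self abs_mult)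
    also have "\<dots> \<le> Re (?A x) * \<bar>Im (?B t)\<bar>" using a by (intro mult_right_mono) auto
    finally have "Re (?A x) * (Re (?B t) - \<bar>Im (?B t)\<bar>) \<le> Re (?A x * ?B t)"
      by (simp add: algebra_simps)
    moreover have "Re (?A x) * \<delta> \<le> Re (?A x) * (Re (?B t) - \<bar>Im (?B t)\<bar>)"
      using a by (intro mult_left_mono \<delta>le t) auto
    moreover have "norm (?A x) * \<delta> \<le> 2 * Re (?A x) * \<delta>" using na \<delta> by (intro mult_right_mono) auto
    ultimately have "\<delta> * norm (?A x) \<le> 2 * Re (?A x * ?B t)" by (simp add: algebra_simps)
    then show ?thesis by (simp add: norm_exp_eq_Re algebra_simps)
  qed
  have key: "norm (?A x) * exp (- (\<delta> * norm (?A x))) \<le> K / (1 + x^2)" for x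
  proof -
    let ?r = "norm (?A x)"
    have "(\<delta> * ?r) ^ 5 * exp (- (\<delta> * ?r)) \<le> 3125" using \<delta> by (intro power5_exp_bound) simp
    also have "(\<delta> * ?r) ^ 5 = \<delta> ^ 5 * (?r ^ 4 * ?r)"
      unfolding power_mult_distrib power_Suc2[symmetric] by simp
    finally have "\<delta> ^ 5 * (?r ^ 4 * (?r * exp (- (\<delta> * ?r)))) \<le> 3125"
      by (simp only: mult.assoc)
    then have "?r ^ 4 * (?r * exp (- (\<delta> * ?r))) \<le> K"
      unfolding K_def using \<delta> by (subst pos_le_divide_eq) (auto simp only: mult_ac zero_less_power)
    moreover have "0 < 1 + x^2" by (simp add: add_pos_nonneg)
    ultimately show ?thesis unfolding norm_one_minus_ix by (subst pos_le_divide_eq) (auto simp only: mult_ac)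
  qed
  define C where "C = (1 / \<delta> + 1 / \<delta>^2 + 1 / \<delta>^3) * K"
  have K: "K \<ge> 0" using \<delta> by (simp add: K_def)
  have main: "c * exp (- (\<delta> * norm (?A x))) \<le> C / (1 + x^2)"
    if "0 \<le> c" "c \<le> (1 / \<delta> + 1 / \<delta>^2 + 1 / \<delta>^3) * norm (?A x)" for c x
  proof -
    have "c * exp (- (\<delta> * norm (?A x))) \<le> (1 / \<delta> + 1 / \<delta>^2 + 1 / \<delta>^3) * (norm (?A x) * exp (- (\<delta> * norm (?A x))))"
      using that by (simp add: mult.assoc[symmetric] mult_right_mono)
    also have "\<dots> \<le> (1 / \<delta> + 1 / \<delta>^2 + 1 / \<delta>^3) * (K / (1 + x^2))"
      using \<delta> by (intro mult_left_mono key) auto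
    finally show ?thesis by (simp add: C_def)
  qed
  show ?thesis
  proof (rule that)
    show "C \<ge> 0" using \<delta> K by (simp add: C_def)
    fix t x assume t: "\<bar>t\<bar> \<le> M"
    have nB: "1 / norm (?B t) ^ n \<le> 1 / \<delta> ^ n" for n
      using Bge[OF t] \<delta> by (intro frac_le power_mono) auto
    have "norm (sol d (of_real t) (of_real x)) = 1 / norm (?B t) * norm (exp (- 2 * ?A x * ?B t))"
      by (simp add: sol_def norm_divide)
    also have "\<dots> \<le> 1 / norm (?B t) * exp (- (\<delta> * norm (?A x)))"
      by (intro mult_left_mono ex t) simp
    also have "\<dots> \<le> C / (1 + x^2)"
    proof (rule main)
      have "1 / norm (?B t) \<le> (1 / \<delta>) * 1" using nB[of 1] by simp
      also have "\<dots> \<le> (1 / \<delta> + 1 / \<delta>^2 + 1 / \<delta>^3) * norm (?A x)"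
        using \<delta> A1 by (intro mult_mono) auto
      finally show "1 / norm (?B t) \<le> (1 / \<delta> + 1 / \<delta>^2 + 1 / \<delta>^3) * norm (?A x)" .
    qed simp
    finally show "norm (sol d (of_real t) (of_real x)) \<le> C / (1 + x^2)" .
    let ?c = "norm (\<i> / (2 * ?B t ^ 3) + \<i> * ?A x / ?B t ^ 2)"
    have "norm (sol' d (of_real t) (of_real x)) = ?c * norm (exp (- 2 * ?A x * ?B t))"
      by (simp add: sol'_def norm_mult)
    also have "\<dots> \<le> ?c * exp (- (\<delta> * norm (?A x)))"
      by (intro mult_left_mono ex t) simp
    also have "\<dots> \<le> C / (1 + x^2)"
    proof (rule main)
      have "?c \<le> norm (\<i> / (2 * ?B t ^ 3)) + norm (\<i> * ?A x / ?B t ^ 2)" by (rule norm_triangle_ineq)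
      also have "\<dots> = 1/2 * (1 / norm (?B t) ^ 3) + norm (?A x) * (1 / norm (?B t) ^ 2)"
        by (simp add: norm_divide norm_mult norm_power)
      also have "\<dots> \<le> 1 * (1 / \<delta> ^ 3) + norm (?A x) * (1 / \<delta> ^ 2)"
        using \<delta> by (intro add_mono mult_mono nB) auto
      also have "\<dots> \<le> norm (?A x) * (1 / \<delta> ^ 3) + norm (?A x) * (1 / \<delta> ^ 2)"
        using \<delta> A1[of x] by (intro add_right_mono mult_right_mono) auto
      also have "\<dots> = (1 / \<delta>^2 + 1 / \<delta>^3) * norm (?A x)" by (simp add: algebra_simps)
      also have "\<dots> \<le> (1 / \<delta> + 1 / \<delta>^2 + 1 / \<delta>^3) * norm (?A x)"
        using \<delta> by (intro mult_right_mono) auto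
      finally show "?c \<le> (1 / \<delta> + 1 / \<delta>^2 + 1 / \<delta>^3) * norm (?A x)" .
    qed simp
    finally show "norm (sol' d (of_real t) (of_real x)) \<le> C / (1 + x^2)" .
  qed
qed

section \<open>The explicit solution as a differentiable curve\<close>

lemma integrable_inverse_one_plus_square: "integrable lborel (\<lambda>x::real. 1 / (1 + x^2))"
proof -
  have "einterval (-\<infinity>) \<infinity> = UNIV" by (auto simp: einterval_def)
  then have "set_integrable lborel UNIV (\<lambda>x::real. inverse (1 + x^2))"
    using integrable_inverse_1_plus_square by simp
  then show ?thesis by (simp add: set_integrable_def inverse_eq_divide)
qed

lemma integrable_powr_of_decay:
  assumes p: "1 \<le> p" and [measurable]: "f \<in> borel_measurable borel"
    and le: "\<And>x. norm (f x) \<le> C / (1 + x^2)"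
  shows "integrable lborel (\<lambda>x. norm (f x :: complex) powr p)"
proof (rule Bochner_Integration.integrable_bound)
  show "integrable lborel (\<lambda>x::real. \<bar>C\<bar> powr p * (1 / (1 + x^2)))"
    by (intro integrable_mult_right integrable_inverse_one_plus_square)
  show "AE x in lborel. norm (norm (f x) powr p) \<le> norm (\<bar>C\<bar> powr p * (1 / (1 + x^2)))"
  proof (rule AE_I2)
    fix x :: real
    have pos: "0 < 1 + x^2" by (simp add: add_pos_nonneg)
    have "norm (f x) \<le> \<bar>C\<bar> * (1 / (1 + x^2))"
      using le[of x] pos by (simp add: order_trans[OF _ divide_right_mono[OF abs_ge_self]])
    then have "norm (f x) powr p \<le> (\<bar>C\<bar> * (1 / (1 + x^2))) powr p"
      using p by (intro powr_mono2) auto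
    also have "\<dots> = \<bar>C\<bar> powr p * (1 / (1 + x^2)) powr p"
      by (rule powr_mult)
    also have "\<dots> \<le> \<bar>C\<bar> powr p * (1 / (1 + x^2)) powr 1"
      using p pos by (intro mult_left_mono powr_mono') auto
    finally show "norm (norm (f x) powr p) \<le> norm (\<bar>C\<bar> powr p * (1 / (1 + x^2)))"
      using pos by simp
  qed
qed measurable

lemma Lp_norm_tendsto_0_dominated:
  fixes f :: "real \<Rightarrow> real \<Rightarrow> complex"
  assumes p: "1 \<le> p" and [measurable]: "\<And>h. f h \<in> borel_measurable borel"
    and lim: "\<And>x. ((\<lambda>h. f h x) \<longlongrightarrow> 0) (at 0)"
    and le: "\<And>h x. h \<noteq> 0 \<Longrightarrow> \<bar>h\<bar> \<le> 1 \<Longrightarrow> norm (f h x) \<le> C / (1 + x^2)"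
  shows "((\<lambda>h. Lp_norm p (abs_L0 (f h))) \<longlongrightarrow> 0) (at 0)"
  unfolding tendsto_at_iff_sequentially
proof (intro allI impI)
  fix X :: "nat \<Rightarrow> real" assume X: "\<forall>i. X i \<in> UNIV - {0}" "X \<longlonglongrightarrow> 0"
  have p0: "p > 0" using p by simp
  have "\<forall>\<^sub>F i in sequentially. norm (X i) < 1"
    using order_tendstoD(2)[OF tendsto_norm[OF X(2)], of 1] by simp
  then obtain N where N: "\<And>i. i \<ge> N \<Longrightarrow> \<bar>X i\<bar> < 1" by (auto simp: eventually_sequentially)
  \<comment> \<open>The dominating bound holds for \<open>\<bar>h\<bar> \<le> 1\<close> only, so an
    initial segment of the sequence is dropped.\<close>
  define Y where "Y i = X (i + N)" for i
  have Y: "Y i \<noteq> 0" "\<bar>Y i\<bar> \<le> 1" for i using X(1) N[of "i + N"] by (auto simp: Y_def)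
  have limY: "Y \<longlonglongrightarrow> 0" unfolding Y_def by (rule LIMSEQ_ignore_initial_segment[OF X(2)])
  have "(\<lambda>i. LINT x|lborel. norm (f (Y i) x) powr p) \<longlonglongrightarrow> (LINT x::real|lborel. (0::real))"
  proof (rule integral_dominated_convergence[where s = "\<lambda>i x. norm (f (Y i) x) powr p" and M = lborel and f = "\<lambda>_. 0"
        and w = "\<lambda>x. norm (complex_of_real (C / (1 + x^2))) powr p"])
    show "integrable lborel (\<lambda>x::real. norm (complex_of_real (C / (1 + x^2))) powr p)"
    proof (rule integrable_powr_of_decay[OF p])
      show "norm (complex_of_real (C / (1 + x^2))) \<le> \<bar>C\<bar> / (1 + x^2)" for x :: real
        unfolding norm_of_real by (simp add: abs_divide)
    qed measurable
    show "AE x in lborel. (\<lambda>i. norm (f (Y i) x) powr p) \<longlonglongrightarrow> 0"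
    proof (rule AE_I2)
      fix x
      have "(\<lambda>i. f (Y i) x) \<longlonglongrightarrow> 0"
        using lim[of x] Y limY unfolding tendsto_at_iff_sequentially by (auto simp: o_def)
      then have "(\<lambda>i. norm (f (Y i) x) powr p) \<longlonglongrightarrow> norm (0::complex) powr p"
        using p0 by (intro tendsto_powr' tendsto_norm tendsto_const) auto
      then show "(\<lambda>i. norm (f (Y i) x) powr p) \<longlonglongrightarrow> 0" using p0 by simp
    qed
    show "AE x in lborel. norm (norm (f (Y i) x) powr p) \<le> norm (complex_of_real (C / (1 + x^2))) powr p" for i
    proof (rule AE_I2)
      fix x :: real
      have "norm (f (Y i) x) \<le> norm (complex_of_real (C / (1 + x^2)))"
        unfolding norm_of_real using le[OF Y, of i x] by linarith
      then show "norm (norm (f (Y i) x) powr p) \<le> norm (complex_of_real (C / (1 + x^2))) powr p"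
        using p0 by (simp add: powr_mono2)
    qed
  qed measurable
  then have "(\<lambda>i. (LINT x|lborel. norm (f (Y i) x) powr p) powr (1 / p)) \<longlonglongrightarrow> 0 powr (1 / p)"
    using p0 by (intro tendsto_powr') (auto intro: integral_nonneg_AE)
  then have "(\<lambda>i. Lp_norm p (abs_L0 (f (Y i)))) \<longlonglongrightarrow> 0"
    using p0 by (simp add: Lp_norm_abs)
  then have "(\<lambda>i. Lp_norm p (abs_L0 (f (X (i + N))))) \<longlonglongrightarrow> 0" by (simp add: Y_def)
  then show "((\<lambda>h. Lp_norm p (abs_L0 (f h))) \<circ> X) \<longlonglongrightarrow> 0"
    unfolding o_def by (rule LIMSEQ_offset)
qed

definition sol_L0 :: "real \<Rightarrow> real \<Rightarrow> L0" where
  "sol_L0 d t = abs_L0 (\<lambda>x. sol d (of_real t) (of_real x))"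

definition sol'_L0 :: "real \<Rightarrow> real \<Rightarrow> L0" where
  "sol'_L0 d t = abs_L0 (\<lambda>x. sol' d (of_real t) (of_real x))"

lemma sol_L0_in_Lp:
  assumes d: "d > 0" and p: "1 \<le> p"
  shows "sol_L0 d t \<in> Lp p" "sol'_L0 d t \<in> Lp p"
proof -
  obtain C where C: "\<And>x. norm (sol d (of_real t) (of_real x)) \<le> C / (1 + x^2)"
    "\<And>x. norm (sol' d (of_real t) (of_real x)) \<le> C / (1 + x^2)"
    using sol_bound[OF d, of "\<bar>t\<bar>"] by (metis order_refl)
  then show "sol_L0 d t \<in> Lp p" "sol'_L0 d t \<in> Lp p"
    using integrable_powr_of_decay[OF p sol_measurable(1)[OF d], of t C] integrable_powr_of_decay[OF p sol_measurable(2)[OF d], of t C]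
    by (auto simp: sol_L0_def sol'_L0_def abs_in_Lp sol_measurable d)
qed

lemma sol_L0_neg_ddx:
  assumes d: "d > 0" and p: "1 \<le> p"
  shows "(sol'_L0 d t, sol_L0 d t) \<in> neg_ddx p"
proof -
  have w: "weak_derivative (sol'_L0 d t) (- sol_L0 d t)"
    unfolding sol'_L0_def sol_L0_def abs_L0_uminus[OF sol_measurable(1)[OF d]]
    by (intro weak_derivative_of_C1 sol'_deriv_x continuous_on_minus sol_continuous d)
  have "- sol_L0 d t \<in> Lp p" using sol_L0_in_Lp[OF d p] by (simp add: Lp_uminus)
  then show ?thesis unfolding neg_ddx_def W1p_def using w sol_L0_in_Lp[OF d p, of t]
    by (intro CollectI exI[of _ "sol'_L0 d t"] exI[of _ "- sol_L0 d t"]) auto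
qed

text \<open>Pointwise differentiability becomes differentiability in norm by dominated convergence.
  The mean value inequality bounds the difference quotient by one \<open>C / (1 + x^2)\<close>, and
  the subtracted derivative costs another.\<close>

lemma sol_L0_differentiable:
  assumes d: "d > 0" and p: "1 \<le> p"
  shows "((\<lambda>h. Lp_norm p (scaleC (of_real (1 / h)) (sol_L0 d (s + h) - sol_L0 d s) - sol'_L0 d s)) \<longlongrightarrow> 0) (at 0)"
proof -
  let ?u = "\<lambda>t x. sol d (of_real t) (of_real x)" and ?v = "\<lambda>t x. sol' d (of_real t) (of_real x)"
  obtain C where C: "\<And>t x. \<bar>t\<bar> \<le> \<bar>s\<bar> + 1 \<Longrightarrow> norm (?v t x) \<le> C / (1 + x^2)"
    using sol_bound[OF d, of "\<bar>s\<bar> + 1"] by metis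
  note [measurable] = sol_measurable[OF d]
  let ?f = "\<lambda>h x. of_real (1 / h) * (?u (s + h) x - ?u s x) - ?v s x"
  have eq: "scaleC (of_real (1 / h)) (sol_L0 d (s + h) - sol_L0 d s) - sol'_L0 d s = abs_L0 (?f h)" for h
  proof -
    have "(\<lambda>x. ?u (s + h) x - ?u s x) \<in> borel_measurable borel"
      "(\<lambda>x. of_real (1 / h) * (?u (s + h) x - ?u s x)) \<in> borel_measurable borel" by measurable
    note m = this sol_measurable[OF d]
    show ?thesis unfolding sol_L0_def sol'_L0_def by (simp only: abs_L0_arith m)
  qed
  show ?thesis unfolding eq
  proof (rule Lp_norm_tendsto_0_dominated[OF p, where C = "2 * C"])
    fix x
    have "((\<lambda>h. (sol d (of_real s + h) (of_real x) - ?u s x) / h) \<longlongrightarrow> ?v s x) (at 0)"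
      using sol_field_deriv_t[OF d, of "of_real x" s] by (simp add: DERIV_def)
    moreover have "filterlim complex_of_real (at 0) (at 0)"
      by (auto simp: filterlim_at eventually_at_filter intro!: tendsto_eq_intros)
    ultimately have "((\<lambda>h. (sol d (of_real s + of_real h) (of_real x) - ?u s x) / of_real h) \<longlongrightarrow> ?v s x) (at 0)"
      by (rule filterlim_compose)
    then show "((\<lambda>h. ?f h x) \<longlongrightarrow> 0) (at 0)"
      by (intro LIM_zero) (simp add: field_simps)
  next
    fix h x :: real assume h: "h \<noteq> 0" "\<bar>h\<bar> \<le> 1"
    have "norm (?u (s + h) x - ?u s x) \<le> (C / (1 + x^2)) * norm ((s + h) - s)"
    proof (rule differentiable_bound)
      show "convex {s - 1..s + 1}" by simp
      show "((\<lambda>t. ?u t x) has_derivative (\<lambda>r. r *\<^sub>R ?v t x)) (at t within {s - 1..s + 1})" for t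
        using has_vector_derivative_at_within[OF sol_deriv_t[OF d, of "of_real x" t]] by (simp add: has_vector_derivative_def)
      show "onorm (\<lambda>r. r *\<^sub>R ?v t x) \<le> C / (1 + x^2)" if "t \<in> {s - 1..s + 1}" for t
      proof (rule onorm_le)
        fix r :: real
        have "norm (?v t x) \<le> C / (1 + x^2)" using C[of t x] that by auto
        then show "norm (r *\<^sub>R ?v t x) \<le> C / (1 + x^2) * norm r"
          using mult_left_mono[of "norm (?v t x)" "C / (1 + x^2)" "norm r"] by (simp add: mult.commute)
      qed
    qed (use h in auto)
    then have "norm (of_real (1 / h) * (?u (s + h) x - ?u s x)) \<le> C / (1 + x^2)"
      using h by (simp add: norm_mult norm_divide pos_divide_le_eq)
    moreover have "norm (?v s x) \<le> C / (1 + x^2)" using C[of s x] by simp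
    ultimately show "norm (?f h x) \<le> 2 * C / (1 + x^2)"
      using norm_triangle_ineq4[of "of_real (1 / h) * (?u (s + h) x - ?u s x)" "?v s x"] by simp
  qed measurable
qed

text \<open>Half-angle formulas: the substitution \<open>x = sinh y\<close> is chosen because it
  makes the square root explicit.\<close>

lemma csqrt_one_minus_i_sinh: "csqrt (1 - \<i> * of_real (sinh y)) = Complex (cosh (y / 2)) (- sinh (y / 2))"
proof (rule csqrt_unique)
  have "cosh (y / 2) ^ 2 - sinh (y / 2) ^ 2 = 1" using cosh_square_eq[of "y / 2"] by simp
  moreover have "2 * sinh (y / 2) * cosh (y / 2) = sinh y" using sinh_double[of "y / 2"] by simp
  ultimately show "(Complex (cosh (y / 2)) (- sinh (y / 2)))\<^sup>2 = 1 - \<i> * of_real (sinh y)"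
    by (simp add: complex_eq_iff power2_eq_square algebra_simps)
qed auto

text \<open>By the addition theorem the real part of the product of the two roots is
  \<open>sqrt d * cosh ((y - s) / 2)\<close>: in the exponent, advancing in time is a translation of
  \<open>y\<close>.\<close>

lemma norm_sol:
  assumes d: "d > 0"
  shows "norm (sol d (of_real (d * sinh s)) (of_real (sinh y)))
    = exp (- 2 * sqrt d * cosh ((y - s) / 2)) / sqrt (d * cosh s)"
proof -
  have b: "csqrt (of_real d - \<i> * of_real (d * sinh s)) = sqrt d * Complex (cosh (s / 2)) (- sinh (s / 2))"
  proof -
    have "of_real d - \<i> * of_real (d * sinh s) = of_real d * (1 - \<i> * of_real (sinh s))"
      by (simp add: algebra_simps)
    also have "csqrt \<dots> = sqrt d * csqrt (1 - \<i> * of_real (sinh s))"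
    proof (rule csqrt_unique)
      have "0 < Re (csqrt (1 - \<i> * of_real (sinh s)))" by (rule le_less_trans[OF abs_ge_zero Re_csqrt_gt]) simp
      then have "0 < Re (sqrt d * csqrt (1 - \<i> * of_real (sinh s)))" using d by simp
      then show "0 < Re (sqrt d * csqrt (1 - \<i> * of_real (sinh s))) \<or>
        Re (sqrt d * csqrt (1 - \<i> * of_real (sinh s))) = 0 \<and> 0 \<le> Im (sqrt d * csqrt (1 - \<i> * of_real (sinh s)))" by blast
      show "(sqrt d * csqrt (1 - \<i> * of_real (sinh s)))\<^sup>2 = of_real d * (1 - \<i> * of_real (sinh s))"
        using d by (simp add: power_mult_distrib flip: of_real_power)
    qed
    finally show ?thesis by (simp add: csqrt_one_minus_i_sinh)
  qed
  have n: "norm (csqrt (of_real d - \<i> * of_real (d * sinh s))) = sqrt (d * cosh s)"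
  proof -
    have "norm (of_real d - \<i> * of_real (d * sinh s)) = sqrt ((d * cosh s)^2)"
      unfolding cmod_def by (intro arg_cong[of _ _ sqrt]) (simp add: power_mult_distrib cosh_square_eq algebra_simps)
    then have "norm (of_real d - \<i> * of_real (d * sinh s)) = d * cosh s" using d by simp
    then show ?thesis by simp
  qed
  have "Re (csqrt (1 - \<i> * of_real (sinh y)) * csqrt (of_real d - \<i> * of_real (d * sinh s)))
      = sqrt d * cosh (y / 2 - s / 2)"
    unfolding b csqrt_one_minus_i_sinh cosh_diff by (simp add: algebra_simps)
  moreover have "Re (- 2 * a * b) = - 2 * Re (a * b)" for a b :: complex by simp
  ultimately show ?thesis
    unfolding sol_def norm_divide n norm_exp_eq_Re diff_divide_distrib by (simp only: mult.assoc)
qed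

lemma lborel_integral_sinh_substitution:
  assumes "integrable lborel f"
  shows "integrable lborel (\<lambda>y. cosh y * f (sinh y))"
    "(LINT y|lborel. cosh y * f (sinh y)) = (LINT x|lborel. f x :: real)"
proof -
  have [measurable]: "f \<in> borel_measurable borel" using assms by simp
  have [measurable]: "sinh \<in> borel_measurable (borel :: real measure)" "cosh \<in> borel_measurable (borel :: real measure)"
    by (intro borel_measurable_continuous_onI continuous_intros)+
  have surj: "sinh ` UNIV = (UNIV :: real set)" using sinh_arsinh_real by (metis surjI)
  have "f absolutely_integrable_on sinh ` UNIV \<and> integral (sinh ` UNIV) f = (LINT x|lborel. f x)"
    using assms unfolding surj by (simp add: integrable_completion set_integrable_def integral_lborel)
  then have "(\<lambda>y. \<bar>cosh y\<bar> * f (sinh y)) absolutely_integrable_on UNIV \<and>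
      integral UNIV (\<lambda>y. \<bar>cosh y\<bar> * f (sinh y)) = (LINT x|lborel. f x)"
    by (subst has_absolute_integral_change_of_variables_1') (auto intro!: derivative_eq_intros simp: inj_on_def)
  then have *: "(\<lambda>y. cosh y * f (sinh y)) absolutely_integrable_on UNIV"
      "integral UNIV (\<lambda>y. cosh y * f (sinh y)) = (LINT x|lborel. f x)"
    by simp_all
  then show i: "integrable lborel (\<lambda>y. cosh y * f (sinh y))"
    by (subst integrable_completion[symmetric]) (simp_all add: set_integrable_def)
  then show "(LINT y|lborel. cosh y * f (sinh y)) = (LINT x|lborel. f x)"
    using * by (simp add: integral_lborel)
qed

text \<open>After translating by \<open>s\<close> only the weight still depends on it:
  \<open>cosh (s + y)\<close> splits into \<open>cosh s * cosh y\<close> and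
  \<open>sinh s * sinh y\<close>, and the second part integrates to 0 because \<open>E\<close> is
  even. What remains is \<open>cosh s\<close> times \<open>cosh s powr (- p / 2)\<close>.\<close>

lemma integral_norm_sol:
  assumes d: "d > 0" and p: "1 \<le> p"
  obtains C where "C > 0"
    "\<And>s. (LINT x|lborel. norm (sol d (of_real (d * sinh s)) (of_real x)) powr p) = C * cosh s powr (1 - p / 2)"
proof -
  define E where "E y = exp (- 2 * p * sqrt d * cosh (y / 2))" for y
  have int: "integrable lborel (\<lambda>x. norm (sol d (of_real t) (of_real x)) powr p)" for t
    using sol_L0_in_Lp(1)[OF d p, of t] by (simp add: sol_L0_def abs_in_Lp sol_measurable d)
  have E: "norm (sol d (of_real (d * sinh s)) (of_real (sinh y))) powr p = (d * cosh s) powr (- p / 2) * E (y - s)" for s y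
  proof -
    have "sqrt (d * cosh s) powr p = (d * cosh s) powr (p / 2)"
      using d by (simp add: powr_half_sqrt[symmetric] powr_powr)
    then show ?thesis
      unfolding norm_sol[OF d] using d
      by (simp add: E_def powr_divide powr_minus_divide exp_powr_real mult_ac)
  qed
  have int0: "integrable lborel (\<lambda>y. cosh y * E y)"
  proof -
    have "integrable lborel (\<lambda>y. d powr (- p / 2) * (cosh y * E y))"
      using lborel_integral_sinh_substitution(1)[OF int[of "d * sinh 0"]] unfolding E
      by (simp add: mult.left_commute)
    then show ?thesis using d by (simp add: integrable_mult_right_iff)
  qed
  have E_eq: "E = (\<lambda>y. exp (- 2 * p * sqrt d * cosh (y / 2)))" by (simp add: E_def fun_eq_iff)
  have [measurable]: "E \<in> borel_measurable borel"
    unfolding E_eq by (auto intro!: borel_measurable_continuous_onI continuous_intros)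
  have int1: "integrable lborel (\<lambda>y. sinh y * E y)"
  proof (rule Bochner_Integration.integrable_bound[OF int0])
    have [measurable]: "sinh \<in> borel_measurable (borel :: real measure)"
      by (intro borel_measurable_continuous_onI continuous_intros)
    show "(\<lambda>y. sinh y * E y) \<in> borel_measurable lborel" by measurable
    show "AE y in lborel. norm (sinh y * E y) \<le> norm (cosh y * E y)"
      by (intro AE_I2) (simp add: abs_mult mult_right_mono sinh_le_cosh_real abs_le_iff E_def
          sinh_le_cosh_real[of "- _", simplified])
  qed
  have odd: "(LINT y|lborel. sinh y * E y) = 0"
    using lborel_integral_real_affine[of "-1" "\<lambda>y. sinh y * E y" 0] by (simp add: E_def)
  have "(LINT y|lborel. cosh y * E y) \<noteq> 0"
  proof
    assume "(LINT y|lborel. cosh y * E y) = 0"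
    then have "AE y in lborel. cosh y * E y = 0"
      using integral_nonneg_eq_0_iff_AE[OF int0] by (simp add: E_def)
    then have "AE y in (lborel :: real measure). False" by (simp add: E_def)
    then show False by (simp add: AE_iff_null null_sets_def emeasure_lborel_UNIV)
  qed
  moreover have "0 \<le> (LINT y|lborel. cosh y * E y)" by (simp add: E_def)
  ultimately have pos: "0 < (LINT y|lborel. cosh y * E y)" by simp
  show ?thesis
  proof (rule that)
    show "0 < d powr (- p / 2) * (LINT y|lborel. cosh y * E y)" using pos d by simp
    fix s
    have "(LINT x|lborel. norm (sol d (of_real (d * sinh s)) (of_real x)) powr p)
      = (LINT y|lborel. cosh y * ((d * cosh s) powr (- p / 2) * E (y - s)))"
      by (subst lborel_integral_sinh_substitution(2)[OF int, symmetric]) (simp only: E)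
    also have "\<dots> = (LINT y|lborel. cosh (s + y) * ((d * cosh s) powr (- p / 2) * E y))"
      using lborel_integral_real_affine[of 1 "\<lambda>y. cosh y * ((d * cosh s) powr (- p / 2) * E (y - s))" s] by simp
    also have "\<dots> = (LINT y|lborel. (d * cosh s) powr (- p / 2) * (cosh s * (cosh y * E y) + sinh s * (sinh y * E y)))"
      by (intro Bochner_Integration.integral_cong refl) (simp add: cosh_add algebra_simps)
    also have "\<dots> = (d * cosh s) powr (- p / 2) * (cosh s * (LINT y|lborel. cosh y * E y))"
      using int0 int1 odd by simp
    also have "(d * cosh s) powr (- p / 2) = d powr (- p / 2) * cosh s powr (- p / 2)"
      using d by (simp add: powr_mult)
    also have "\<dots> * (cosh s * (LINT y|lborel. cosh y * E y))
      = d powr (- p / 2) * (LINT y|lborel. cosh y * E y) * (cosh s powr 1 * cosh s powr (- p / 2))" by simp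
    also have "cosh s powr 1 * cosh s powr (- p / 2) = cosh s powr (1 - p / 2)"
      by (simp only: powr_add[symmetric]) simp
    finally show "(LINT x|lborel. norm (sol d (of_real (d * sinh s)) (of_real x)) powr p)
      = d powr (- p / 2) * (LINT y|lborel. cosh y * E y) * cosh s powr (1 - p / 2)" .
  qed
qed

lemma Lp_norm_sol_L0:
  assumes d: "d > 0" and p: "1 \<le> p"
  obtains C where "C > 0" "\<And>s. Lp_norm p (sol_L0 d (d * sinh s)) powr p = C * cosh s powr (1 - p / 2)"
proof -
  obtain C where "C > 0"
    "\<And>s. (LINT x|lborel. norm (sol d (of_real (d * sinh s)) (of_real x)) powr p) = C * cosh s powr (1 - p / 2)"
    using integral_norm_sol[OF assms] by metis
  moreover have "Lp_norm p (sol_L0 d t) powr p = (LINT x|lborel. norm (sol d (of_real t) (of_real x)) powr p)" for t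
    using p by (simp add: sol_L0_def integral_powr_norm sol_measurable d)
  ultimately show ?thesis using that by metis
qed

lemma sol_L0_orbit:
  assumes T: "C0_semigroup p T" "generator p T = (neg_ddx p)\<inverse>" and d: "d > 0" and p: "1 \<le> p"
  shows "T 1 (sol_L0 d r) = sol_L0 d (r + 1)"
proof -
  have "T 1 (sol_L0 d (r + 0)) = sol_L0 d (r + 1)"
  proof (rule orbit_unique[OF p T(1), where u = "\<lambda>s. sol_L0 d (r + s)" and v = "\<lambda>s. sol'_L0 d (r + s)"])
    show "(sol_L0 d (r + s), sol'_L0 d (r + s)) \<in> generator p T" for s
      using sol_L0_neg_ddx[OF d p] by (simp add: T(2))
    show "((\<lambda>h. Lp_norm p (scaleC (of_real (1 / h)) (sol_L0 d (r + (s + h)) - sol_L0 d (r + s)) - sol'_L0 d (r + s))) \<longlongrightarrow> 0) (at 0)" for s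
      using sol_L0_differentiable[OF d p, of "r + s"] by (simp only: add.assoc)
  qed (auto simp: sol_L0_in_Lp d p)
  then show ?thesis by simp
qed

section \<open>Nonexistence of the semigroup for \<open>p \<noteq> 2\<close>\<close>

lemma cosh_powr_unbounded:
  assumes "(e :: real) > 0" obtains s :: real where "s > 0" "cosh s powr e > K"
proof -
  have "filterlim (\<lambda>s::real. cosh s powr e) at_top at_top"
    using assms by (intro filterlim_compose[OF _ cosh_real_at_top] real_powr_at_top)
  then have "\<forall>\<^sub>F s in at_top. K < cosh s powr e" by (simp add: filterlim_at_top_dense)
  then have "\<forall>\<^sub>F s::real in at_top. K < cosh s powr e \<and> s > 0"
    using eventually_gt_at_top[of 0] by eventually_elim simp
  then show ?thesis using that by (metis (mono_tags, lifting) eventually_happens trivial_limit_at_top_linorder)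
qed

theorem not_generates:
  assumes p: "1 \<le> p" "p \<noteq> 2"
  shows "\<not> generates_C0_semigroup p ((neg_ddx p)\<inverse>)"
proof
  assume "generates_C0_semigroup p ((neg_ddx p)\<inverse>)"
  then obtain T where T: "C0_semigroup p T" "generator p T = (neg_ddx p)\<inverse>"
    by (auto simp: generates_C0_semigroup_def)
  have p0: "p > 0" using p by simp
  obtain K0 where K0: "\<And>f. f \<in> Lp p \<Longrightarrow> Lp_norm p (T 1 f) \<le> K0 * Lp_norm p f"
    using T(1) unfolding C0_semigroup_def bounded_operator_def by (metis zero_le_one)
  define K where "K = max K0 0"
  have K: "Lp_norm p (T 1 f) powr p \<le> K powr p * Lp_norm p f powr p" if "f \<in> Lp p" for f
  proof -
    have "Lp_norm p (T 1 f) \<le> K * Lp_norm p f"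
      using K0[OF that] mult_right_mono[of K0 K "Lp_norm p f"] by (simp add: K_def)
    then have "Lp_norm p (T 1 f) powr p \<le> (K * Lp_norm p f) powr p"
      using p0 by (intro powr_mono2) auto
    then show ?thesis by (simp add: powr_mult K_def)
  qed
  show False
  proof (cases "p < 2")
    case True
    then obtain s where s: "s > 0" "cosh s powr (1 - p / 2) > K powr p"
      using cosh_powr_unbounded[of "1 - p / 2" "K powr p"] by auto
    \<comment> \<open>Time 1 thereby corresponds to the parameter \<open>s\<close>. The bound
      \<open>K\<close> concerns \<open>T 1\<close> only, so \<open>s\<close> could be chosen before
      \<open>d\<close>.\<close>
    define d where "d = 1 / sinh s"
    have d: "d > 0" "d * sinh s = 1" using s by (auto simp: d_def)
    obtain C where C: "C > 0" "\<And>s. Lp_norm p (sol_L0 d (d * sinh s)) powr p = C * cosh s powr (1 - p / 2)"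
      by (rule Lp_norm_sol_L0[OF d(1) p(1)]) blast
    have "Lp_norm p (sol_L0 d 1) powr p \<le> K powr p * Lp_norm p (sol_L0 d 0) powr p"
      using K[OF sol_L0_in_Lp(1)[OF d(1) p(1)], of 0] sol_L0_orbit[OF T d(1) p(1), of 0] by simp
    then have "C * cosh s powr (1 - p / 2) \<le> K powr p * C"
      using C(2)[of s] C(2)[of 0] d(2) by simp
    then show False using s C(1) by (simp add: mult.commute)
  next
    \<comment> \<open>Here the norm is largest at time 0, so the growth is found on the way from
      time -1 to time 0.\<close>
    case False
    then obtain s where s: "s > 0" "cosh s powr (p / 2 - 1) > K powr p"
      using cosh_powr_unbounded[of "p / 2 - 1" "K powr p"] p by auto
    define d where "d = 1 / sinh s"
    have d: "d > 0" "d * sinh (- s) = - 1" using s by (auto simp: d_def)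
    obtain C where C: "C > 0" "\<And>s. Lp_norm p (sol_L0 d (d * sinh s)) powr p = C * cosh s powr (1 - p / 2)"
      by (rule Lp_norm_sol_L0[OF d(1) p(1)]) blast
    have "Lp_norm p (sol_L0 d 0) powr p \<le> K powr p * Lp_norm p (sol_L0 d (- 1)) powr p"
      using K[OF sol_L0_in_Lp(1)[OF d(1) p(1)], of "-1"] sol_L0_orbit[OF T d(1) p(1), of "-1"] by simp
    then have "C \<le> K powr p * (C * cosh s powr (1 - p / 2))"
      using C(2)[of "- s"] C(2)[of 0] d(2) by simp
    then have "1 \<le> K powr p * cosh s powr (1 - p / 2)" using C(1) by (simp add: mult.left_commute)
    also have "cosh s powr (1 - p / 2) = 1 / cosh s powr (p / 2 - 1)"
      by (simp add: powr_minus_divide[symmetric])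
    finally show False using s by (simp add: field_simps)
  qed
qed

section \<open>Test functions and uniqueness for the resolvent equation\<close>

text \<open>The polynomial factor in \<open>1 / x\<close> makes the family of these functions, all
  flat at 0, closed under differentiation.\<close>

definition flat_exp :: "real poly \<Rightarrow> real \<Rightarrow> real" where
  "flat_exp q x = (if x > 0 then poly q (inverse x) * exp (- inverse x) else 0)"

lemma poly_exp_tendsto_0: "((\<lambda>u. poly q u * exp (- u)) \<longlongrightarrow> (0::real)) at_top"
proof -
  have "((\<lambda>u. \<Sum>i\<le>degree q. coeff q i * (u ^ i / exp u)) \<longlongrightarrow> (\<Sum>i\<le>degree q. coeff q i * 0)) at_top"
    by (intro tendsto_sum tendsto_mult tendsto_const tendsto_power_div_exp_0)
  moreover have "(\<Sum>i\<le>degree q. coeff q i * (u ^ i / exp u)) = poly q u * exp (- u)" for u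
    by (simp add: poly_altdef sum_distrib_right exp_minus divide_inverse mult.assoc)
  ultimately show ?thesis by simp
qed

text \<open>With \<open>u = 1 / x\<close> one has \<open>du/dx = - u^2\<close>, which turns the
  derivative of \<open>q(u) exp (- u)\<close> into \<open>u^2 (q - q')(u) exp (- u)\<close>. At 0
  the exponential beats the additional factor \<open>u\<close> of the difference quotient.\<close>

lemma flat_exp_deriv:
  "(flat_exp q has_real_derivative flat_exp (monom 1 2 * (q - pderiv q)) x) (at x)"
proof -
  consider "x > 0" | "x < 0" | "x = 0" by linarith
  then show ?thesis
  proof cases
    case 1
    have "((\<lambda>x. poly q (inverse x) * exp (- inverse x)) has_real_derivative flat_exp (monom 1 2 * (q - pderiv q)) x) (at x)"
      using 1 unfolding flat_exp_def
      by (auto intro!: derivative_eq_intros DERIV_chain2[OF poly_DERIV] simp: poly_monom power2_eq_square algebra_simps)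
    then show ?thesis
      by (rule has_field_derivative_transform_within_open[of _ _ _ "{0<..}"]) (use 1 in \<open>auto simp: flat_exp_def\<close>)
  next
    case 2
    have "((\<lambda>x. 0) has_real_derivative flat_exp (monom 1 2 * (q - pderiv q)) x) (at x)"
      using 2 by (simp add: flat_exp_def)
    then show ?thesis
      by (rule has_field_derivative_transform_within_open[of _ _ _ "{..<0}"]) (use 2 in \<open>auto simp: flat_exp_def\<close>)
  next
    case 3
    have "((\<lambda>x. flat_exp q x / x) \<longlongrightarrow> 0) (at 0)"
    proof (rule filterlim_split_at)
      have "\<forall>\<^sub>F x in at_left 0. flat_exp q x / x = (0::real)"
        by (auto simp: eventually_at_filter flat_exp_def intro!: always_eventually)
      then show "((\<lambda>x. flat_exp q x / x) \<longlongrightarrow> 0) (at_left 0)" by (rule tendsto_eventually)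
      have "((\<lambda>x. poly (pCons 0 q) (inverse x) * exp (- inverse x)) \<longlongrightarrow> 0) (at_right 0)"
        by (rule filterlim_compose[OF poly_exp_tendsto_0 filterlim_inverse_at_top_right])
      moreover have "\<forall>\<^sub>F x in at_right 0. poly (pCons 0 q) (inverse x) * exp (- inverse x) = flat_exp q x / x"
        by (auto simp: eventually_at_filter flat_exp_def divide_inverse intro!: always_eventually)
      ultimately show "((\<lambda>x. flat_exp q x / x) \<longlongrightarrow> 0) (at_right 0)" by (rule Lim_transform_eventually)
    qed
    then show ?thesis using 3 by (simp add: has_field_derivative_iff flat_exp_def)
  qed
qed

text \<open>A class of functions closed under differentiation, which makes all its members smooth.\<close>

inductive smooth_alg :: "(real \<Rightarrow> real) \<Rightarrow> bool" where
  const: "smooth_alg (\<lambda>x. c)"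
| flat: "smooth_alg (flat_exp q)"
| exp: "smooth_alg (\<lambda>x. exp (c * x))"
| affine: "smooth_alg f \<Longrightarrow> smooth_alg (\<lambda>x. f (a * x + b))"
| add: "smooth_alg f \<Longrightarrow> smooth_alg g \<Longrightarrow> smooth_alg (\<lambda>x. f x + g x)"
| mult: "smooth_alg f \<Longrightarrow> smooth_alg g \<Longrightarrow> smooth_alg (\<lambda>x. f x * g x)"
| antideriv: "smooth_alg f \<Longrightarrow> (\<And>x. (F has_real_derivative f x) (at x)) \<Longrightarrow> smooth_alg F"

lemma smooth_alg_deriv:
  assumes "smooth_alg f"
  shows "\<exists>f'. smooth_alg f' \<and> (\<forall>x. (f has_real_derivative f' x) (at x))"
  using assms
proof induction
  case (const c)
  show ?case by (intro exI[of _ "\<lambda>_. 0"]) (auto intro: smooth_alg.const)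
next
  case (flat q)
  show ?case using flat_exp_deriv smooth_alg.flat by blast
next
  case (exp c)
  have "smooth_alg (\<lambda>x. c * exp (c * x))" by (intro smooth_alg.mult smooth_alg.const smooth_alg.exp)
  moreover have "((\<lambda>x. exp (c * x)) has_real_derivative c * exp (c * x)) (at x)" for x
    by (auto intro!: derivative_eq_intros)
  ultimately show ?case by blast
next
  case (affine f a b)
  then obtain f' where f': "smooth_alg f'" "\<And>x. (f has_real_derivative f' x) (at x)" by blast
  have "smooth_alg (\<lambda>x. a * f' (a * x + b))" by (intro smooth_alg.mult smooth_alg.const smooth_alg.affine f')
  moreover have "((\<lambda>x. f (a * x + b)) has_real_derivative a * f' (a * x + b)) (at x)" for x
  proof -
    have "((\<lambda>x. a * x + b) has_real_derivative a) (at x)" by (auto intro!: derivative_eq_intros)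
    from DERIV_chain2[OF f'(2) this] show ?thesis by (simp add: mult.commute)
  qed
  ultimately show ?case by blast
next
  case (add f g)
  then obtain f' g' where fg: "smooth_alg f'" "\<And>x. (f has_real_derivative f' x) (at x)"
    "smooth_alg g'" "\<And>x. (g has_real_derivative g' x) (at x)" by blast
  then show ?case by (intro exI[of _ "\<lambda>x. f' x + g' x"]) (auto intro: smooth_alg.add DERIV_add)
next
  case (mult f g)
  then obtain f' g' where fg: "smooth_alg f'" "\<And>x. (f has_real_derivative f' x) (at x)"
    "smooth_alg g'" "\<And>x. (g has_real_derivative g' x) (at x)" by blast
  have "smooth_alg (\<lambda>x. f' x * g x + g' x * f x)" by (intro smooth_alg.add smooth_alg.mult fg mult)
  then show ?case using DERIV_mult[OF fg(2) fg(4)] by blast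
next
  case (antideriv f F)
  then show ?case by blast
qed

lemma smooth_alg_continuous: "smooth_alg f \<Longrightarrow> continuous_on UNIV f"
  using smooth_alg_deriv DERIV_continuous_on by (metis has_field_derivative_at_within)

lemma smooth_alg_antideriv:
  assumes "smooth_alg f" obtains F where "smooth_alg F" "\<And>x. (F has_real_derivative f x) (at x)"
proof -
  have "\<exists>F. \<forall>x::real. (-\<infinity>::ereal) < x \<longrightarrow> x < (\<infinity>::ereal) \<longrightarrow> (F has_vector_derivative f x) (at x)"
    using smooth_alg_continuous[OF assms] by (intro einterval_antiderivative) (auto simp: continuous_on_eq_continuous_at)
  then obtain F where "\<And>x. (F has_real_derivative f x) (at x)"
    by (auto simp: has_real_derivative_iff_has_vector_derivative)
  then show ?thesis using that smooth_alg.antideriv[OF assms] by blast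
qed

lemma smooth_alg_test_function:
  assumes f: "smooth_alg f" and supp: "\<And>x. f x \<noteq> 0 \<Longrightarrow> x \<in> {a..b}"
  shows "test_function f"
proof -
  have d: "smooth_alg (deriv g)" if g: "smooth_alg g" for g
  proof -
    obtain g' where "smooth_alg g'" "\<And>x. (g has_real_derivative g' x) (at x)" using smooth_alg_deriv[OF g] by blast
    moreover from this have "deriv g = g'" by (auto intro!: DERIV_imp_deriv)
    ultimately show ?thesis by simp
  qed
  have "smooth_alg ((deriv ^^ n) f)" for n by (induction n) (auto intro: d f)
  then have "(deriv ^^ n) f differentiable_on UNIV" for n
    using smooth_alg_deriv by (metis differentiable_at_withinI differentiable_on_def real_differentiable_def)
  moreover have "compact (closure {x. f x \<noteq> 0})"
  proof -
    have "bounded {x. f x \<noteq> 0}" by (rule bounded_subset[of "{a..b}"]) (use supp in auto)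
    then show ?thesis by (simp add: compact_closure)
  qed
  ultimately show ?thesis by (simp add: test_function_def)
qed

text \<open>The arguments have the literal form \<open>a * x + b\<close> of the rule
  \<open>affine\<close>; \<open>bump_eq\<close> gives the readable version. Growing \<open>n\<close>
  steepens both flanks, so that the bumps tend to the indicator of the open interval.\<close>

definition bump :: "real \<Rightarrow> real \<Rightarrow> nat \<Rightarrow> real \<Rightarrow> real" where
  "bump a b n x = flat_exp 1 (real n * x + (- (real n * a))) * flat_exp 1 ((- real n) * x + real n * b)"

lemma bump_smooth: "smooth_alg (bump a b n)"
  unfolding bump_def[abs_def] by (intro smooth_alg.mult smooth_alg.affine smooth_alg.flat)

lemma bump_eq: "bump a b n x = flat_exp 1 (real n * (x - a)) * flat_exp 1 (real n * (b - x))"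
  by (simp add: bump_def algebra_simps)

lemma bump_bounds: "0 \<le> bump a b n x" "bump a b n x \<le> 1" "bump a b n x \<noteq> 0 \<Longrightarrow> a < x \<and> x < b"
proof -
  have e: "0 \<le> flat_exp 1 y" "flat_exp 1 y \<le> 1" for y by (auto simp: flat_exp_def)
  show "0 \<le> bump a b n x" "bump a b n x \<le> 1" unfolding bump_eq by (auto intro: mult_nonneg_nonneg mult_le_one e)
  show "bump a b n x \<noteq> 0 \<Longrightarrow> a < x \<and> x < b"
    unfolding bump_eq by (auto simp: flat_exp_def zero_less_mult_iff split: if_splits)
qed

lemma bump_tendsto: "(\<lambda>n. bump a b n x) \<longlonglongrightarrow> indicator {a<..<b} x"
proof (cases "a < x \<and> x < b")
  case True
  have e: "(\<lambda>n. flat_exp 1 (real n * c)) \<longlonglongrightarrow> 1" if "c > 0" for c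
  proof -
    have "(\<lambda>n. exp (- (inverse (real n) * inverse c))) \<longlonglongrightarrow> exp (- (0 * inverse c))"
      by (intro tendsto_intros lim_inverse_n)
    moreover have "\<forall>\<^sub>F n in sequentially. exp (- (inverse (real n) * inverse c)) = flat_exp 1 (real n * c)"
      using eventually_gt_at_top[of 0] by eventually_elim (use that in \<open>simp add: flat_exp_def\<close>)
    ultimately show ?thesis using Lim_transform_eventually by fastforce
  qed
  have "(\<lambda>n. bump a b n x) \<longlonglongrightarrow> 1 * 1" unfolding bump_eq using True by (intro tendsto_mult e) auto
  then show ?thesis using True by simp
next
  case False
  then have "bump a b n x = 0" for n using bump_bounds(3)[of a b n x] by blast
  then show ?thesis using False by simp
qed

section \<open>Weak solutions of \<open>w' = - m w\<close> in \<open>L\<^sup>2\<close>\<close>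

lemma integrable_mult_of_square_integrable:
  fixes f g :: "'a \<Rightarrow> complex"
  assumes [measurable]: "f \<in> borel_measurable M" "g \<in> borel_measurable M"
    and "integrable M (\<lambda>x. (norm (f x))\<^sup>2)" "integrable M (\<lambda>x. (norm (g x))\<^sup>2)"
  shows "integrable M (\<lambda>x. f x * g x)"
proof (rule Bochner_Integration.integrable_bound)
  show "integrable M (\<lambda>x. (norm (f x))\<^sup>2 + (norm (g x))\<^sup>2)" using assms by simp
  have "norm (f x * g x) \<le> (norm (f x))\<^sup>2 + (norm (g x))\<^sup>2" for x
  proof -
    have "2 * (norm (f x) * norm (g x)) \<le> (norm (f x))\<^sup>2 + (norm (g x))\<^sup>2"
      using sum_squares_bound[of "norm (f x)" "norm (g x)"] by (simp add: mult.assoc)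
    moreover have "0 \<le> norm (f x) * norm (g x)" by simp
    ultimately show ?thesis unfolding norm_mult by linarith
  qed
  then show "AE x in M. norm (f x * g x) \<le> norm ((norm (f x))\<^sup>2 + (norm (g x))\<^sup>2)"
    by (intro AE_I2) (simp add: order_trans[OF _ abs_ge_self])
qed measurable

lemma integrable_L2_mult_compact_support:
  fixes w :: "real \<Rightarrow> complex"
  assumes [measurable]: "w \<in> borel_measurable borel" and w: "integrable lborel (\<lambda>x. (norm (w x))\<^sup>2)"
    and \<psi>: "continuous_on UNIV \<psi>" "\<And>x. \<psi> x \<noteq> 0 \<Longrightarrow> x \<in> {c..d}"
  shows "integrable lborel (\<lambda>x. w x * of_real (\<psi> x))"
proof (rule integrable_mult_of_square_integrable)
  have [measurable]: "\<psi> \<in> borel_measurable borel" using \<psi>(1) by (rule borel_measurable_continuous_onI)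
  show "(\<lambda>x. complex_of_real (\<psi> x)) \<in> borel_measurable lborel" by measurable
  show "integrable lborel (\<lambda>x. (norm (complex_of_real (\<psi> x)))\<^sup>2)"
  proof (rule integrable_compact_support)
    show "continuous_on UNIV (\<lambda>x. (norm (complex_of_real (\<psi> x)))\<^sup>2)" using \<psi> by (intro continuous_intros)
    show "(norm (complex_of_real (\<psi> x)))\<^sup>2 = 0" if "\<bar>c\<bar> + \<bar>d\<bar> < \<bar>x\<bar>" for x
    proof -
      have "x \<notin> {c..d}" using that by auto
      then show ?thesis using \<psi>(2)[of x] by auto
    qed
  qed
qed (use w in measurable)

text \<open>As \<open>ennreal\<close> sends negative numbers to 0, \<open>M 1\<close> and
  \<open>M (- 1)\<close> are the measures whose densities are the positive and the negative part of
  \<open>g\<close>. They agree on half-lines, hence everywhere, so the two parts coincide.\<close>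

lemma AE_zero_of_integral_greaterThan:
  fixes g :: "real \<Rightarrow> real"
  assumes g: "integrable lborel g" and z: "\<And>x. (LINT y|lborel. g y * indicator {x<..} y) = 0"
  shows "AE x in lborel. g x = 0"
proof -
  have [measurable]: "g \<in> borel_measurable borel" using g by simp
  define M where "M s = density lborel (\<lambda>x. ennreal (s * g x))" for s :: real
  have e: "emeasure (M s) {x<..} = ennreal (LINT y|lborel. max 0 (s * g y) * indicator {x<..} y)" for s x
  proof -
    have i: "integrable lborel (\<lambda>y. max 0 (s * g y) * indicator {x<..} y)"
      using g by (intro integrable_real_mult_indicator integrable_max integrable_mult_right) auto
    have "emeasure (M s) {x<..} = (\<integral>\<^sup>+y. ennreal (max 0 (s * g y) * indicator {x<..} y) \<partial>lborel)"
      unfolding M_def by (subst emeasure_density) (auto intro!: nn_integral_cong simp: indicator_def max_def ennreal_neg)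
    also have "\<dots> = ennreal (LINT y|lborel. max 0 (s * g y) * indicator {x<..} y)"
      by (intro nn_integral_eq_integral i) (auto simp: indicator_def)
    finally show ?thesis .
  qed
  have "M 1 = M (- 1)"
  proof (rule measure_eqI_lessThan)
    fix x :: real
    have i: "integrable lborel (\<lambda>y. max 0 (s * g y) * indicator {x<..} y)" for s
      using g by (intro integrable_real_mult_indicator integrable_max integrable_mult_right) auto
    have "(LINT y|lborel. max 0 (1 * g y) * indicator {x<..} y) - (LINT y|lborel. max 0 (- 1 * g y) * indicator {x<..} y)
        = (LINT y|lborel. max 0 (1 * g y) * indicator {x<..} y - max 0 (- 1 * g y) * indicator {x<..} y)"
      by (intro Bochner_Integration.integral_diff[symmetric] i)
    also have "\<dots> = (LINT y|lborel. g y * indicator {x<..} y)"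
      by (intro Bochner_Integration.integral_cong refl) (auto simp: max_def indicator_def)
    finally show "emeasure (M 1) {x<..} = emeasure (M (- 1)) {x<..}" using z[of x] by (simp add: e)
    show "emeasure (M 1) {x<..} < \<infinity>" by (simp add: e)
  qed (auto simp: M_def)
  then have "AE x in lborel. ennreal (1 * g x) = ennreal (- 1 * g x)"
    unfolding M_def by (intro sigma_finite_measure.density_unique[OF sigma_finite_lborel]) auto
  then show ?thesis
  proof eventually_elim
    case (elim x)
    then show ?case by (cases "g x \<ge> 0") (auto simp: ennreal_neg ennreal_eq_0_iff)
  qed
qed

lemma AE_zero_of_integral_intervals:
  fixes w :: "real \<Rightarrow> complex"
  assumes [measurable]: "w \<in> borel_measurable borel"
    and int: "\<And>a b. integrable lborel (\<lambda>x. w x * indicator {a<..<b} x)"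
    and z: "\<And>a b. (LINT x|lborel. w x * indicator {a<..<b} x) = 0"
  shows "AE x in lborel. w x = 0"
proof -
  have "AE x in lborel. w x * indicator {- real N<..<real N} x = 0" for N
  proof -
    let ?w = "\<lambda>x. w x * indicator {- real N<..<real N} x"
    have cut: "?w y * indicator {x<..} y = w y * indicator {max x (- real N)<..<real N} y" for x y
      by (auto simp: indicator_def)
    have part: "AE x in lborel. p (?w x) = 0" if p: "bounded_linear p" for p :: "complex \<Rightarrow> real"
    proof (rule AE_zero_of_integral_greaterThan)
      show "integrable lborel (\<lambda>x. p (?w x))" by (intro integrable_bounded_linear[OF p] int)
      fix x
      have "p (?w y) * indicator {x<..} y = p (?w y * indicator {x<..} y)" for y
        using linear_0[OF bounded_linear.linear[OF p]] by (auto simp: indicator_def)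
      then have "(LINT y|lborel. p (?w y) * indicator {x<..} y) = (LINT y|lborel. p (w y * indicator {max x (- real N)<..<real N} y))"
        by (simp only: cut)
      also have "\<dots> = p (LINT y|lborel. w y * indicator {max x (- real N)<..<real N} y)"
        by (intro integral_bounded_linear[OF p] int)
      finally show "(LINT y|lborel. p (?w y) * indicator {x<..} y) = 0"
        by (simp only: z linear_0[OF bounded_linear.linear[OF p]])
    qed
    from part[OF bounded_linear_Re] part[OF bounded_linear_Im]
    show ?thesis by eventually_elim (simp add: complex_eq_iff)
  qed
  then have "AE x in lborel. \<forall>N. w x * indicator {- real N<..<real N} x = 0" by (intro AE_all_countable[THEN iffD2] allI)
  then show ?thesis
  proof eventually_elim
    case (elim x)
    obtain N where "\<bar>x\<bar> < real N" using reals_Archimedean2 by blast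
    then show ?case using elim[rule_format, of N] by (auto simp: indicator_def abs_less_iff)
  qed
qed

text \<open>Testing \<open>w' = - m w\<close> with \<open>\<phi> x = exp (m x) (G x - G (x - 1))\<close>, where \<open>G' x = exp (- m x) \<theta> x\<close>,
  shows \<open>w x = exp m * w (x + 1)\<close> in the sense of distributions.\<close>

lemma weak_exponential_shift:
  fixes w :: "real \<Rightarrow> complex"
  assumes [measurable]: "w \<in> borel_measurable borel" and w: "integrable lborel (\<lambda>x. (norm (w x))\<^sup>2)"
    and weak: "weak_derivative (abs_L0 w) (abs_L0 (\<lambda>x. - of_real m * w x))"
    and \<theta>: "smooth_alg \<theta>" "\<And>x. \<theta> x \<noteq> 0 \<Longrightarrow> x \<in> {a..b}"
  shows "(LINT x|lborel. w x * of_real (\<theta> x)) = of_real (exp m) * (LINT x|lborel. w (x + 1) * of_real (\<theta> x))"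
proof -
  have "smooth_alg (\<lambda>x. exp (- m * x) * \<theta> x)" by (intro smooth_alg.mult smooth_alg.exp \<theta>)
  then obtain G where G: "smooth_alg G" "\<And>x. (G has_real_derivative exp (- m * x) * \<theta> x) (at x)"
    by (rule smooth_alg_antideriv) blast
  define \<phi> where "\<phi> x = exp (m * x) * (G x + (- 1) * G (1 * x + (- 1)))" for x
  have \<phi>: "smooth_alg \<phi>"
    unfolding \<phi>_def[abs_def] by (intro smooth_alg.mult smooth_alg.add smooth_alg.exp smooth_alg.const smooth_alg.affine G)
  have supp: "x \<in> {a..b + 1}" if "\<phi> x \<noteq> 0" for x
  proof (rule ccontr)
    assume x: "x \<notin> {a..b + 1}"
    \<comment> \<open>If \<open>\<phi> x \<noteq> 0\<close> then \<open>G\<close> changes on the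
      interval from \<open>x - 1\<close> to \<open>x\<close>, so \<open>\<theta>\<close> is nonzero
      somewhere in it. This is why the support grows by 1 on the right.\<close>
    obtain z where z: "x - 1 < z" "z < x" "G x - G (x - 1) = (x - (x - 1)) * (exp (- m * z) * \<theta> z)"
      using MVT2[of "x - 1" x G "\<lambda>x. exp (- m * x) * \<theta> x"] G(2) by auto
    have "z \<notin> {a..b}" using x z by auto
    then have "\<theta> z = 0" using \<theta>(2) by blast
    then show False using z that by (simp add: \<phi>_def)
  qed
  have test: "test_function \<phi>" by (rule smooth_alg_test_function[OF \<phi> supp])
  \<comment> \<open>The term \<open>m * \<phi> x\<close> cancels against the right-hand side of the
    weak equation, which leaves \<open>\<theta>\<close> and its translate.\<close>
  have deriv: "deriv \<phi> x = m * \<phi> x + (\<theta> x - exp m * \<theta> (x - 1))" for x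
  proof (rule DERIV_imp_deriv)
    have G1: "((\<lambda>x. G (x - 1)) has_real_derivative exp (- m * (x - 1)) * \<theta> (x - 1)) (at x)"
    proof -
      have "((\<lambda>x. x - 1) has_real_derivative 1) (at x)" by (auto intro!: derivative_eq_intros)
      from DERIV_chain2[OF G(2) this] show ?thesis by simp
    qed
    have "((\<lambda>x. exp (m * x) * (G x - G (x - 1))) has_real_derivative
        exp (m * x) * m * (G x - G (x - 1)) + (exp (- m * x) * \<theta> x - exp (- m * (x - 1)) * \<theta> (x - 1)) * exp (m * x)) (at x)"
      by (auto intro!: derivative_eq_intros G1 G(2))
    moreover have "exp (m * x) * m * (G x - G (x - 1)) + (exp (- m * x) * \<theta> x - exp (- m * (x - 1)) * \<theta> (x - 1)) * exp (m * x)
        = m * \<phi> x + (\<theta> x - exp m * \<theta> (x - 1))"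
    proof -
      have "exp (- m * x) * exp (m * x) = 1" "exp (- m * (x - 1)) * exp (m * x) = exp m"
        by (simp_all add: exp_add[symmetric] algebra_simps)
      then show ?thesis by (simp add: \<phi>_def) algebra
    qed
    ultimately have "((\<lambda>x. exp (m * x) * (G x - G (x - 1))) has_real_derivative m * \<phi> x + (\<theta> x - exp m * \<theta> (x - 1))) (at x)"
      by (simp only:)
    moreover have "(\<lambda>x. exp (m * x) * (G x - G (x - 1))) = \<phi>" by (simp add: \<phi>_def fun_eq_iff)
    ultimately show "(\<phi> has_real_derivative m * \<phi> x + (\<theta> x - exp m * \<theta> (x - 1))) (at x)" by simp
  qed
  note int = integrable_L2_mult_compact_support[OF assms(1) w]
  have c\<theta>: "continuous_on UNIV \<theta>" by (rule smooth_alg_continuous[OF \<theta>(1)])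
  have i1: "integrable lborel (\<lambda>x. w x * of_real (\<phi> x))" by (rule int[OF smooth_alg_continuous[OF \<phi>] supp])
  have i2: "integrable lborel (\<lambda>x. w x * of_real (\<theta> x))" by (rule int[OF c\<theta> \<theta>(2)])
  have i3: "integrable lborel (\<lambda>x. w x * of_real (\<theta> (x - 1)))"
  proof (rule int)
    show "continuous_on UNIV (\<lambda>x. \<theta> (x - 1))" by (intro continuous_on_compose2[OF c\<theta>] continuous_intros) auto
    show "x \<in> {a + 1..b + 1}" if "\<theta> (x - 1) \<noteq> 0" for x using \<theta>(2)[OF that] by auto
  qed
  have "(LINT x|lborel. w x * of_real (deriv \<phi> x)) = - (LINT x|lborel. - of_real m * w x * of_real (\<phi> x))"
    using weak test by (simp add: weak_derivative_abs)
  moreover have "(LINT x|lborel. w x * of_real (deriv \<phi> x)) = (LINT x|lborel. m * (w x * of_real (\<phi> x))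
      + (w x * of_real (\<theta> x) - of_real (exp m) * (w x * of_real (\<theta> (x - 1)))))"
    by (intro Bochner_Integration.integral_cong refl) (simp add: deriv algebra_simps exp_of_real)
  moreover have "\<dots> = m * (LINT x|lborel. w x * of_real (\<phi> x)) + ((LINT x|lborel. w x * of_real (\<theta> x))
      - of_real (exp m) * (LINT x|lborel. w x * of_real (\<theta> (x - 1))))"
    using i1 i2 i3 by simp
  moreover have "- (LINT x|lborel. - of_real m * w x * of_real (\<phi> x)) = m * (LINT x|lborel. w x * of_real (\<phi> x))"
    by (simp add: mult.assoc)
  ultimately have "(LINT x|lborel. w x * of_real (\<theta> x)) = of_real (exp m) * (LINT x|lborel. w x * of_real (\<theta> (x - 1)))"
    by simp
  also have "(LINT x|lborel. w x * of_real (\<theta> (x - 1))) = (LINT x|lborel. w (x + 1) * of_real (\<theta> x))"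
    using lborel_integral_real_affine[of 1 "\<lambda>x. w x * complex_of_real (\<theta> (x - 1))" 1] by (simp add: add.commute)
  finally show ?thesis .
qed

text \<open>Obtained from \<open>norm (w x) \<le> (norm (w x))^2 + 1\<close> on the interval. The
  point is that the bound depends on the length only and so is the same for all translates.\<close>

lemma square_integrable_interval:
  fixes w :: "real \<Rightarrow> complex"
  assumes [measurable]: "w \<in> borel_measurable borel" and w: "integrable lborel (\<lambda>x. (norm (w x))\<^sup>2)" and "a \<le> b"
  shows "integrable lborel (\<lambda>x. w x * indicator {a<..<b} x)"
    "norm (LINT x|lborel. w x * indicator {a<..<b} x) \<le> (LINT x|lborel. (norm (w x))\<^sup>2) + (b - a)"
proof -
  have i: "integrable lborel (\<lambda>x. (norm (w x))\<^sup>2 + indicator {a<..<b} x)"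
    using w \<open>a \<le> b\<close> by (intro Bochner_Integration.integrable_add) (auto simp: integrable_indicator_iff)
  have le: "norm (w x * indicator {a<..<b} x) \<le> (norm (w x))\<^sup>2 + indicator {a<..<b} x" for x
  proof -
    have "norm (w x) \<le> (norm (w x))\<^sup>2 + 1"
      using sum_squares_bound[of "norm (w x)" 1] norm_ge_zero[of "w x"] unfolding mult_1_right one_power2 by linarith
    then show ?thesis by (auto simp: indicator_def)
  qed
  show "integrable lborel (\<lambda>x. w x * indicator {a<..<b} x)"
    using le by (intro Bochner_Integration.integrable_bound[OF i]) (auto intro!: AE_I2 order_trans[OF _ abs_ge_self])
  then have "norm (LINT x|lborel. w x * indicator {a<..<b} x) \<le> (LINT x|lborel. (norm (w x))\<^sup>2 + indicator {a<..<b} x)"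
    using i le by (intro Bochner_Integration.integral_norm_bound_integral) auto
  also have "\<dots> = (LINT x|lborel. (norm (w x))\<^sup>2) + (b - a)"
    using w \<open>a \<le> b\<close> by (subst Bochner_Integration.integral_add) (auto simp: integrable_indicator_iff)
  finally show "norm (LINT x|lborel. w x * indicator {a<..<b} x) \<le> (LINT x|lborel. (norm (w x))\<^sup>2) + (b - a)" .
qed

text \<open>By the previous lemma, the integrals of \<open>w\<close> over intervals grow like \<open>exp (m n)\<close> when shifted to
  the left by \<open>n\<close>, but they are bounded.\<close>

lemma weak_exponential_zero:
  fixes w :: "real \<Rightarrow> complex"
  assumes [measurable]: "w \<in> borel_measurable borel" and w: "integrable lborel (\<lambda>x. (norm (w x))\<^sup>2)"
    and weak: "weak_derivative (abs_L0 w) (abs_L0 (\<lambda>x. - of_real m * w x))" and m: "m > 0"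
  shows "AE x in lborel. w x = 0"
proof (rule AE_zero_of_integral_intervals)
  have intv: "integrable lborel (\<lambda>x. w x * indicator {a<..<b} x)" for a b
    using square_integrable_interval(1)[OF assms(1) w, of a b] by (cases "a \<le> b") auto
  then show "\<And>a b. integrable lborel (\<lambda>x. w x * indicator {a<..<b} x)" .
  have intv1: "integrable lborel (\<lambda>x. w (x + 1) * indicator {a<..<b} x)" for a b
    using lborel_integrable_real_affine[OF intv[of "a + 1" "b + 1"], of 1 1]
    by (rule back_subst[of "integrable lborel"]) (auto simp: fun_eq_iff indicator_def add.commute)
  define I where "I a b = (LINT x|lborel. w x * indicator {a<..<b} x)" for a b
  \<comment> \<open>The shift identity passes from bumps to indicators by dominated
    convergence.\<close>
  have shift: "I a b = of_real (exp m) * I (a + 1) (b + 1)" for a b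
  proof -
    have lim: "(\<lambda>n. LINT x|lborel. v x * of_real (bump a b n x)) \<longlonglongrightarrow> (LINT x|lborel. v x * indicator {a<..<b} x)"
      if [measurable]: "v \<in> borel_measurable borel" and i: "integrable lborel (\<lambda>x. v x * indicator {a<..<b} x)" for v :: "real \<Rightarrow> complex"
    proof (rule integral_dominated_convergence)
      have [measurable]: "bump a b n \<in> borel_measurable borel" for n
        by (intro borel_measurable_continuous_onI smooth_alg_continuous bump_smooth)
      show "(\<lambda>x. v x * of_real (bump a b n x)) \<in> borel_measurable lborel" for n by measurable
      show "integrable lborel (\<lambda>x. norm (v x * indicator {a<..<b} x))" using i by (rule integrable_norm)
      show "AE x in lborel. (\<lambda>n. v x * of_real (bump a b n x)) \<longlonglongrightarrow> v x * indicator {a<..<b} x"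
      proof (intro AE_I2 tendsto_mult tendsto_const)
        fix x
        have "(\<lambda>n. complex_of_real (bump a b n x)) \<longlonglongrightarrow> of_real (indicator {a<..<b} x)"
          by (intro tendsto_of_real bump_tendsto)
        then show "(\<lambda>n. complex_of_real (bump a b n x)) \<longlonglongrightarrow> indicator {a<..<b} x"
          by (cases "x \<in> {a<..<b}") auto
      qed
      show "AE x in lborel. norm (v x * of_real (bump a b n x)) \<le> norm (v x * indicator {a<..<b} x)" for n
      proof (intro AE_I2)
        fix x
        show "norm (v x * of_real (bump a b n x)) \<le> norm (v x * indicator {a<..<b} x)"
        proof (cases "a < x \<and> x < b")
          case True
          then show ?thesis using bump_bounds[of a b n x] by (simp add: norm_mult mult_left_le)
        next
          case False
          then have "bump a b n x = 0" using bump_bounds(3)[of a b n x] by blast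
          then show ?thesis by simp
        qed
      qed
    qed measurable
    have "(LINT x|lborel. w x * of_real (bump a b n x)) = of_real (exp m) * (LINT x|lborel. w (x + 1) * of_real (bump a b n x))" for n
      by (rule weak_exponential_shift[where a = a and b = b, OF assms(1) w weak bump_smooth])
        (use bump_bounds(3)[of a b n] in force)
    then have "(\<lambda>n. LINT x|lborel. w x * of_real (bump a b n x)) \<longlonglongrightarrow> of_real (exp m) * (LINT x|lborel. w (x + 1) * indicator {a<..<b} x)"
      using tendsto_mult_left[OF lim[OF _ intv1], of "complex_of_real (exp m)"] by simp
    then have "I a b = of_real (exp m) * (LINT x|lborel. w (x + 1) * indicator {a<..<b} x)"
      unfolding I_def using lim[OF assms(1) intv] LIMSEQ_unique by blast
    also have "(LINT x|lborel. w (x + 1) * indicator {a<..<b} x) = I (a + 1) (b + 1)"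
      unfolding I_def using lborel_integral_real_affine[of 1 "\<lambda>x. w x * indicator {a + 1<..<b + 1} x" 1]
      by (simp add: add.commute) (auto intro!: Bochner_Integration.integral_cong simp: indicator_def)
    finally show ?thesis .
  qed
  have I0: "I a b = 0" if "a \<le> b" for a b
  proof -
    have pow: "I (a - real n) (b - real n) = of_real (exp m) ^ n * I a b" for n
    proof (induction n)
      case (Suc n)
      have "I (a - real (Suc n)) (b - real (Suc n)) = of_real (exp m) * I (a - real n) (b - real n)"
        using shift[of "a - real (Suc n)" "b - real (Suc n)"] by (simp add: algebra_simps)
      then show ?case by (simp add: Suc)
    qed simp
    define C where "C = (LINT x|lborel. (norm (w x))\<^sup>2) + (b - a)"
    have bd: "exp m ^ n * norm (I a b) \<le> C" for n
    proof -
      have "norm (I (a - real n) (b - real n)) \<le> C"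
        using square_integrable_interval(2)[OF assms(1) w, of "a - real n" "b - real n"] that by (simp add: I_def C_def)
      then show ?thesis by (simp add: pow norm_mult norm_power)
    qed
    show ?thesis
    proof (rule ccontr)
      assume "I a b \<noteq> 0"
      then have pos: "norm (I a b) > 0" by simp
      obtain n where "C / norm (I a b) < exp m ^ n" using real_arch_pow[of "exp m"] m by auto
      then have "C < exp m ^ n * norm (I a b)" using pos by (simp add: pos_divide_less_eq)
      with bd[of n] show False by simp
    qed
  qed
  show "(LINT x|lborel. w x * indicator {a<..<b} x) = 0" for a b
    using I0[of a b] by (cases "a \<le> b") (auto simp: I_def)
qed (rule assms(1))

section \<open>The resolvent on $L^2$\<close>

definition exp_kernel :: "real \<Rightarrow> real \<Rightarrow> real" where
  "exp_kernel m s = indicator {0..} s * exp (- m * s)"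

text \<open>The kernel formula for \<open>(m - A)\<^sup>-\<^sup>1\<close> with
  \<open>A = - d/dx\<close>, that is, for the solution of \<open>g' + m g = f\<close> that only
  looks to the left.\<close>

definition resolvent :: "real \<Rightarrow> (real \<Rightarrow> complex) \<Rightarrow> real \<Rightarrow> complex" where
  "resolvent m f x = (LINT y|lborel. exp_kernel m (x - y) *\<^sub>R f y)"

lemma exp_kernel_measurable [measurable]: "exp_kernel m \<in> borel_measurable borel"
  unfolding exp_kernel_def[abs_def] by measurable

lemma borel_measurable_cnj [measurable (raw)]:
  assumes "f \<in> borel_measurable M" shows "(\<lambda>x. cnj (f x)) \<in> borel_measurable M"
proof (rule measurable_compose[OF assms])
  show "cnj \<in> borel_measurable borel" by (intro borel_measurable_continuous_onI continuous_intros)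
qed

lemma exp_kernel_nonneg [simp]: "0 \<le> exp_kernel m s"
  by (simp add: exp_kernel_def)

lemma exp_kernel_le_1: "0 \<le> m \<Longrightarrow> exp_kernel m s \<le> 1"
  by (simp add: exp_kernel_def indicator_def)

lemma has_integral_ker:
  assumes m: "m > 0"
  shows "has_bochner_integral lborel (exp_kernel m) (1 / m)"
proof -
  have "has_bochner_integral lborel (\<lambda>x. x ^ 0 * exp (- x) * indicator {0 ..} x) (fact 0 :: real)"
    by (rule has_bochner_integral_I0i_power_exp_m')
  then have "has_bochner_integral lborel (\<lambda>x. exp (- x) * indicator {0 ..} x) (1 :: real)" by simp
  from lborel_has_bochner_integral_real_affine_iff[of m _ _ 0, THEN iffD1, OF _ this] m
  have "has_bochner_integral lborel (\<lambda>x. exp (- (m * x)) * indicator {0 ..} (m * x)) (1 / m)"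
    by (simp add: divide_inverse)
  moreover have "(\<lambda>x. exp (- (m * x)) * indicator {0 ..} (m * x)) = exp_kernel m"
    using m by (auto simp: fun_eq_iff exp_kernel_def indicator_def zero_le_mult_iff)
  ultimately show ?thesis by simp
qed

lemma exp_kernel_integrals:
  assumes m: "m > 0"
  shows "integrable lborel (\<lambda>y. exp_kernel m (x - y))" "(LINT y|lborel. exp_kernel m (x - y)) = 1 / m"
    "integrable lborel (\<lambda>x. exp_kernel m (x - y))" "(LINT x|lborel. exp_kernel m (x - y)) = 1 / m"
proof -
  note k = has_integral_ker[OF m, unfolded has_bochner_integral_iff]
  show "integrable lborel (\<lambda>y. exp_kernel m (x - y))" "(LINT y|lborel. exp_kernel m (x - y)) = 1 / m"
    using k lborel_integrable_real_affine[of "exp_kernel m" "-1" x] lborel_integral_real_affine[of "-1" "exp_kernel m" x] by simp_all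
  show "integrable lborel (\<lambda>x. exp_kernel m (x - y))" "(LINT x|lborel. exp_kernel m (x - y)) = 1 / m"
    using k lborel_integrable_real_affine[of "exp_kernel m" 1 "-y"] lborel_integral_real_affine[of 1 "exp_kernel m" "-y"] by simp_all
qed

lemma exp_kernel_square: "(exp_kernel m s)\<^sup>2 = exp_kernel (2 * m) s"
  by (simp add: exp_kernel_def indicator_def power2_eq_square exp_add[symmetric])

text \<open>Values in a Banach space are allowed because \<open>q\<close> will be the real function
  \<open>(norm f)^2\<close> as well as the complex product of \<open>f\<close> with the conjugate of
  its resolvent.\<close>

lemma exp_kernel_convolution:
  fixes q :: "real \<Rightarrow> 'a::{banach, second_countable_topology}"
  assumes m: "m > 0" and q: "integrable lborel q"
  shows "integrable lborel (\<lambda>x. LINT y|lborel. exp_kernel m (x - y) *\<^sub>R q y)"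
    "(LINT x|lborel. LINT y|lborel. exp_kernel m (x - y) *\<^sub>R q y) = (1 / m) *\<^sub>R (LINT y|lborel. q y)"
proof -
  have [measurable]: "q \<in> borel_measurable borel" using q by simp
  have I: "integrable (lborel \<Otimes>\<^sub>M lborel) (\<lambda>(y, x). exp_kernel m (x - y) *\<^sub>R q y)"
  proof (rule lborel_pair.Fubini_integrable)
    have "(LINT x|lborel. norm (exp_kernel m (x - y) *\<^sub>R q y)) = (1 / m) * norm (q y)" for y
      using exp_kernel_integrals(4)[OF m, of y] by simp
    then show "integrable lborel (\<lambda>y. LINT x|lborel. norm (case (y, x) of (y, x) \<Rightarrow> exp_kernel m (x - y) *\<^sub>R q y))"
      using q by simp
    show "AE y in lborel. integrable lborel (\<lambda>x. case (y, x) of (y, x) \<Rightarrow> exp_kernel m (x - y) *\<^sub>R q y)"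
      using exp_kernel_integrals(3)[OF m] by simp
  qed measurable
  show "integrable lborel (\<lambda>x. LINT y|lborel. exp_kernel m (x - y) *\<^sub>R q y)"
    using lborel_pair.integrable_snd[OF I] by simp
  have "(LINT x|lborel. LINT y|lborel. exp_kernel m (x - y) *\<^sub>R q y) = (LINT y|lborel. LINT x|lborel. exp_kernel m (x - y) *\<^sub>R q y)"
    by (rule lborel_pair.Fubini_integral[OF I])
  also have "\<dots> = (LINT y|lborel. (1 / m) *\<^sub>R q y)"
    by (simp only: Bochner_Integration.integral_scaleR_left[OF exp_kernel_integrals(3)[OF m]] exp_kernel_integrals(4)[OF m])
  finally show "(LINT x|lborel. LINT y|lborel. exp_kernel m (x - y) *\<^sub>R q y) = (1 / m) *\<^sub>R (LINT y|lborel. q y)"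
    by simp
qed

text \<open>Splitting the square along the diagonal gives two conjugate halves.\<close>

lemma norm_square_integral:
  fixes h :: "real \<Rightarrow> complex"
  assumes h: "integrable lborel h"
  shows "(norm (LINT y|lborel. h y))\<^sup>2 = 2 * Re (LINT y|lborel. h y * cnj (LINT z|lborel. indicator {..y} z *\<^sub>R h z))"
proof -
  have [measurable]: "h \<in> borel_measurable borel" using h by simp
  let ?c = "LINT y|lborel. cnj (h y)"
  have hc: "integrable lborel (\<lambda>z. cnj (h z))" using h by simp
  have prod: "integrable (lborel \<Otimes>\<^sub>M lborel) (\<lambda>(y, z). h y * cnj (h z))"
  proof (rule lborel_pair.Fubini_integrable)
    show "integrable lborel (\<lambda>y. LINT z|lborel. norm (case (y, z) of (y, z) \<Rightarrow> h y * cnj (h z)))"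
      using h by (simp add: norm_mult)
    show "AE y in lborel. integrable lborel (\<lambda>z. case (y, z) of (y, z) \<Rightarrow> h y * cnj (h z))" using h by simp
  qed measurable
  have L: "integrable (lborel \<Otimes>\<^sub>M lborel) (\<lambda>(y, z). indicator {..y} z *\<^sub>R (h y * cnj (h z)))"
    by (rule Bochner_Integration.integrable_bound[OF prod]) (auto simp: indicator_def)
  have U: "integrable (lborel \<Otimes>\<^sub>M lborel) (\<lambda>(y, z). indicator {..z} y *\<^sub>R (h y * cnj (h z)))"
    by (rule Bochner_Integration.integrable_bound[OF prod]) (auto simp: indicator_def)
  define J where "J = (LINT y|lborel. h y * cnj (LINT z|lborel. indicator {..y} z *\<^sub>R h z))"
  have iL: "integrable lborel (\<lambda>z. indicator {..y} z *\<^sub>R h z)" for y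
    by (rule Bochner_Integration.integrable_bound[OF h]) (auto simp: indicator_def)
  have JL: "J = (LINT y|lborel. LINT z|lborel. indicator {..y} z *\<^sub>R (h y * cnj (h z)))"
  proof -
    have "h y * cnj (LINT z|lborel. indicator {..y} z *\<^sub>R h z) = (LINT z|lborel. indicator {..y} z *\<^sub>R (h y * cnj (h z)))" for y
    proof -
      have "cnj (LINT z|lborel. indicator {..y} z *\<^sub>R h z) = (LINT z|lborel. cnj (indicator {..y} z *\<^sub>R h z))"
        by (rule Bochner_Integration.integral_cnj[symmetric])
      then have "h y * cnj (LINT z|lborel. indicator {..y} z *\<^sub>R h z) = (LINT z|lborel. h y * cnj (indicator {..y} z *\<^sub>R h z))"
        by (simp only: integral_mult_right_zero)
      then show ?thesis by (simp add: scaleR_conv_of_real mult_ac)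
    qed
    then show ?thesis by (simp add: J_def)
  qed
  have JU: "cnj J = (LINT y|lborel. LINT z|lborel. indicator {..z} y *\<^sub>R (h y * cnj (h z)))"
  proof -
    have "cnj J = (LINT y|lborel. LINT z|lborel. cnj (indicator {..y} z *\<^sub>R (h y * cnj (h z))))"
      unfolding JL by (simp only: Bochner_Integration.integral_cnj)
    also have "\<dots> = (LINT y|lborel. LINT z|lborel. indicator {..y} z *\<^sub>R (h z * cnj (h y)))"
      by (simp add: scaleR_conv_of_real mult_ac)
    also have "\<dots> = (LINT y|lborel. LINT z|lborel. indicator {..z} y *\<^sub>R (h y * cnj (h z)))"
      by (rule lborel_pair.Fubini_integral[OF U])
    finally show ?thesis .
  qed
  have "(LINT y|lborel. h y) * cnj (LINT z|lborel. h z) = (LINT y|lborel. LINT z|lborel. h y * cnj (h z))"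
    by (simp add: mult.commute)
  also have "\<dots> = (LINT y|lborel. (LINT z|lborel. indicator {..y} z *\<^sub>R (h y * cnj (h z))) + (LINT z|lborel. indicator {..z} y *\<^sub>R (h y * cnj (h z))))"
  proof (rule Bochner_Integration.integral_cong[OF refl])
    fix y
    have i: "integrable lborel (\<lambda>z. h y * cnj (h z))" using hc by simp
    \<comment> \<open>The two halves overlap on the diagonal, which for fixed \<open>y\<close> is a
      single point.\<close>
    have "(LINT z|lborel. h y * cnj (h z)) = (LINT z|lborel. indicator {..y} z *\<^sub>R (h y * cnj (h z)) + indicator {..z} y *\<^sub>R (h y * cnj (h z)))"
    proof (rule integral_cong_AE)
      show "AE z in lborel. h y * cnj (h z) = indicator {..y} z *\<^sub>R (h y * cnj (h z)) + indicator {..z} y *\<^sub>R (h y * cnj (h z))"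
        using AE_lborel_singleton[of y] by eventually_elim (auto simp: indicator_def)
      show "(\<lambda>z. h y * cnj (h z)) \<in> borel_measurable lborel" by measurable
      have "indicator {..z} y = (indicator {y..} z :: real)" for z by (simp add: indicator_def)
      then show "(\<lambda>z. indicator {..y} z *\<^sub>R (h y * cnj (h z)) + indicator {..z} y *\<^sub>R (h y * cnj (h z))) \<in> borel_measurable lborel"
        by (simp only:) measurable
    qed
    also have "\<dots> = (LINT z|lborel. indicator {..y} z *\<^sub>R (h y * cnj (h z))) + (LINT z|lborel. indicator {..z} y *\<^sub>R (h y * cnj (h z)))"
      by (intro Bochner_Integration.integral_add; rule Bochner_Integration.integrable_bound[OF i]) (auto simp: indicator_def)
    finally show "(LINT z|lborel. h y * cnj (h z)) = (LINT z|lborel. indicator {..y} z *\<^sub>R (h y * cnj (h z))) + (LINT z|lborel. indicator {..z} y *\<^sub>R (h y * cnj (h z)))" .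
  qed
  also have "\<dots> = J + cnj J"
    unfolding JU unfolding JL using lborel_pair.integrable_fst[OF L] lborel_pair.integrable_fst[OF U]
    by (intro Bochner_Integration.integral_add) auto
  finally have "complex_of_real ((norm (LINT y|lborel. h y))\<^sup>2) = of_real (2 * Re J)"
    by (simp only: complex_norm_square complex_add_cnj)
  then show ?thesis unfolding J_def of_real_eq_iff .
qed

context
  fixes m :: real and f :: "real \<Rightarrow> complex"
  assumes m: "m > 0" and f_meas [measurable]: "f \<in> borel_measurable borel"
    and f: "integrable lborel (\<lambda>x. (norm (f x))\<^sup>2)"
begin

lemma exp_kernel_mult_integrable: "integrable lborel (\<lambda>y. exp_kernel m (x - y) *\<^sub>R f y)"
proof -
  have "integrable lborel (\<lambda>y. complex_of_real (exp_kernel m (x - y)) * f y)"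
    using f exp_kernel_integrals(1)[of "2 * m" x] m by (intro integrable_mult_of_square_integrable) (auto simp: exp_kernel_square)
  then show ?thesis by (simp add: scaleR_conv_of_real)
qed

lemma resolvent_measurable [measurable]: "resolvent m f \<in> borel_measurable borel"
  unfolding resolvent_def[abs_def] by measurable

text \<open>The resolvent of \<open>norm f\<close>, a pointwise majorant of
  \<open>resolvent m f\<close>. It yields square integrability and the absolute convergence behind
  Fubini's theorem in \<open>resolvent_weak_derivative\<close>.\<close>

definition resolvent_bound where "resolvent_bound x = (LINT y|lborel. exp_kernel m (x - y) * norm (f y))"

lemma resolvent_bound_integrable: "integrable lborel (\<lambda>y. exp_kernel m (x - y) * norm (f y))"
  using integrable_norm[OF exp_kernel_mult_integrable[of x]] by simp

lemma resolvent_bound_measurable [measurable]: "resolvent_bound \<in> borel_measurable borel"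
  unfolding resolvent_bound_def[abs_def] by measurable

lemma norm_resolvent_le: "norm (resolvent m f x) \<le> resolvent_bound x"
  unfolding resolvent_def resolvent_bound_def using integral_norm_bound[of lborel "\<lambda>y. exp_kernel m (x - y) *\<^sub>R f y"] by simp

lemma resolvent_bound_nonneg: "0 \<le> resolvent_bound x"
  unfolding resolvent_bound_def by (intro integral_nonneg_AE AE_I2) simp

text \<open>Nonnegativity of a variance: \<open>m * exp_kernel m (x - y)\<close> is a probability
  density in \<open>y\<close>, under which \<open>norm (f y)\<close> has mean
  \<open>m * resolvent_bound x\<close>.\<close>

lemma resolvent_bound_square_le: "(resolvent_bound x)\<^sup>2 \<le> (1 / m) * (LINT y|lborel. exp_kernel m (x - y) *\<^sub>R (norm (f y))\<^sup>2)"
proof -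
  have i: "integrable lborel (\<lambda>y. exp_kernel m (x - y) * (norm (f y))\<^sup>2)"
    by (rule Bochner_Integration.integrable_bound[OF f]) (use m exp_kernel_le_1 in \<open>auto simp: mult_left_le_one_le\<close>)
  have "0 \<le> (LINT y|lborel. exp_kernel m (x - y) * (norm (f y) - m * resolvent_bound x)\<^sup>2)"
    by (intro integral_nonneg_AE AE_I2) simp
  also have "\<dots> = (LINT y|lborel. exp_kernel m (x - y) * (norm (f y))\<^sup>2 - 2 * m * resolvent_bound x * (exp_kernel m (x - y) * norm (f y)) + (m * resolvent_bound x)\<^sup>2 * exp_kernel m (x - y))"
    by (intro Bochner_Integration.integral_cong refl) (simp add: power2_eq_square algebra_simps)
  also have "\<dots> = (LINT y|lborel. exp_kernel m (x - y) * (norm (f y))\<^sup>2) - 2 * m * resolvent_bound x * resolvent_bound x + (m * resolvent_bound x)\<^sup>2 * (1 / m)"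
    using i resolvent_bound_integrable[of x] exp_kernel_integrals(1)[OF m, of x] exp_kernel_integrals(2)[OF m, of x] by (simp add: resolvent_bound_def)
  finally have "m * (resolvent_bound x)\<^sup>2 \<le> (LINT y|lborel. exp_kernel m (x - y) * (norm (f y))\<^sup>2)"
    using m by (simp add: power2_eq_square field_simps)
  then show ?thesis using m by (simp add: field_simps)
qed

lemma resolvent_bound_square_integrable: "integrable lborel (\<lambda>x. (resolvent_bound x)\<^sup>2)"
proof (rule Bochner_Integration.integrable_bound)
  show "integrable lborel (\<lambda>x. (1 / m) * (LINT y|lborel. exp_kernel m (x - y) *\<^sub>R (norm (f y))\<^sup>2))"
    by (intro integrable_mult_right exp_kernel_convolution(1)[OF m f])
  show "AE x in lborel. norm ((resolvent_bound x)\<^sup>2) \<le> norm ((1 / m) * (LINT y|lborel. exp_kernel m (x - y) *\<^sub>R (norm (f y))\<^sup>2))"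
    using resolvent_bound_square_le by (intro AE_I2) (simp only: real_norm_def abs_power2 order_trans[OF _ abs_ge_self])
qed measurable

lemma resolvent_square_integrable: "integrable lborel (\<lambda>x. (norm (resolvent m f x))\<^sup>2)"
  by (rule Bochner_Integration.integrable_bound[OF resolvent_bound_square_integrable])
    (use norm_resolvent_le in \<open>auto intro!: AE_I2 power_mono\<close>)

lemma f_resolvent_integrable: "integrable lborel (\<lambda>y. f y * cnj (resolvent m f y))"
  using f resolvent_square_integrable by (intro integrable_mult_of_square_integrable) auto

text \<open>\<open>norm_square_integral\<close> is applied to the integrand of the resolvent at
  \<open>x\<close>. Its integral up to \<open>y\<close> is \<open>exp (- m * (x - y))\<close> times
  the resolvent at \<open>y\<close>, and the two exponentials combine to the kernel for
  \<open>2 * m\<close>.\<close>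

lemma norm_resolvent_square: "(norm (resolvent m f x))\<^sup>2 = 2 * Re (LINT y|lborel. exp_kernel (2 * m) (x - y) *\<^sub>R (f y * cnj (resolvent m f y)))"
proof -
  have inner: "exp_kernel m (x - y) *\<^sub>R f y * cnj (LINT z|lborel. indicator {..y} z *\<^sub>R (exp_kernel m (x - z) *\<^sub>R f z))
      = exp_kernel (2 * m) (x - y) *\<^sub>R (f y * cnj (resolvent m f y))" for y
  proof (cases "y \<le> x")
    case True
    have "indicator {..y} z *\<^sub>R (exp_kernel m (x - z) *\<^sub>R f z) = exp (- m * (x - y)) *\<^sub>R (exp_kernel m (y - z) *\<^sub>R f z)" for z
      using True by (auto simp: exp_kernel_def indicator_def exp_add[symmetric] algebra_simps)
    then have "(LINT z|lborel. indicator {..y} z *\<^sub>R (exp_kernel m (x - z) *\<^sub>R f z)) = exp (- m * (x - y)) *\<^sub>R resolvent m f y"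
      by (simp only: resolvent_def integral_scaleR_right)
    moreover have "exp (- m * (x - y)) = exp_kernel m (x - y)" using True by (simp add: exp_kernel_def)
    moreover have "exp_kernel (2 * m) (x - y) = exp_kernel m (x - y) * exp_kernel m (x - y)"
      by (simp only: exp_kernel_square[symmetric] power2_eq_square)
    ultimately show ?thesis by (simp add: scaleR_conv_of_real mult_ac)
  qed (simp add: exp_kernel_def)
  show ?thesis
    unfolding resolvent_def[of m f x] norm_square_integral[OF exp_kernel_mult_integrable] inner ..
qed

text \<open>For the resolvent \<open>g\<close> of \<open>f\<close> this expresses
  \<open>Re \<langle>g', g\<rangle> = 0\<close>, that is, skew-adjointness. Integrating the
  pointwise identity avoids derivatives and boundary terms: the mass \<open>1 / (2 * m)\<close> of
  the kernel cancels the factor 2.\<close>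

lemma resolvent_energy: "m * (LINT x|lborel. (norm (resolvent m f x))\<^sup>2) = Re (LINT y|lborel. f y * cnj (resolvent m f y))"
proof -
  have m2: "2 * m > 0" using m by simp
  note c = exp_kernel_convolution[OF m2 f_resolvent_integrable]
  have "(LINT x|lborel. (norm (resolvent m f x))\<^sup>2) = 2 * Re (LINT x|lborel. LINT y|lborel. exp_kernel (2 * m) (x - y) *\<^sub>R (f y * cnj (resolvent m f y)))"
    unfolding norm_resolvent_square using c(1) by simp
  also have "\<dots> = 2 * Re ((1 / (2 * m)) *\<^sub>R (LINT y|lborel. f y * cnj (resolvent m f y)))" by (simp only: c(2))
  finally show ?thesis using m by simp
qed

text \<open>Expanding the square, the energy identity makes the mixed term twice the last one with
  opposite sign, so the quadratic term is subtracted exactly once.\<close>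

lemma resolvent_contraction:
  "(LINT x|lborel. (norm (f x - m *\<^sub>R resolvent m f x))\<^sup>2) \<le> (LINT x|lborel. (norm (f x))\<^sup>2)"
proof -
  have "(norm (f x - m *\<^sub>R resolvent m f x))\<^sup>2 = (norm (f x))\<^sup>2 - 2 * m * Re (f x * cnj (resolvent m f x)) + m\<^sup>2 * (norm (resolvent m f x))\<^sup>2" for x
    unfolding cmod_power2 by (simp add: power2_eq_square algebra_simps)
  then have "(LINT x|lborel. (norm (f x - m *\<^sub>R resolvent m f x))\<^sup>2)
      = (LINT x|lborel. (norm (f x))\<^sup>2) - 2 * m * Re (LINT x|lborel. f x * cnj (resolvent m f x)) + m\<^sup>2 * (LINT x|lborel. (norm (resolvent m f x))\<^sup>2)"
    using f f_resolvent_integrable resolvent_square_integrable by (simp del: Re_complex_of_real times_complex.sel complex_cnj)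
  also have "\<dots> = (LINT x|lborel. (norm (f x))\<^sup>2) - m\<^sup>2 * (LINT x|lborel. (norm (resolvent m f x))\<^sup>2)"
    unfolding resolvent_energy[symmetric] by (simp add: power2_eq_square)
  also have "\<dots> \<le> (LINT x|lborel. (norm (f x))\<^sup>2)" by (simp add: integral_nonneg_AE)
  finally show ?thesis .
qed

text \<open>The kernel is at most 1, so the resolvent is bounded by the \<open>L\<^sup>1\<close>
  norm of \<open>f\<close>; insert this into the energy identity. Letting \<open>m\<close> tend to 0
  gives the dense domain of the inverse operator.\<close>

lemma resolvent_small:
  assumes f1: "integrable lborel f"
  shows "m\<^sup>2 * (LINT x|lborel. (norm (resolvent m f x))\<^sup>2) \<le> m * (LINT x|lborel. norm (f x))\<^sup>2"
proof -
  have b: "norm (resolvent m f x) \<le> (LINT y|lborel. norm (f y))" for x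
    unfolding resolvent_def using f1 m exp_kernel_le_1
    by (intro Bochner_Integration.integral_norm_bound_integral exp_kernel_mult_integrable) (auto simp: mult_left_le_one_le)
  have "Re (LINT y|lborel. f y * cnj (resolvent m f y)) \<le> norm (LINT y|lborel. f y * cnj (resolvent m f y))" by (rule complex_Re_le_cmod)
  also have "\<dots> \<le> (LINT y|lborel. norm (f y) * (LINT y|lborel. norm (f y)))"
    using f1 b by (intro Bochner_Integration.integral_norm_bound_integral f_resolvent_integrable) (auto simp: norm_mult mult_left_mono)
  also have "\<dots> = (LINT x|lborel. norm (f x))\<^sup>2" by (simp add: power2_eq_square)
  finally have "m * (LINT x|lborel. (norm (resolvent m f x))\<^sup>2) \<le> (LINT x|lborel. norm (f x))\<^sup>2" by (simp add: resolvent_energy)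
  from mult_left_mono[OF this, of m] m show ?thesis by (simp add: power2_eq_square mult.assoc)
qed

lemma resolvent_weak_derivative: "weak_derivative (abs_L0 (resolvent m f)) (abs_L0 (\<lambda>x. f x - m *\<^sub>R resolvent m f x))"
proof -
  have "(LINT x|lborel. resolvent m f x * of_real (deriv \<phi> x)) = - (LINT x|lborel. (f x - m *\<^sub>R resolvent m f x) * of_real (\<phi> x))"
    if \<phi>: "test_function \<phi>" for \<phi>
  proof -
    obtain M where M: "M > 0" "\<And>x. (\<phi> has_real_derivative deriv \<phi> x) (at x)"
      "continuous_on UNIV \<phi>" "continuous_on UNIV (deriv \<phi>)"
      "\<And>x. M \<le> \<bar>x\<bar> \<Longrightarrow> \<phi> x = 0" "\<And>x. M \<le> \<bar>x\<bar> \<Longrightarrow> deriv \<phi> x = 0"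
      using test_functionE[OF \<phi>] by metis
    \<comment> \<open>Integrating the kernel against \<open>\<psi>\<close> returns
      \<open>- \<phi>\<close>, because \<open>exp (- m * (x - y)) * \<phi> x\<close> has derivative
      \<open>exp (- m * (x - y)) * \<psi> x\<close>. Fubini's theorem moves the kernel from
      \<open>f\<close> to \<open>\<psi>\<close>.\<close>
    define \<psi> where "\<psi> x = deriv \<phi> x - m * \<phi> x" for x
    have supp: "x \<in> {- M..M}" if "\<phi> x \<noteq> 0 \<or> deriv \<phi> x \<noteq> 0 \<or> \<psi> x \<noteq> 0" for x
      using M(5,6)[of x] that by (cases "M \<le> \<bar>x\<bar>") (auto simp: \<psi>_def)
    have c\<psi>: "continuous_on UNIV \<psi>" unfolding \<psi>_def[abs_def] using M by (intro continuous_intros)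
    have [measurable]: "\<phi> \<in> borel_measurable borel" "deriv \<phi> \<in> borel_measurable borel" "\<psi> \<in> borel_measurable borel"
      using M c\<psi> by (auto intro: borel_measurable_continuous_onI)
    note icp = integrable_L2_mult_compact_support[where c = "- M" and d = M]
    have P: "integrable (lborel \<Otimes>\<^sub>M lborel) (\<lambda>(x, y). (exp_kernel m (x - y) *\<^sub>R f y) * of_real (\<psi> x))"
    proof (rule lborel_pair.Fubini_integrable)
      have "(LINT y|lborel. norm ((exp_kernel m (x - y) *\<^sub>R f y) * complex_of_real (\<psi> x))) = norm (complex_of_real (resolvent_bound x) * of_real (\<psi> x))" for x
        using resolvent_bound_nonneg[of x] by (simp add: norm_mult resolvent_bound_def flip: mult.assoc)
      moreover have "integrable lborel (\<lambda>x. complex_of_real (resolvent_bound x) * of_real (\<psi> x))"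
        using resolvent_bound_square_integrable c\<psi> supp by (intro icp) auto
      ultimately show "integrable lborel (\<lambda>x. LINT y|lborel. norm (case (x, y) of (x, y) \<Rightarrow> (exp_kernel m (x - y) *\<^sub>R f y) * complex_of_real (\<psi> x)))"
        by (simp only: prod.case) (rule integrable_norm)
      show "AE x in lborel. integrable lborel (\<lambda>y. case (x, y) of (x, y) \<Rightarrow> (exp_kernel m (x - y) *\<^sub>R f y) * complex_of_real (\<psi> x))"
        unfolding prod.case by (intro AE_I2 integrable_mult_left exp_kernel_mult_integrable)
    qed measurable
    have inner: "(LINT x|lborel. (exp_kernel m (x - y) *\<^sub>R f y) * of_real (\<psi> x)) = - (f y * of_real (\<phi> y))" for y
    proof -
      \<comment> \<open>Far enough to the right for \<open>\<phi>\<close> to vanish and for the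
        interval to start at \<open>y\<close>.\<close>
      define N where "N = max M \<bar>y\<bar>"
      have N: "y \<le> N" "\<phi> N = 0" using M(5)[of N] M(1) by (auto simp: N_def)
      have "has_bochner_integral lborel (\<lambda>x. indicator {y..N} x *\<^sub>R (exp (- m * (x - y)) * \<psi> x))
          (exp (- m * (N - y)) * \<phi> N - exp (- m * (y - y)) * \<phi> y)"
      proof (rule has_bochner_integral_FTC_Icc[OF N(1)])
        fix x
        have "((\<lambda>x. exp (- m * (x - y)) * \<phi> x) has_real_derivative exp (- m * (x - y)) * \<psi> x) (at x within {y..N})"
          by (auto intro!: derivative_eq_intros DERIV_subset[OF M(2)] simp: \<psi>_def algebra_simps)
        then show "((\<lambda>x. exp (- m * (x - y)) * \<phi> x) has_vector_derivative exp (- m * (x - y)) * \<psi> x) (at x within {y..N})"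
          by (simp add: has_real_derivative_iff_has_vector_derivative)
      next
        show "continuous_on {y..N} (\<lambda>x. exp (- m * (x - y)) * \<psi> x)"
          by (intro continuous_intros continuous_on_subset[OF c\<psi>]) auto
      qed
      moreover have "indicator {y..N} x *\<^sub>R (exp (- m * (x - y)) * \<psi> x) = exp_kernel m (x - y) * \<psi> x" for x
        using supp[of x] by (cases "\<psi> x = 0") (auto simp: exp_kernel_def indicator_def N_def)
      ultimately have "has_bochner_integral lborel (\<lambda>x. exp_kernel m (x - y) * \<psi> x)
          (exp (- m * (N - y)) * \<phi> N - exp (- m * (y - y)) * \<phi> y)" by (simp only:)
      then have "has_bochner_integral lborel (\<lambda>x. exp_kernel m (x - y) * \<psi> x) (- \<phi> y)" using N(2) by simp
      then have k: "(LINT x|lborel. exp_kernel m (x - y) * \<psi> x) = - \<phi> y" by (rule has_bochner_integral_integral_eq)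
      have "(LINT x|lborel. (exp_kernel m (x - y) *\<^sub>R f y) * of_real (\<psi> x)) = (LINT x|lborel. f y * complex_of_real (exp_kernel m (x - y) * \<psi> x))"
        by (intro Bochner_Integration.integral_cong refl) (simp add: scaleR_conv_of_real mult_ac)
      also have "\<dots> = f y * complex_of_real (LINT x|lborel. exp_kernel m (x - y) * \<psi> x)"
        by (simp only: integral_mult_right_zero integral_complex_of_real)
      finally show ?thesis by (simp add: k)
    qed
    have i1: "integrable lborel (\<lambda>x. resolvent m f x * of_real (deriv \<phi> x))" using resolvent_square_integrable M supp by (intro icp) auto
    have i2: "integrable lborel (\<lambda>x. resolvent m f x * of_real (\<phi> x))" using resolvent_square_integrable M supp by (intro icp) auto
    have i3: "integrable lborel (\<lambda>x. f x * of_real (\<phi> x))" using f M supp by (intro icp) auto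
    have "(LINT x|lborel. resolvent m f x * of_real (\<psi> x)) = (LINT x|lborel. LINT y|lborel. (exp_kernel m (x - y) *\<^sub>R f y) * of_real (\<psi> x))"
      by (simp only: resolvent_def integral_mult_left_zero)
    also have "\<dots> = (LINT y|lborel. LINT x|lborel. (exp_kernel m (x - y) *\<^sub>R f y) * of_real (\<psi> x))"
      by (rule lborel_pair.Fubini_integral[OF P, symmetric])
    also have "\<dots> = - (LINT y|lborel. f y * of_real (\<phi> y))" by (simp only: inner Bochner_Integration.integral_minus)
    finally have e: "(LINT x|lborel. resolvent m f x * of_real (\<psi> x)) = - (LINT y|lborel. f y * of_real (\<phi> y))" .
    have "(LINT x|lborel. resolvent m f x * of_real (\<psi> x)) = (LINT x|lborel. resolvent m f x * of_real (deriv \<phi> x) - m * (resolvent m f x * of_real (\<phi> x)))"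
      by (intro Bochner_Integration.integral_cong refl) (simp add: \<psi>_def algebra_simps)
    also have "\<dots> = (LINT x|lborel. resolvent m f x * of_real (deriv \<phi> x)) - m * (LINT x|lborel. resolvent m f x * of_real (\<phi> x))"
      using i1 i2 by simp
    finally have e1: "(LINT x|lborel. resolvent m f x * of_real (deriv \<phi> x)) = m * (LINT x|lborel. resolvent m f x * of_real (\<phi> x)) - (LINT y|lborel. f y * of_real (\<phi> y))"
      using e by (simp add: algebra_simps)
    have "(LINT x|lborel. (f x - m *\<^sub>R resolvent m f x) * of_real (\<phi> x)) = (LINT x|lborel. f x * of_real (\<phi> x) - m * (resolvent m f x * of_real (\<phi> x)))"
      by (intro Bochner_Integration.integral_cong refl) (simp add: scaleR_conv_of_real algebra_simps)
    also have "\<dots> = (LINT x|lborel. f x * of_real (\<phi> x)) - m * (LINT x|lborel. resolvent m f x * of_real (\<phi> x))"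
      using i2 i3 by simp
    finally show ?thesis using e1 by simp
  qed
  then show ?thesis by (simp add: weak_derivative_abs)
qed

end

section \<open>The resolvent on classes in \<open>L\<^sup>2\<close>\<close>

lemma powr_2_eq_power2: "norm z powr 2 = (norm z)\<^sup>2"
  by (cases "norm z = 0") (auto simp: powr_numeral)

lemma in_L2_iff:
  "f \<in> borel_measurable borel \<Longrightarrow> abs_L0 f \<in> Lp 2 \<longleftrightarrow> integrable lborel (\<lambda>x. (norm (f x))\<^sup>2)"
  by (simp add: abs_in_Lp powr_2_eq_power2)

lemma L2_norm_square:
  "f \<in> borel_measurable borel \<Longrightarrow> (Lp_norm 2 (abs_L0 f))\<^sup>2 = (LINT x|lborel. (norm (f x))\<^sup>2)"
  using integral_powr_norm[of f 2] powr_2_eq_power2[of "Lp_norm 2 (abs_L0 f)"]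
  by (simp add: powr_2_eq_power2)

lemma weak_derivative_scaleC:
  assumes "weak_derivative F F'" shows "weak_derivative (scaleC c F) (scaleC c F')"
proof -
  obtain f where f [measurable]: "f \<in> borel_measurable borel" "F = abs_L0 f" by (rule L0_cases)
  obtain f' where f' [measurable]: "f' \<in> borel_measurable borel" "F' = abs_L0 f'" by (rule L0_cases)
  show ?thesis using assms by (simp add: f f' abs_L0_scaleC weak_derivative_abs mult.assoc)
qed

lemma weak_derivative_uminus: "weak_derivative F F' \<Longrightarrow> weak_derivative (- F) (- F')"
  using weak_derivative_scaleC[of F F' "-1"] by (simp add: scaleC_minus_one)

lemma weak_derivative_add:
  assumes "weak_derivative F F'" "weak_derivative H H'" and L2: "F \<in> Lp 2" "F' \<in> Lp 2" "H \<in> Lp 2" "H' \<in> Lp 2"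
  shows "weak_derivative (F + H) (F' + H')"
proof -
  obtain f where f [measurable]: "f \<in> borel_measurable borel" "F = abs_L0 f" by (rule L0_cases)
  obtain f' where f' [measurable]: "f' \<in> borel_measurable borel" "F' = abs_L0 f'" by (rule L0_cases)
  obtain h where h [measurable]: "h \<in> borel_measurable borel" "H = abs_L0 h" by (rule L0_cases)
  obtain h' where h' [measurable]: "h' \<in> borel_measurable borel" "H' = abs_L0 h'" by (rule L0_cases)
  have sq: "integrable lborel (\<lambda>x. (norm (f x))\<^sup>2)" "integrable lborel (\<lambda>x. (norm (f' x))\<^sup>2)"
    "integrable lborel (\<lambda>x. (norm (h x))\<^sup>2)" "integrable lborel (\<lambda>x. (norm (h' x))\<^sup>2)"
    using L2 by (simp_all add: f f' h h' in_L2_iff)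
  show ?thesis
    unfolding f(2) f'(2) h(2) h'(2) abs_L0_add[OF f(1) h(1)] abs_L0_add[OF f'(1) h'(1)]
  proof (subst weak_derivative_abs, measurable, intro allI impI)
    fix \<phi> assume \<phi>: "test_function \<phi>"
    obtain M where M: "continuous_on UNIV \<phi>" "continuous_on UNIV (deriv \<phi>)"
      "\<And>x. M \<le> \<bar>x\<bar> \<Longrightarrow> \<phi> x = 0" "\<And>x. M \<le> \<bar>x\<bar> \<Longrightarrow> deriv \<phi> x = 0"
      using test_functionE[OF \<phi>] by metis
    have supp: "x \<in> {- M..M}" if "\<phi> x \<noteq> 0 \<or> deriv \<phi> x \<noteq> 0" for x
      using M(3,4)[of x] that by (cases "M \<le> \<bar>x\<bar>") auto
    note i = integrable_L2_mult_compact_support[where c = "- M" and d = M]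
    have "integrable lborel (\<lambda>x. f x * of_real (deriv \<phi> x))" "integrable lborel (\<lambda>x. h x * of_real (deriv \<phi> x))"
      "integrable lborel (\<lambda>x. f' x * of_real (\<phi> x))" "integrable lborel (\<lambda>x. h' x * of_real (\<phi> x))"
      using sq M supp by (auto intro!: i)
    then show "(LINT x|lborel. (f x + h x) * of_real (deriv \<phi> x)) = - (LINT x|lborel. (f' x + h' x) * of_real (\<phi> x))"
      using assms(1,2) \<phi> by (simp add: f f' h h' weak_derivative_abs distrib_right)
  qed
qed

definition L2_resolvent :: "real \<Rightarrow> L0 \<Rightarrow> L0" where
  "L2_resolvent m F = abs_L0 (resolvent m (rep_L0 F))"

context
  fixes m :: real and F :: L0 assumes m: "m > 0" and F: "F \<in> Lp 2"
begin

lemma rep_square_integrable: "integrable lborel (\<lambda>x. (norm (rep_L0 F x))\<^sup>2)"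
  using F in_L2_iff[OF rep_L0_measurable, of F] by (simp add: abs_rep_L0)

lemmas resolvent_facts = m rep_L0_measurable rep_square_integrable

lemma L2_resolvent_in_L2: "L2_resolvent m F \<in> Lp 2"
  unfolding L2_resolvent_def by (simp add: in_L2_iff resolvent_measurable resolvent_square_integrable resolvent_facts)

lemma diff_L2_resolvent:
  "F - scaleC (of_real m) (L2_resolvent m F) = abs_L0 (\<lambda>x. rep_L0 F x - m *\<^sub>R resolvent m (rep_L0 F) x)"
proof -
  have [measurable]: "resolvent m (rep_L0 F) \<in> borel_measurable borel" by (rule resolvent_measurable[OF resolvent_facts])
  have "F - scaleC (of_real m) (L2_resolvent m F) = abs_L0 (rep_L0 F) - abs_L0 (\<lambda>x. of_real m * resolvent m (rep_L0 F) x)"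
    by (simp add: L2_resolvent_def abs_L0_scaleC abs_rep_L0)
  also have "\<dots> = abs_L0 (\<lambda>x. rep_L0 F x - of_real m * resolvent m (rep_L0 F) x)"
    by (rule abs_L0_diff) measurable
  finally show ?thesis by (simp add: scaleR_conv_of_real)
qed

lemma L2_resolvent_weak_derivative:
  "weak_derivative (L2_resolvent m F) (F - scaleC (of_real m) (L2_resolvent m F))"
  unfolding diff_L2_resolvent using resolvent_weak_derivative[OF resolvent_facts] by (simp add: L2_resolvent_def)

lemma L2_resolvent_contraction: "Lp_norm 2 (F - scaleC (of_real m) (L2_resolvent m F)) \<le> Lp_norm 2 F"
proof (rule power2_le_imp_le)
  have [measurable]: "resolvent m (rep_L0 F) \<in> borel_measurable borel" by (rule resolvent_measurable[OF resolvent_facts])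
  have "(Lp_norm 2 (F - scaleC (of_real m) (L2_resolvent m F)))\<^sup>2 = (LINT x|lborel. (norm (rep_L0 F x - m *\<^sub>R resolvent m (rep_L0 F) x))\<^sup>2)"
    unfolding diff_L2_resolvent by (rule L2_norm_square) measurable
  also have "\<dots> \<le> (LINT x|lborel. (norm (rep_L0 F x))\<^sup>2)" by (rule resolvent_contraction[OF resolvent_facts])
  also have "\<dots> = (Lp_norm 2 F)\<^sup>2" using L2_norm_square[OF rep_L0_measurable, of F] by (simp add: abs_rep_L0)
  finally show "(Lp_norm 2 (F - scaleC (of_real m) (L2_resolvent m F)))\<^sup>2 \<le> (Lp_norm 2 F)\<^sup>2" .
qed simp

lemma L2_resolvent_small:
  assumes "integrable lborel (rep_L0 F)"
  shows "(Lp_norm 2 (scaleC (of_real m) (L2_resolvent m F)))\<^sup>2 \<le> m * (LINT x|lborel. norm (rep_L0 F x))\<^sup>2"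
  using resolvent_small[OF resolvent_facts assms] m
  by (simp add: Lp_norm_scaleC power_mult_distrib L2_resolvent_def L2_norm_square resolvent_measurable resolvent_facts)

end

text \<open>Uniqueness for the resolvent equation: the difference of the two candidates satisfies
  \<open>u' = - m u\<close> weakly and lies in \<open>L\<^sup>2\<close>, so it vanishes.\<close>

lemma weak_derivative_imp_L2_resolvent:
  assumes w: "weak_derivative Y Y'" and Y: "Y \<in> Lp 2" "Y' \<in> Lp 2" and m: "m > 0"
  shows "Y = L2_resolvent m (scaleC (of_real m) Y + Y')"
proof -
  define Z where "Z = scaleC (of_real m) Y + Y'"
  have Z: "Z \<in> Lp 2" unfolding Z_def by (intro Lp_add Lp_scaleC Y) auto
  let ?R = "L2_resolvent m Z"
  have R: "?R \<in> Lp 2" "Z - scaleC (of_real m) ?R \<in> Lp 2"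
    by (auto intro!: Lp_diff Lp_scaleC L2_resolvent_in_L2 m Z)
  have "weak_derivative (Y + - ?R) (Y' + - (Z - scaleC (of_real m) ?R))"
    by (intro weak_derivative_add weak_derivative_uminus w L2_resolvent_weak_derivative m Z Y Lp_uminus R)
  moreover have "Y' + - (Z - scaleC (of_real m) ?R) = scaleC (- of_real m) (Y - ?R)"
    by (simp add: Z_def L0.scale_right_diff_distrib L0.scale_minus_left)
  ultimately have wd: "weak_derivative (Y - ?R) (scaleC (- of_real m) (Y - ?R))" by simp
  obtain u where u [measurable]: "u \<in> borel_measurable borel" "Y - ?R = abs_L0 u" by (rule L0_cases)
  have "Y - ?R \<in> Lp 2" by (intro Lp_diff Y R) simp
  then have "AE x in lborel. u x = 0"
    using wd[unfolded u(2) abs_L0_scaleC[OF u(1)]] m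
    by (intro weak_exponential_zero[of u m]) (auto simp: u in_L2_iff)
  then have "Y - ?R = 0" by (simp add: u zero_L0_abs abs_L0_eq_iff)
  then show ?thesis by (simp add: Z_def)
qed

lemma truncation_dense_L2:
  assumes F: "F \<in> Lp 2" and e: "e > 0"
  obtains H where "H \<in> Lp 2" "integrable lborel (rep_L0 H)" "Lp_norm 2 (F - H) < e"
proof -
  obtain f where f [measurable]: "f \<in> borel_measurable borel" and Ff: "F = abs_L0 f" by (rule L0_cases)
  have sq: "integrable lborel (\<lambda>x. (norm (f x))\<^sup>2)" using F by (simp add: Ff in_L2_iff)
  let ?h = "\<lambda>n x. f x * indicator {- real n<..<real n} x"
  have "(\<lambda>n. LINT x|lborel. (norm (f x - ?h n x))\<^sup>2) \<longlonglongrightarrow> (LINT x::real|lborel. (0::real))"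
  proof (rule integral_dominated_convergence[OF _ _ sq])
    show "AE x in lborel. (\<lambda>n. (norm (f x - ?h n x))\<^sup>2) \<longlonglongrightarrow> 0"
    proof (rule AE_I2)
      fix x
      obtain N where N: "\<bar>x\<bar> < real N" using reals_Archimedean2 by blast
      have "\<forall>\<^sub>F n in sequentially. (norm (f x - ?h n x))\<^sup>2 = 0"
        using eventually_ge_at_top[of N] by eventually_elim (use N in \<open>auto simp: indicator_def abs_less_iff\<close>)
      then show "(\<lambda>n. (norm (f x - ?h n x))\<^sup>2) \<longlonglongrightarrow> 0" by (rule tendsto_eventually)
    qed
  qed (auto simp: indicator_def)
  then have "\<forall>\<^sub>F n in sequentially. (LINT x|lborel. (norm (f x - ?h n x))\<^sup>2) < e\<^sup>2"
    using e by (intro order_tendstoD(2)[of _ 0]) auto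
  then obtain n where n: "(LINT x|lborel. (norm (f x - ?h n x))\<^sup>2) < e\<^sup>2" by (auto simp: eventually_sequentially)
  have hm [measurable]: "?h n \<in> borel_measurable borel" by measurable
  define H where "H = abs_L0 (?h n)"
  have ae: "AE x in lborel. rep_L0 H x = ?h n x"
    using abs_L0_eq_iff[OF rep_L0_measurable hm, of H] by (simp add: abs_rep_L0 H_def)
  show ?thesis
  proof (rule that)
    show "H \<in> Lp 2" unfolding H_def
      by (subst in_L2_iff[OF hm], rule Bochner_Integration.integrable_bound[OF sq]) (auto simp: indicator_def)
    show "integrable lborel (rep_L0 H)"
      using ae square_integrable_interval(1)[OF f sq, of "- real n" "real n"] by (subst integrable_cong_AE) auto
    have "(Lp_norm 2 (F - H))\<^sup>2 < e\<^sup>2"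
      using n by (simp add: Ff H_def abs_L0_diff L2_norm_square)
    then show "Lp_norm 2 (F - H) < e" by (rule power2_less_imp_less) (use e in simp)
  qed
qed

section \<open>\<open>L\<^sup>2\<close> as a real Banach space\<close>

typedef L2 = "Lp 2" by (rule exI[of _ 0]) simp

setup_lifting type_definition_L2

instantiation L2 :: real_normed_vector
begin

lift_definition zero_L2 :: L2 is 0 by simp
lift_definition plus_L2 :: "L2 \<Rightarrow> L2 \<Rightarrow> L2" is "(+)" by (rule Lp_add) auto
lift_definition minus_L2 :: "L2 \<Rightarrow> L2 \<Rightarrow> L2" is "(-)" by (rule Lp_diff) auto
lift_definition uminus_L2 :: "L2 \<Rightarrow> L2" is uminus by (rule Lp_uminus)
lift_definition scaleR_L2 :: "real \<Rightarrow> L2 \<Rightarrow> L2" is "\<lambda>r. scaleC (of_real r)" by (rule Lp_scaleC)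
lift_definition norm_L2 :: "L2 \<Rightarrow> real" is "Lp_norm 2" .

definition dist_L2 :: "L2 \<Rightarrow> L2 \<Rightarrow> real" where "dist_L2 x y = norm (x - y)"
definition sgn_L2 :: "L2 \<Rightarrow> L2" where "sgn_L2 x = inverse (norm x) *\<^sub>R x"
definition uniformity_L2 :: "(L2 \<times> L2) filter" where
  "uniformity_L2 = (INF e\<in>{0<..}. principal {(x, y). dist x y < e})"
definition open_L2 :: "L2 set \<Rightarrow> bool" where
  "open_L2 U \<longleftrightarrow> (\<forall>x\<in>U. \<forall>\<^sub>F (x', y) in uniformity. x' = x \<longrightarrow> y \<in> U)"

instance
proof
  fix x y :: L2 and a b :: real
  show "a *\<^sub>R (x + y) = a *\<^sub>R x + a *\<^sub>R y" by transfer (simp add: L0.scale_right_distrib)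
  show "(a + b) *\<^sub>R x = a *\<^sub>R x + b *\<^sub>R x" by transfer (simp add: L0.scale_left_distrib)
  show "a *\<^sub>R b *\<^sub>R x = (a * b) *\<^sub>R x" by transfer simp
  show "norm x = 0 \<longleftrightarrow> x = 0" by transfer (simp add: Lp_norm_eq_0_iff)
  show "norm (x + y) \<le> norm x + norm y" by transfer (simp add: Lp_norm_triangle)
  show "norm (a *\<^sub>R x) = \<bar>a\<bar> * norm x" by transfer (simp add: Lp_norm_scaleC)
qed (simp_all add: dist_L2_def sgn_L2_def uniformity_L2_def open_L2_def, (transfer, simp add: algebra_simps)+)

end

instance L2 :: banach
proof
  fix X :: "nat \<Rightarrow> L2" assume X: "Cauchy X"
  have "\<exists>F\<in>Lp 2. (\<lambda>n. Lp_norm 2 (Rep_L2 (X n) - F)) \<longlonglongrightarrow> 0"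
  proof (rule Lp_complete)
    fix e :: real assume "e > 0"
    then obtain N where N: "\<And>m n. m \<ge> N \<Longrightarrow> n \<ge> N \<Longrightarrow> norm (X m - X n) < e"
      using X unfolding Cauchy_def dist_norm by blast
    then show "\<exists>N. \<forall>m\<ge>N. \<forall>n\<ge>N. Lp_norm 2 (Rep_L2 (X m) - Rep_L2 (X n)) < e"
      by (intro exI[of _ N]) (simp add: norm_L2.rep_eq minus_L2.rep_eq)
  qed (use Rep_L2 in auto)
  then obtain F where F: "F \<in> Lp 2" "(\<lambda>n. Lp_norm 2 (Rep_L2 (X n) - F)) \<longlonglongrightarrow> 0" by blast
  have "(\<lambda>n. norm (X n - Abs_L2 F)) \<longlonglongrightarrow> 0"
    using F by (simp add: norm_L2.rep_eq minus_L2.rep_eq Abs_L2_inverse)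
  then show "convergent X"
    unfolding convergent_def using tendsto_norm_zero_iff LIM_zero_iff by blast
qed

text \<open>\<open>y' = - x\<close> means \<open>A y = x\<close>, so \<open>y\<close> is the image
  of \<open>x\<close> under the inverse; membership in \<open>Lp 2\<close> is part of the
  type.\<close>

definition inv_graph :: "(L2 \<times> L2) set" where
  "inv_graph = {(x, y). weak_derivative (Rep_L2 y) (- Rep_L2 x)}"

lemma inv_graph_iff: "(x, y) \<in> inv_graph \<longleftrightarrow> (Rep_L2 x, Rep_L2 y) \<in> (neg_ddx 2)\<inverse>"
proof
  assume "(x, y) \<in> inv_graph"
  then have w: "weak_derivative (Rep_L2 y) (- Rep_L2 x)" by (simp add: inv_graph_def)
  have "- Rep_L2 x \<in> Lp 2" by (rule Lp_uminus[OF Rep_L2])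
  then have "Rep_L2 y \<in> W1p 2" unfolding W1p_def using w Rep_L2[of y] by blast
  then show "(Rep_L2 x, Rep_L2 y) \<in> (neg_ddx 2)\<inverse>"
    unfolding neg_ddx_def using w \<open>- Rep_L2 x \<in> Lp 2\<close>
    by (auto intro!: exI[of _ "- Rep_L2 x"])
qed (auto simp: neg_ddx_def inv_graph_def)

text \<open>For the resolvent \<open>R\<close> the equation \<open>A R z = l R z - z\<close> says
  that the inverse maps \<open>z - l R z\<close> to \<open>- R z\<close>. These pairs solve
  \<open>x - l y = z\<close>.\<close>

lemma inv_graph_resolvent:
  assumes "l > 0"
  shows "(Abs_L2 (Rep_L2 z - scaleC (of_real l) (L2_resolvent l (Rep_L2 z))), Abs_L2 (- L2_resolvent l (Rep_L2 z))) \<in> inv_graph"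
proof -
  have R: "L2_resolvent l (Rep_L2 z) \<in> Lp 2" by (rule L2_resolvent_in_L2[OF assms Rep_L2])
  then have "Rep_L2 z - scaleC (of_real l) (L2_resolvent l (Rep_L2 z)) \<in> Lp 2"
    by (intro Lp_diff Lp_scaleC Rep_L2) auto
  then show ?thesis
    using weak_derivative_uminus[OF L2_resolvent_weak_derivative[OF assms Rep_L2[of z]]] R
    by (simp add: inv_graph_def Abs_L2_inverse Lp_uminus)
qed

lemma inv_graph_scaleC:
  "(x, y) \<in> inv_graph \<Longrightarrow> (Abs_L2 (scaleC c (Rep_L2 x)), Abs_L2 (scaleC c (Rep_L2 y))) \<in> inv_graph"
  unfolding inv_graph_def using weak_derivative_scaleC[of "Rep_L2 y" "- Rep_L2 x" c]
  by (simp add: Abs_L2_inverse Lp_scaleC Rep_L2)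

text \<open>With \<open>Z = l y - x\<close> uniqueness identifies \<open>y\<close> as the resolvent
  of \<open>Z\<close>, so \<open>- x\<close> is \<open>Z - l R Z\<close>, and the contraction
  estimate applies to \<open>Z\<close>.\<close>

lemma inv_graph_dissipative:
  assumes B: "(x, y) \<in> inv_graph" and l: "0 < l"
  shows "norm x \<le> norm (x - l *\<^sub>R y)"
proof -
  let ?X = "Rep_L2 x" and ?Y = "Rep_L2 y"
  define Z where "Z = scaleC (of_real l) ?Y + - ?X"
  have Z: "Z \<in> Lp 2" unfolding Z_def by (intro Lp_add Lp_scaleC Lp_uminus Rep_L2) simp
  have "?Y = L2_resolvent l Z" unfolding Z_def
    using B by (intro weak_derivative_imp_L2_resolvent Lp_uminus Rep_L2 l) (simp add: inv_graph_def)
  then have "Z - scaleC (of_real l) (L2_resolvent l Z) = - ?X" by (simp add: Z_def)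
  then have "Lp_norm 2 (- ?X) \<le> Lp_norm 2 Z" using L2_resolvent_contraction[OF l Z] by simp
  then have "Lp_norm 2 ?X \<le> Lp_norm 2 (- Z)" by (simp add: Lp_norm_uminus)
  then show ?thesis by (simp add: norm_L2.rep_eq minus_L2.rep_eq scaleR_L2.rep_eq Z_def)
qed

lemma inv_graph_dense: "closure (Domain inv_graph) = UNIV"
proof -
  have "\<exists>x\<in>Domain inv_graph. dist x z < e" if e: "e > 0" for z e
  proof -
    obtain H where H: "H \<in> Lp 2" "integrable lborel (rep_L0 H)" "Lp_norm 2 (Rep_L2 z - H) < e / 2"
      by (rule truncation_dense_L2[OF Rep_L2[of z], of "e / 2"]) (use e in auto)
    \<comment> \<open>The \<open>+ 1\<close> makes \<open>C\<close> positive and the next estimate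
      strict; \<open>l\<close> is then chosen so that \<open>l * C\<close> is the square of
      \<open>e / 2\<close>.\<close>
    define C where "C = (LINT x|lborel. norm (rep_L0 H x))\<^sup>2 + 1"
    have C: "C > 0" unfolding C_def by (simp add: add_nonneg_pos)
    define l where "l = (e / 2)\<^sup>2 / C"
    have l: "l > 0" using e C by (simp add: l_def)
    have "(Lp_norm 2 (scaleC (of_real l) (L2_resolvent l H)))\<^sup>2 \<le> l * (LINT x|lborel. norm (rep_L0 H x))\<^sup>2"
      by (rule L2_resolvent_small[OF l H(1,2)])
    also have "\<dots> < l * C" using l by (simp add: C_def)
    also have "\<dots> = (e / 2)\<^sup>2" using C by (simp add: l_def)
    finally have small: "Lp_norm 2 (scaleC (of_real l) (L2_resolvent l H)) < e / 2"
      by (rule power2_less_imp_less) (use e in simp)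
    define x where "x = Abs_L2 (H - scaleC (of_real l) (L2_resolvent l H))"
    have sc: "scaleC (of_real l) (L2_resolvent l H) \<in> Lp 2" by (intro Lp_scaleC L2_resolvent_in_L2 l H)
    have "(x, Abs_L2 (- L2_resolvent l H)) \<in> inv_graph"
      using inv_graph_resolvent[OF l, of "Abs_L2 H"] H by (simp add: x_def Abs_L2_inverse)
    moreover have "dist x z < e"
    proof -
      have "dist x z = Lp_norm 2 (Rep_L2 z - (H - scaleC (of_real l) (L2_resolvent l H)))"
        using H sc by (simp add: dist_norm norm_L2.rep_eq minus_L2.rep_eq x_def Abs_L2_inverse Lp_diff Lp_norm_minus_commute)
      also have "\<dots> = Lp_norm 2 ((Rep_L2 z - H) + scaleC (of_real l) (L2_resolvent l H))" by (simp add: algebra_simps)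
      also have "\<dots> \<le> Lp_norm 2 (Rep_L2 z - H) + Lp_norm 2 (scaleC (of_real l) (L2_resolvent l H))"
        by (intro Lp_norm_triangle Lp_diff Rep_L2 H sc) auto
      also have "\<dots> < e" using H(3) small by simp
      finally show ?thesis .
    qed
    ultimately show ?thesis by blast
  qed
  then show ?thesis by (auto simp: closure_approachable)
qed

lemma inv_graph_subspace: "subspace inv_graph"
proof (rule subspaceI)
  have "weak_derivative (scaleC 0 0) (scaleC 0 0)"
    using L2_resolvent_weak_derivative[of 1 0] weak_derivative_scaleC[of _ _ 0] by fastforce
  then show "0 \<in> inv_graph" by (simp add: inv_graph_def zero_prod_def zero_L2.rep_eq)
  show "p + q \<in> inv_graph" if "p \<in> inv_graph" "q \<in> inv_graph" for p q
  proof -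
    have "weak_derivative (Rep_L2 (snd p) + Rep_L2 (snd q)) (- Rep_L2 (fst p) + - Rep_L2 (fst q))"
      using that by (intro weak_derivative_add Rep_L2 Lp_uminus) (auto simp: inv_graph_def)
    then show ?thesis by (simp add: inv_graph_def plus_prod_def plus_L2.rep_eq)
  qed
  show "c *\<^sub>R p \<in> inv_graph" if "p \<in> inv_graph" for c p
    using inv_graph_scaleC[of "fst p" "snd p" "of_real c"] that
    by (metis Rep_L2_inverse prod.collapse scaleR_L2.rep_eq scaleR_prod_def)
qed

interpretation inv: m_dissipative inv_graph
proof
  show "\<exists>x y. (x, y) \<in> inv_graph \<and> x - l *\<^sub>R y = z" if l: "0 < l" for l z
  proof (intro exI conjI)
    show "(Abs_L2 (Rep_L2 z - scaleC (of_real l) (L2_resolvent l (Rep_L2 z))), Abs_L2 (- L2_resolvent l (Rep_L2 z))) \<in> inv_graph"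
      by (rule inv_graph_resolvent[OF l])
    have R: "L2_resolvent l (Rep_L2 z) \<in> Lp 2" by (rule L2_resolvent_in_L2[OF l Rep_L2])
    then have "Rep_L2 z - scaleC (of_real l) (L2_resolvent l (Rep_L2 z)) \<in> Lp 2"
      by (intro Lp_diff Lp_scaleC Rep_L2) auto
    then show "Abs_L2 (Rep_L2 z - scaleC (of_real l) (L2_resolvent l (Rep_L2 z))) - l *\<^sub>R Abs_L2 (- L2_resolvent l (Rep_L2 z)) = z"
      using R by (simp add: Rep_L2_inject[symmetric] minus_L2.rep_eq scaleR_L2.rep_eq Abs_L2_inverse Lp_uminus)
  qed
qed (rule inv_graph_subspace inv_graph_dense | erule (1) inv_graph_dissipative)+

section \<open>The semigroup generated for \<open>p = 2\<close>\<close>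

definition inv_semigroup :: "real \<Rightarrow> L0 \<Rightarrow> L0" where
  "inv_semigroup t F = Rep_L2 (inv.T t (Abs_L2 F))"

lemma inv_semigroup_in_L2: "inv_semigroup t F \<in> Lp 2"
  by (simp add: inv_semigroup_def Rep_L2)

lemma Abs_L2_arith:
  assumes "F \<in> Lp 2" "H \<in> Lp 2"
  shows "Abs_L2 (F + H) = Abs_L2 F + Abs_L2 H" "Abs_L2 (F - H) = Abs_L2 F - Abs_L2 H"
  using assms by (simp_all add: Rep_L2_inject[symmetric] plus_L2.rep_eq minus_L2.rep_eq Abs_L2_inverse Lp_add Lp_diff)

text \<open>The locale gives real linearity only. Multiplication by \<open>c\<close> is bounded and
  maps \<open>inv_graph\<close> into itself, so it commutes with the semigroup.\<close>

lemma inv_semigroup_scaleC: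
  assumes F: "F \<in> Lp 2" and t: "0 \<le> t"
  shows "inv_semigroup t (scaleC c F) = scaleC c (inv_semigroup t F)"
proof -
  let ?C = "\<lambda>x. Abs_L2 (scaleC c (Rep_L2 x))"
  have "bounded_linear ?C"
  proof (rule bounded_linear_intro[where K = "norm c"])
    show "?C (x + y) = ?C x + ?C y" for x y
      by (simp add: Rep_L2_inject[symmetric] plus_L2.rep_eq Abs_L2_inverse Lp_scaleC Lp_add Rep_L2 L0.scale_right_distrib)
    show "?C (r *\<^sub>R x) = r *\<^sub>R ?C x" for r x
      by (simp add: Rep_L2_inject[symmetric] scaleR_L2.rep_eq Abs_L2_inverse Lp_scaleC Rep_L2 mult.commute)
    show "norm (?C x) \<le> norm x * norm c" for x
      by (simp add: norm_L2.rep_eq Abs_L2_inverse Lp_scaleC Rep_L2 Lp_norm_scaleC)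
  qed
  from inv.T_commute_gen[OF this inv_graph_scaleC t, of "Abs_L2 F"] F
  show ?thesis by (simp add: inv_semigroup_def Abs_L2_inverse Lp_scaleC Rep_L2)
qed

lemma inv_semigroup_C0: "C0_semigroup 2 inv_semigroup"
  unfolding C0_semigroup_def bounded_operator_def
proof (intro conjI allI impI ballI)
  fix t :: real assume t: "0 \<le> t"
  show "inv_semigroup t F \<in> Lp 2" for F by (rule inv_semigroup_in_L2)
  show "inv_semigroup t (F + H) = inv_semigroup t F + inv_semigroup t H" if "F \<in> Lp 2" "H \<in> Lp 2" for F H
    using that by (simp add: inv_semigroup_def Abs_L2_arith inv.T_simps[OF t] plus_L2.rep_eq)
  show "inv_semigroup t (scaleC c F) = scaleC c (inv_semigroup t F)" if "F \<in> Lp 2" for c F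
    by (rule inv_semigroup_scaleC[OF that t])
  have "Lp_norm 2 (inv_semigroup t F) \<le> 1 * Lp_norm 2 F" if "F \<in> Lp 2" for F
    using that inv.T_simps(4)[OF t, of "Abs_L2 F"] by (simp add: inv_semigroup_def norm_L2.rep_eq Abs_L2_inverse)
  then show "\<exists>K. \<forall>f\<in>Lp 2. Lp_norm 2 (inv_semigroup t f) \<le> K * Lp_norm 2 f" by blast
next
  fix F assume "F \<in> Lp 2"
  then show "inv_semigroup 0 F = F" by (simp add: inv_semigroup_def inv.T_zero Abs_L2_inverse)
next
  fix s t :: real and F assume "0 \<le> s" "0 \<le> t"
  then show "inv_semigroup (s + t) F = inv_semigroup s (inv_semigroup t F)"
    by (simp add: inv_semigroup_def inv.T_add Rep_L2_inverse)
next
  fix F s assume s: "0 \<le> (s :: real)"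
  have "((\<lambda>t. norm (inv.T t (Abs_L2 F) - inv.T s (Abs_L2 F))) \<longlongrightarrow> 0) (at s within {0..})"
    using inv.T_continuous[OF s, of "Abs_L2 F"] by (simp add: tendsto_norm_zero_iff LIM_zero_iff)
  then show "((\<lambda>t. Lp_norm 2 (inv_semigroup t F - inv_semigroup s F)) \<longlongrightarrow> 0) (at s within {0..})"
    by (simp add: norm_L2.rep_eq minus_L2.rep_eq inv_semigroup_def)
qed

lemma inv_semigroup_generator: "generator 2 inv_semigroup = (neg_ddx 2)\<inverse>"
proof -
  have gen: "(F, H) \<in> generator 2 inv_semigroup \<longleftrightarrow> (F, H) \<in> (neg_ddx 2)\<inverse>" if FH: "F \<in> Lp 2" "H \<in> Lp 2" for F H
  proof -
    have "(F, H) \<in> generator 2 inv_semigroup \<longleftrightarrow>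
        ((\<lambda>t. norm ((1 / t) *\<^sub>R (inv.T t (Abs_L2 F) - Abs_L2 F) - Abs_L2 H)) \<longlongrightarrow> 0) (at_right 0)"
      using FH by (simp add: generator_def norm_L2.rep_eq minus_L2.rep_eq scaleR_L2.rep_eq inv_semigroup_def Abs_L2_inverse)
    also have "\<dots> \<longleftrightarrow> ((\<lambda>t. (1 / t) *\<^sub>R (inv.T t (Abs_L2 F) - Abs_L2 F)) \<longlongrightarrow> Abs_L2 H) (at_right 0)"
      by (simp only: tendsto_norm_zero_iff LIM_zero_iff)
    also have "\<dots> \<longleftrightarrow> (Abs_L2 F, Abs_L2 H) \<in> inv_graph"
      using inv.T_has_generator inv.generator_imp_B by blast
    also have "\<dots> \<longleftrightarrow> (F, H) \<in> (neg_ddx 2)\<inverse>" using FH by (simp add: inv_graph_iff Abs_L2_inverse)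
    finally show ?thesis .
  qed
  have 1: "F \<in> Lp 2 \<and> H \<in> Lp 2" if "(F, H) \<in> generator 2 inv_semigroup" for F H using that by (simp add: generator_def)
  have 2: "F \<in> Lp 2 \<and> H \<in> Lp 2" if "(F, H) \<in> (neg_ddx 2)\<inverse>" for F H
    using that by (auto simp: neg_ddx_def W1p_def Lp_uminus)
  show ?thesis
  proof (rule set_eqI)
    fix z
    show "z \<in> generator 2 inv_semigroup \<longleftrightarrow> z \<in> (neg_ddx 2)\<inverse>"
      using gen[of "fst z" "snd z"] 1[of "fst z" "snd z"] 2[of "fst z" "snd z"] unfolding prod.collapse by blast
  qed
qed

theorem generates_2: "generates_C0_semigroup 2 ((neg_ddx 2)\<inverse>)"
  using inv_semigroup_C0 inv_semigroup_generator by (auto simp: generates_C0_semigroup_def)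

theorem theorem3p2:
  fixes p :: real
  assumes "1 < p"
  shows "generates_C0_semigroup p ((neg_ddx p)\<inverse>) \<longleftrightarrow> p = 2"
  using assms generates_2 not_generates[of p] by auto

end
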